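(* Assume that $\bar K(\epsilon)>0$ for all $\epsilon\in(0,1]$. Let $\Omega$ be the allowed region of an eternally expanding $K<0$ McVittie spacetime and let $(t_0,r_0)\in\Omega$. Then the unique outgoing radial null geodesic (affinely parametrised) $s\mapsto(t(s),r_{ORNG}(s))$ with $(t(0),r_{ORNG}(0))=(t_0,r_0)$ is future-complete and satisfies $\lim_{s\to+\infty}(t(s),r_{ORNG}(s))=(+\infty,+\infty)$.
   Context: Setting: $M>0$, $\Lambda\in\mathbb{R}$ (necessarily $\Lambda\ge0$ here), $K=-1$ (normalisation of $K<0$), scale factor $a:(0,+\infty)\to\mathbb{R}_+$, $H=a'/a$, $\kappa(t,r)=1-\frac{2M}{r}+\frac{r^2}{a^2(t)}$; $r_1(t)$ is the unique positive zero of $\kappa(t,\cdot)$; $\Omega=\{(t,r):t>0,\ r>r_1(t)\}$. The spacetime is $\Omega\times\mathbb{S}^2$ with $$ds^2=-\sigma^2(H^{-2}-r^2\kappa^{-1})dt^2-2\sigma r\kappa^{-1}dt\,dr+\kappa^{-1}dr^2+r^2d\omega^2,\qquad \sigma=\frac{H}{a^2}\kappa^{1/2}\int_r^\infty\bar r\,\kappa^{-3/2}(t,\bar r)\,d\bar r.$$ "Eternally expanding McVittie spacetime" means: $H(t)>0$ for all $t>0$ and (i) $a\in C^2((0,\infty),\mathbb{R}_+)$; (ii) $\lim_{t\to0^+}a=0$; (iii) $\mu_{FLRW}>0$, $\mu_{FLRW}+P_{FLRW}>0$, $\mu_{FLRW}+3P_{FLRW}>0$ for all $t>0$, where $8\pi\mu_{FLRW}+\Lambda=3(H^2+Ka^{-2})$,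 $8\pi P_{FLRW}-\Lambda=-2H'-3H^2-Ka^{-2}$; (iv) $\lim_{a\to0^+}aH=+\infty$ and $(aH)^2\sim-K+\frac\Lambda3a^2$ as $a\to+\infty$. $$\bar K(\epsilon)=3\epsilon^{3/2}J(\epsilon)-2,\qquad J(\epsilon)=\int_0^1(1-\xi)^{-1/2}(2\xi+\epsilon)(\xi^2+\epsilon\xi+\epsilon)^{-5/2}d\xi.$$ Outgoing radial null geodesics are null geodesics with constant angular coordinates satisfying, in the $(t,r)$-plane, $\frac{dr}{dt}=\sigma(r+\kappa^{1/2}H^{-1})$. The affine parameter $s$ is oriented so that $t$ increases with $s$; it is unique up to positive rescaling once $s=0$ is fixed. Future-complete means that $s$ extends to $+\infty$. *)

theory Defs
  imports "HOL-Analysis.Analysis" "HOL-Library.Landau_Symbols"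
begin

section \<open>Null geodesics of a metric in coordinates\<close>

definition partial_deriv :: "'n \<Rightarrow> (real ^ 'n \<Rightarrow> real) \<Rightarrow> real ^ 'n \<Rightarrow> real" where
  "partial_deriv i f x = deriv (\<lambda>h. f (x + h *\<^sub>R axis i 1)) 0"

definition christoffel ::
  "(real ^ 'n \<Rightarrow> real ^ 'n ^ 'n) \<Rightarrow> real ^ 'n \<Rightarrow> 'n \<Rightarrow> 'n \<Rightarrow> 'n \<Rightarrow> real" where
  "christoffel g x k i j =
     (1/2) * (\<Sum>l\<in>UNIV. matrix_inv (g x) $ k $ l *
        (partial_deriv i (\<lambda>y. g y $ j $ l) x
         + partial_deriv j (\<lambda>y. g y $ i $ l) x
         - partial_deriv l (\<lambda>y. g y $ i $ j) x))"

abbreviation velocity :: "(real \<Rightarrow> real ^ 'n) \<Rightarrow> real \<Rightarrow> real ^ 'n" where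
  "velocity \<gamma> s \<equiv> vector_derivative \<gamma> (at s)"

definition affine_geodesic_on ::
  "real set \<Rightarrow> (real ^ 'n \<Rightarrow> real ^ 'n ^ 'n) \<Rightarrow> (real ^ 'n) set \<Rightarrow> (real \<Rightarrow> real ^ 'n) \<Rightarrow> bool" where
  "affine_geodesic_on I g U \<gamma> \<longleftrightarrow>
     (\<forall>s\<in>I. \<gamma> s \<in> U \<and> \<gamma> differentiable (at s) \<and>
        (velocity \<gamma> has_vector_derivative
           (\<chi> k. - (\<Sum>i\<in>UNIV. \<Sum>j\<in>UNIV.
              christoffel g (\<gamma> s) k i j * velocity \<gamma> s $ i * velocity \<gamma> s $ j))) (at s))"

definition null_on ::
  "real set \<Rightarrow> (real ^ 'n \<Rightarrow> real ^ 'n ^ 'n) \<Rightarrow> (real \<Rightarrow> real ^ 'n) \<Rightarrow> bool" where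
  "null_on I g \<gamma> \<longleftrightarrow> (\<forall>s\<in>I. velocity \<gamma> s \<bullet> (g (\<gamma> s) *v velocity \<gamma> s) = 0)"


section \<open>McVittie spacetimes with hyperbolic background\<close>

text \<open>The scale factor \<open>a\<close> only matters on \<open>t > 0\<close>. The curvature is normalised to \<open>K = -1\<close>.\<close>

abbreviation curv :: real where "curv \<equiv> -1"

definition hubble :: "(real \<Rightarrow> real) \<Rightarrow> real \<Rightarrow> real" where
  "hubble a t = deriv a t / a t"

definition \<kappa> :: "real \<Rightarrow> (real \<Rightarrow> real) \<Rightarrow> real \<Rightarrow> real \<Rightarrow> real" where
  "\<kappa> M a t r = 1 - 2 * M / r + r^2 / (a t)^2"

definition r1 :: "real \<Rightarrow> (real \<Rightarrow> real) \<Rightarrow> real \<Rightarrow> real" where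
  "r1 M a t = (THE r. r > 0 \<and> \<kappa> M a t r = 0)"

definition allowed_region :: "real \<Rightarrow> (real \<Rightarrow> real) \<Rightarrow> (real \<times> real) set" where
  "allowed_region M a = {(t, r). t > 0 \<and> r > r1 M a t}"

definition \<sigma> :: "real \<Rightarrow> (real \<Rightarrow> real) \<Rightarrow> real \<Rightarrow> real \<Rightarrow> real" where
  "\<sigma> M a t r = hubble a t / (a t)^2 * sqrt (\<kappa> M a t r) *
     integral {r..} (\<lambda>u. u * \<kappa> M a t u powr (-3/2))"

definition mu_FLRW :: "real \<Rightarrow> (real \<Rightarrow> real) \<Rightarrow> real \<Rightarrow> real" where
  "mu_FLRW \<Lambda> a t = (3 * ((hubble a t)^2 + curv / (a t)^2) - \<Lambda>) / (8 * pi)"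

definition P_FLRW :: "real \<Rightarrow> (real \<Rightarrow> real) \<Rightarrow> real \<Rightarrow> real" where
  "P_FLRW \<Lambda> a t =
     (- 2 * deriv (hubble a) t - 3 * (hubble a t)^2 - curv / (a t)^2 + \<Lambda>) / (8 * pi)"

definition C2_on :: "real set \<Rightarrow> (real \<Rightarrow> real) \<Rightarrow> bool" where
  "C2_on S f \<longleftrightarrow> (\<forall>t\<in>S. f differentiable (at t) \<and> deriv f differentiable (at t))
     \<and> continuous_on S (deriv (deriv f))"

text \<open>
  Since \<open>a' > 0\<close>, the scale factor is a strictly increasing function of \<open>t\<close>, so the limits
  \<open>a \<rightarrow> 0+\<close> and \<open>a \<rightarrow> +\<infinity>\<close> of functions of \<open>a\<close> are the limits \<open>t \<rightarrow> 0+\<close> and \<open>t \<rightarrow> +\<infinity>\<close>.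
  For the latter to make sense \<open>a\<close> has to be unbounded, which is recorded explicitly; for
  \<open>\<Lambda> \<ge> 0\<close> this follows from \<open>mu_FLRW > 0\<close>, which gives \<open>a' > 1\<close>.
\<close>

definition eternally_expanding :: "real \<Rightarrow> (real \<Rightarrow> real) \<Rightarrow> bool" where
  "eternally_expanding \<Lambda> a \<longleftrightarrow>
     (\<forall>t>0. a t > 0) \<and> C2_on {0<..} a \<and>
     (\<forall>t>0. hubble a t > 0) \<and>
     (a \<longlongrightarrow> 0) (at_right 0) \<and>
     (\<forall>t>0. mu_FLRW \<Lambda> a t > 0 \<and>
        mu_FLRW \<Lambda> a t + P_FLRW \<Lambda> a t > 0 \<and>
        mu_FLRW \<Lambda> a t + 3 * P_FLRW \<Lambda> a t > 0) \<and>
     filterlim (\<lambda>t. a t * hubble a t) at_top (at_right 0) \<and>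
     filterlim a at_top at_top \<and>
     (\<lambda>t. (a t * hubble a t)^2) \<sim>[at_top] (\<lambda>t. - curv + \<Lambda> / 3 * (a t)^2)"

text \<open>
  The spacetime is described in the coordinates \<open>(t, r, \<theta>, \<phi>)\<close>, with
  \<open>d\<omega>\<^sup>2 = d\<theta>\<^sup>2 + sin\<^sup>2 \<theta> d\<phi>\<^sup>2\<close> and \<open>0 < \<theta> < \<pi>\<close>. Radial curves have constant \<open>(\<theta>, \<phi>)\<close>,
  so for them the exclusion of the poles is no restriction: every point of the sphere lies
  in such a chart.
\<close>

definition point :: "real \<Rightarrow> real \<Rightarrow> real \<Rightarrow> real \<Rightarrow> real ^ 4" where
  "point t r \<theta> \<phi> = vector [t, r, \<theta>, \<phi>]"

definition spacetime :: "real \<Rightarrow> (real \<Rightarrow> real) \<Rightarrow> (real ^ 4) set" where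
  "spacetime M a = {x. (x $ 1, x $ 2) \<in> allowed_region M a \<and> 0 < x $ 3 \<and> x $ 3 < pi}"

definition mcvittie_metric :: "real \<Rightarrow> (real \<Rightarrow> real) \<Rightarrow> real ^ 4 \<Rightarrow> real ^ 4 ^ 4" where
  "mcvittie_metric M a x =
     (let t = x $ 1; r = x $ 2; \<theta> = x $ 3;
          S = \<sigma> M a t r; k = \<kappa> M a t r
      in vector
        [vector [- (S^2) * (1 / (hubble a t)^2 - r^2 / k), - S * r / k, 0, 0],
         vector [- S * r / k,                            1 / k,       0, 0],
         vector [0, 0, r^2, 0],
         vector [0, 0, 0, r^2 * (sin \<theta>)^2]])"

text \<open>
  \<open>outgoing_radial_null_geodesic M a I \<gamma>\<close>: \<open>\<gamma>\<close> is affinely parametrised by the open interval \<open>I\<close>,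
  with \<open>t\<close> increasing; the values of \<open>\<gamma>\<close> outside \<open>I\<close> are irrelevant.
\<close>

definition outgoing_radial_null_geodesic ::
  "real \<Rightarrow> (real \<Rightarrow> real) \<Rightarrow> real set \<Rightarrow> (real \<Rightarrow> real ^ 4) \<Rightarrow> bool" where
  "outgoing_radial_null_geodesic M a I \<gamma> \<longleftrightarrow>
     open I \<and> is_interval I \<and>
     affine_geodesic_on I (mcvittie_metric M a) (spacetime M a) \<gamma> \<and>
     null_on I (mcvittie_metric M a) \<gamma> \<and>
     (\<exists>\<theta> \<phi>. \<forall>s\<in>I. \<gamma> s $ 3 = \<theta> \<and> \<gamma> s $ 4 = \<phi>) \<and>
     (\<forall>s\<in>I. velocity \<gamma> s $ 1 > 0 \<and>
        velocity \<gamma> s $ 2 / velocity \<gamma> s $ 1 =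
          \<sigma> M a (\<gamma> s $ 1) (\<gamma> s $ 2) *
            (\<gamma> s $ 2 + sqrt (\<kappa> M a (\<gamma> s $ 1) (\<gamma> s $ 2)) / hubble a (\<gamma> s $ 1)))"

text \<open>
  \<open>\<gamma>\<close> is the maximal outgoing radial null geodesic with \<open>\<gamma> 0 = p\<close>: up to a positive rescaling
  of the parameter, every other one starting at \<open>p\<close> is a restriction of it.
\<close>

definition unique_ORNG_through ::
  "real \<Rightarrow> (real \<Rightarrow> real) \<Rightarrow> real ^ 4 \<Rightarrow> real set \<Rightarrow> (real \<Rightarrow> real ^ 4) \<Rightarrow> bool" where
  "unique_ORNG_through M a p I \<gamma> \<longleftrightarrow>
     outgoing_radial_null_geodesic M a I \<gamma> \<and> 0 \<in> I \<and> \<gamma> 0 = p \<and>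
     (\<forall>J \<eta>. outgoing_radial_null_geodesic M a J \<eta> \<and> 0 \<in> J \<and> \<eta> 0 = p \<longrightarrow>
        (\<exists>c>0. \<forall>s\<in>J. c * s \<in> I \<and> \<eta> s = \<gamma> (c * s)))"

section \<open>The function in the hypothesis\<close>

definition J_int :: "real \<Rightarrow> real" where
  "J_int \<epsilon> = integral {0..1} (\<lambda>\<xi>. (1 - \<xi>) powr (-1/2) * (2 * \<xi> + \<epsilon>) *
     (\<xi>^2 + \<epsilon> * \<xi> + \<epsilon>) powr (-5/2))"

definition K_bar :: "real \<Rightarrow> real" where
  "K_bar \<epsilon> = 3 * \<epsilon> powr (3/2) * J_int \<epsilon> - 2"

end

theory Submission
  imports Defs
begin

text \<open>
  Put \<open>x = 1 / r\<close>, \<open>\<beta> = 1 / a\<^sup>2\<close> and \<open>P \<beta> w = \<beta> + w\<^sup>2 - 2 M w\<^sup>3\<close>, so that \<open>\<kappa> = r\<^sup>2 P \<beta> x\<close> and the improper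
  integral in \<open>\<sigma>\<close> becomes, after \<open>u = 1 / w\<close>, the proper integral \<open>I3 = \<integral>\<^sub>0\<^sup>x P\<^bsup>-3/2\<^esup>\<close>. The outgoing rays are the solutions of
  \<open>x' = - Q\<close> with \<open>Q = \<beta> P\<^bsup>1/2\<^esup> I3 (H + P\<^bsup>1/2\<^esup>)\<close>. Writing \<open>x P\<^bsup>-1/2\<^esup>\<close> as the integral of its derivative
  \<open>(\<beta> + M w\<^sup>3) P\<^bsup>-3/2\<^esup>\<close> gives \<open>I3 \<ge> x P\<^bsup>-1/2\<^esup> / (\<beta> + M x\<^sup>3)\<close>. This makes \<open>P / \<beta>\<close> nondecreasing along a ray while
  \<open>2 M x \<ge> 1\<close>, and \<open>P / \<beta> \<ge> 1\<close> otherwise, so the ray never reaches the boundary \<open>P = 0\<close> and exists for all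
  later \<open>t\<close>; since \<open>a\<close> is unbounded, \<open>x\<close> tends to \<open>0\<close>.

  If \<open>dr = F dt\<close> on outgoing rays, the \<open>(t, r)\<close>-part of the metric is
  \<open>\<kappa>\<^bsup>-1\<^esup> (dr - F dt)\<^sup>2 + 2 K dt (dr - F dt)\<close> with \<open>K = \<beta> I3\<close>, and the geodesic equation integrates to
  \<open>ds/dt = K exp (\<integral> \<partial>F/\<partial>r dt)\<close> up to a constant factor. For small \<open>x\<close> the logarithmic derivative of this
  quantity is at least \<open>- 6 M H x \<ge> 12 M x'\<close>, so it stays bounded away from \<open>0\<close> and \<open>s\<close> tends to infinity.
\<close>

section \<open>Maximal solutions of scalar differential equations\<close>

text \<open>Regularity shapes the uniqueness part. The metric contains \<open>H\<close>, so the
  Christoffel symbols contain \<open>deriv H\<close>, that is the second derivative of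
  \<open>a\<close>, which is continuous but need not be Lipschitz; since \<open>t\<close> is an
  unknown of the affinely parametrised geodesic system, Picard-Lindelof does not apply to that
  system as it stands. With \<open>t\<close> as independent variable the slope condition is a scalar
  equation for \<open>x\<close>, where smoothness in \<open>x\<close> is enough, and the affine
  parameter follows by quadrature. A competing geodesic is reduced in the same way, which yields
  uniqueness. The variable \<open>x = 1 / r\<close> puts spatial infinity at \<open>0\<close> and
  makes \<open>I3\<close> a proper integral that can be differentiated in both arguments. Besides
  the boundary \<open>P = 0\<close>, the end \<open>x = 0\<close> must be excluded in finite time;
  there \<open>Q\<close> is at most a multiple of \<open>x\<close>. The bound
  \<open>I3_lower\<close> degenerates when \<open>\<beta>\<close> tends to \<open>0\<close> with
  \<open>x\<close> fixed; at late times a comparison with the massless integral, which is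
  elementary, replaces it.\<close>

lemma integral_upto_lipschitz:
  fixes h :: "real \<Rightarrow> real"
  assumes h: "continuous_on {l..u} h" and c: "\<And>\<tau>. \<tau> \<in> {l..u} \<Longrightarrow> \<bar>h \<tau>\<bar> \<le> c"
    and s: "s \<in> {l..u}" and t: "t \<in> {l..u}"
  shows "\<bar>integral {l..s} h - integral {l..t} h\<bar> \<le> c * \<bar>s - t\<bar>"
proof -
  have *: "\<bar>integral {l..t} h - integral {l..s} h\<bar> \<le> c * (t - s)"
    if "s \<in> {l..u}" "t \<in> {l..u}" "s \<le> t" for s t
  proof -
    have int: "h integrable_on {l..t}" "h integrable_on {s..t}"
      using that by (auto intro!: integrable_continuous_real continuous_on_subset[OF h])
    have "integral {l..s} h + integral {s..t} h = integral {l..t} h"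
      using that int by (intro Henstock_Kurzweil_Integration.integral_combine) auto
    moreover have "norm (integral {s..t} h) \<le> c * (t - s)"
      using that by (intro integral_bound continuous_on_subset[OF h]) (auto intro: c)
    ultimately show ?thesis by simp
  qed
  show ?thesis
    using *[OF s t] *[OF t s] by (cases "s \<le> t") auto
qed

text \<open>In \<open>t\<close> the right-hand side is only continuous, which matches a scale factor
  with two derivatives. Convex sections keep the points between two values at the same time inside
  \<open>D\<close>, so the mean value theorem turns the continuous derivative \<open>Gx\<close> into
  local Lipschitz bounds.\<close>

locale scalar_ode =
  fixes D :: "(real \<times> real) set" and G Gx :: "real \<Rightarrow> real \<Rightarrow> real"
  assumes open_D: "open D"
    and continuous_G: "continuous_on D (\<lambda>(t, x). G t x)"
    and continuous_Gx: "continuous_on D (\<lambda>(t, x). Gx t x)"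
    and G_deriv: "(t, x) \<in> D \<Longrightarrow> (G t has_real_derivative Gx t x) (at x)"
    and section_convex: "(t, x) \<in> D \<Longrightarrow> (t, y) \<in> D \<Longrightarrow> x \<le> z \<Longrightarrow> z \<le> y \<Longrightarrow> (t, z) \<in> D"
begin

definition solves :: "real set \<Rightarrow> (real \<Rightarrow> real) \<Rightarrow> bool" where
  "solves J u \<longleftrightarrow> open J \<and> is_interval J \<and>
     (\<forall>t\<in>J. (t, u t) \<in> D \<and> (u has_real_derivative G t (u t)) (at t))"

lemma solves_cong:
  assumes "solves J u" "\<And>t. t \<in> J \<Longrightarrow> v t = u t"
  shows "solves J v"
proof -
  have "(v has_real_derivative G t (v t)) (at t)" if "t \<in> J" for t
  proof -
    have "(u has_real_derivative G t (v t)) (at t)"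
      using assms that by (simp add: solves_def)
    moreover have "open J" using assms(1) by (simp add: solves_def)
    ultimately show ?thesis
      using assms(2) that by (metis (no_types, lifting) has_field_derivative_transform_within_open)
  qed
  then show ?thesis using assms by (simp add: solves_def)
qed

lemma solves_continuous: "solves J u \<Longrightarrow> continuous_on J u"
  unfolding solves_def
  by (meson DERIV_continuous continuous_at_imp_continuous_on)

lemma compact_bound:
  assumes "compact K" "K \<subseteq> D"
  obtains B L where "B \<ge> 0" "L \<ge> 0"
    "\<And>t x. (t, x) \<in> K \<Longrightarrow> \<bar>G t x\<bar> \<le> B" "\<And>t x. (t, x) \<in> K \<Longrightarrow> \<bar>Gx t x\<bar> \<le> L"
proof -
  have "bounded ((\<lambda>(t, x). G t x) ` K)" "bounded ((\<lambda>(t, x). Gx t x) ` K)"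
    using assms continuous_G continuous_Gx
    by (auto intro!: compact_imp_bounded compact_continuous_image intro: continuous_on_subset)
  then obtain B L where
    "\<forall>y \<in> (\<lambda>(t, x). G t x) ` K. norm y \<le> B" "B > 0"
    "\<forall>y \<in> (\<lambda>(t, x). Gx t x) ` K. norm y \<le> L" "L > 0"
    unfolding bounded_pos by blast
  then show thesis
    by (intro that[of B L]) (auto simp: image_iff Ball_def less_imp_le)
qed

lemma G_lipschitz:
  assumes x: "(t, x) \<in> D" and y: "(t, y) \<in> D"
    and L: "\<And>z. (z \<in> {x..y} \<or> z \<in> {y..x}) \<Longrightarrow> \<bar>Gx t z\<bar> \<le> L"
  shows "\<bar>G t x - G t y\<bar> \<le> L * \<bar>x - y\<bar>"
proof -
  have *: "\<bar>G t y - G t x\<bar> \<le> L * \<bar>y - x\<bar>"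
    if "(t, x) \<in> D" "(t, y) \<in> D" "x < y" "\<And>z. z \<in> {x..y} \<Longrightarrow> \<bar>Gx t z\<bar> \<le> L" for x y
  proof -
    have "\<exists>z>x. z < y \<and> G t y - G t x = (y - x) * Gx t z"
      using that(3) by (intro MVT2 G_deriv section_convex[OF that(1,2)])
    then obtain z where z: "z > x" "z < y" "G t y - G t x = (y - x) * Gx t z" by blast
    have "\<bar>Gx t z\<bar> \<le> L" using z that by auto
    then show ?thesis using z \<open>x < y\<close>
      by (simp add: abs_mult mult.commute mult_right_mono)
  qed
  consider "x < y" | "x = y" | "y < x" by linarith
  then show ?thesis
  proof cases
    case 1 then show ?thesis using *[OF x y 1] L by (simp add: abs_minus_commute)
  next
    case 3 then show ?thesis using *[OF y x 3] L by (simp add: abs_minus_commute)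
  qed simp
qed

text \<open>Gronwall's argument for the squared difference \<open>d\<close>: since
  \<open>\<bar>d' \<tau>\<bar> \<le> 2 * L * d \<tau>\<close>, an exponential factor makes
  \<open>d\<close> monotone, both forward and backward from the common point \<open>t1\<close>,
  where \<open>d\<close> vanishes.\<close>

lemma solves_unique:
  assumes u: "solves J u" and v: "solves J v" and t1: "t1 \<in> J" and eq: "u t1 = v t1" and t: "t \<in> J"
  shows "u t = v t"
proof -
  define s e where "s = min t1 t" and "e = max t1 t"
  have se: "{s..e} \<subseteq> J"
  proof
    fix \<tau> assume "\<tau> \<in> {s..e}"
    moreover have "s \<in> J" "e \<in> J" using t1 t by (auto simp: s_def e_def min_def max_def)
    moreover have "is_interval J" using u by (simp add: solves_def)
    ultimately show "\<tau> \<in> J" by (meson atLeastAtMost_iff mem_is_interval_1_I)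
  qed
  \<comment> \<open>\<open>K\<close> is swept out by the segments joining the two graphs. It is
    compact as a continuous image of a rectangle and so provides one Lipschitz constant on all of
    \<open>{s..e}\<close>.\<close>
  define K where "K = (\<lambda>(\<tau>, \<theta>). (\<tau>, u \<tau> + \<theta> * (v \<tau> - u \<tau>))) ` ({s..e} \<times> {0..1::real})"
  have cu: "continuous_on {s..e} u" "continuous_on {s..e} v"
    using u v se by (auto intro: continuous_on_subset solves_continuous)
  have cK: "compact K"
    unfolding K_def split_beta
    by (intro compact_continuous_image compact_Times compact_Icc continuous_intros
        continuous_on_compose2[OF cu(1)] continuous_on_compose2[OF cu(2)]) auto
  have inK: "(\<tau>, z) \<in> K" if "\<tau> \<in> {s..e}" "z \<in> {u \<tau>..v \<tau>} \<or> z \<in> {v \<tau>..u \<tau>}" for \<tau> z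
  proof (cases "u \<tau> = v \<tau>")
    case True
    then show ?thesis using that unfolding K_def by (force intro!: image_eqI[of _ _ "(\<tau>, 0)"])
  next
    case False
    have "(z - u \<tau>) / (v \<tau> - u \<tau>) \<in> {0..1}"
    proof (cases "v \<tau> > u \<tau>")
      case True then show ?thesis using that by (auto simp: divide_simps)
    next
      case f: False then show ?thesis using that False by (auto simp: divide_simps)
    qed
    then show ?thesis using that False unfolding K_def
      by (intro image_eqI[of _ _ "(\<tau>, (z - u \<tau>) / (v \<tau> - u \<tau>))"]) auto
  qed
  have KD: "K \<subseteq> D"
  proof
    fix p assume "p \<in> K"
    then obtain q where "q \<in> {s..e} \<times> {0..1}" "p = (\<lambda>(\<tau>, \<theta>). (\<tau>, u \<tau> + \<theta> * (v \<tau> - u \<tau>))) q"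
      unfolding K_def by blast
    then obtain \<tau> \<theta> where p: "p = (\<tau>, u \<tau> + \<theta> * (v \<tau> - u \<tau>))" "\<tau> \<in> {s..e}" "0 \<le> \<theta>" "\<theta> \<le> 1"
      by (cases q) auto
    have D: "(\<tau>, u \<tau>) \<in> D" "(\<tau>, v \<tau>) \<in> D" using u v se p by (auto simp: solves_def)
    show "p \<in> D"
    proof (cases "u \<tau> \<le> v \<tau>")
      case True
      have "\<theta> * (v \<tau> - u \<tau>) \<le> 1 * (v \<tau> - u \<tau>)" using True p by (intro mult_right_mono) auto
      then show ?thesis using section_convex[OF D] True p by auto
    next
      case False
      have "\<theta> * (u \<tau> - v \<tau>) \<le> 1 * (u \<tau> - v \<tau>)" "0 \<le> \<theta> * (u \<tau> - v \<tau>)"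
        using False p by (auto intro!: mult_right_mono)
      then show ?thesis using section_convex[OF D(2,1)] False p by (auto simp: algebra_simps)
    qed
  qed
  obtain L where L: "L \<ge> 0" "\<And>t x. (t, x) \<in> K \<Longrightarrow> \<bar>Gx t x\<bar> \<le> L"
    using compact_bound[OF cK KD] by metis
  have lip: "\<bar>G \<tau> (u \<tau>) - G \<tau> (v \<tau>)\<bar> \<le> L * \<bar>u \<tau> - v \<tau>\<bar>" if "\<tau> \<in> {s..e}" for \<tau>
    using u v se that by (intro G_lipschitz L(2) inK) (auto simp: solves_def)
  define d where "d \<tau> = (u \<tau> - v \<tau>)\<^sup>2" for \<tau>
  define d' where "d' \<tau> = 2 * (u \<tau> - v \<tau>) * (G \<tau> (u \<tau>) - G \<tau> (v \<tau>))" for \<tau>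
  have d: "(d has_real_derivative d' \<tau>) (at \<tau>)" if "\<tau> \<in> {s..e}" for \<tau>
  proof -
    have "(u has_real_derivative G \<tau> (u \<tau>)) (at \<tau>)" "(v has_real_derivative G \<tau> (v \<tau>)) (at \<tau>)"
      using u v se that by (auto simp: solves_def)
    then show ?thesis unfolding d_def d'_def by (auto intro!: derivative_eq_intros)
  qed
  have d': "\<bar>d' \<tau>\<bar> \<le> 2 * L * d \<tau>" if "\<tau> \<in> {s..e}" for \<tau>
  proof -
    have "\<bar>u \<tau> - v \<tau>\<bar> * \<bar>G \<tau> (u \<tau>) - G \<tau> (v \<tau>)\<bar> \<le> \<bar>u \<tau> - v \<tau>\<bar> * (L * \<bar>u \<tau> - v \<tau>\<bar>)"
      by (intro mult_left_mono lip that) auto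
    also have "\<dots> = L * d \<tau>" by (simp add: d_def power2_eq_square algebra_simps abs_if)
    finally show ?thesis by (simp add: d'_def abs_mult mult.assoc del: right_diff_distrib_numeral)
  qed
  have d1: "d t1 = 0" by (simp add: d_def eq)
  have "d t \<le> 0"
  proof (cases "t1 \<le> t")
    case True
    have "d t * exp (- 2 * L * t) \<le> d t1 * exp (- 2 * L * t1)"
    proof (rule DERIV_nonpos_imp_nonincreasing[OF True])
      fix \<tau> assume \<tau>: "t1 \<le> \<tau>" "\<tau> \<le> t"
      then have i: "\<tau> \<in> {s..e}" by (auto simp: s_def e_def)
      have "((\<lambda>\<tau>. d \<tau> * exp (- 2 * L * \<tau>)) has_real_derivative
          (d' \<tau> - 2 * L * d \<tau>) * exp (- 2 * L * \<tau>)) (at \<tau>)"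
        by (auto intro!: derivative_eq_intros d[OF i] simp: algebra_simps)
      moreover have "(d' \<tau> - 2 * L * d \<tau>) * exp (- 2 * L * \<tau>) \<le> 0"
        using d'[OF i] by (intro mult_nonpos_nonneg) auto
      ultimately show "\<exists>y. ((\<lambda>\<tau>. d \<tau> * exp (- 2 * L * \<tau>)) has_real_derivative y) (at \<tau>) \<and> y \<le> 0" by blast
    qed
    then show ?thesis using d1 by (simp add: mult_le_0_iff)
  next
    case False
    then have "t \<le> t1" by simp
    have "d t * exp (2 * L * t) \<le> d t1 * exp (2 * L * t1)"
    proof (rule DERIV_nonneg_imp_nondecreasing[OF \<open>t \<le> t1\<close>])
      fix \<tau> assume \<tau>: "t \<le> \<tau>" "\<tau> \<le> t1"
      then have i: "\<tau> \<in> {s..e}" by (auto simp: s_def e_def)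
      have "((\<lambda>\<tau>. d \<tau> * exp (2 * L * \<tau>)) has_real_derivative
          (d' \<tau> + 2 * L * d \<tau>) * exp (2 * L * \<tau>)) (at \<tau>)"
        by (auto intro!: derivative_eq_intros d[OF i] simp: algebra_simps)
      moreover have "(d' \<tau> + 2 * L * d \<tau>) * exp (2 * L * \<tau>) \<ge> 0"
        using d'[OF i] by (intro mult_nonneg_nonneg) auto
      ultimately show "\<exists>y. ((\<lambda>\<tau>. d \<tau> * exp (2 * L * \<tau>)) has_real_derivative y) (at \<tau>) \<and> 0 \<le> y" by blast
    qed
    then show ?thesis using d1 by (simp add: mult_le_0_iff)
  qed
  then show ?thesis by (simp add: d_def)
qed

text \<open>Picard iteration, with one \<delta> serving all initial points near
  \<open>(T, X)\<close>. This uniformity later lets a solution be restarted just before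
  \<open>T\<close> and still live beyond \<open>T\<close>.\<close>

lemma local_solution:
  assumes TX: "(T, X) \<in> D"
  shows "\<exists>\<delta>>0. \<forall>t1 x1. \<bar>t1 - T\<bar> < \<delta> \<longrightarrow> \<bar>x1 - X\<bar> < \<delta> \<longrightarrow>
    (\<exists>u. solves {T - \<delta><..<T + \<delta>} u \<and> u t1 = x1)"
proof -
  obtain A B where AB: "open A" "open B" "(T, X) \<in> A \<times> B" "A \<times> B \<subseteq> D"
    using open_prod_elim[OF open_D TX] by metis
  obtain \<rho>1 \<rho>2 where "\<rho>1 > 0" "cball T \<rho>1 \<subseteq> A" "\<rho>2 > 0" "cball X \<rho>2 \<subseteq> B"
    using AB open_contains_cball by (metis mem_Sigma_iff)
  then obtain \<rho> where \<rho>: "\<rho> > 0" "{T - \<rho>..T + \<rho>} \<times> {X - \<rho>..X + \<rho>} \<subseteq> D"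
  proof (intro that[of "min \<rho>1 \<rho>2"])
    have "{T - min \<rho>1 \<rho>2..T + min \<rho>1 \<rho>2} \<subseteq> A" "{X - min \<rho>1 \<rho>2..X + min \<rho>1 \<rho>2} \<subseteq> B"
      using \<open>cball T \<rho>1 \<subseteq> A\<close> \<open>cball X \<rho>2 \<subseteq> B\<close> by (force simp: cball_eq_atLeastAtMost)+
    then show "{T - min \<rho>1 \<rho>2..T + min \<rho>1 \<rho>2} \<times> {X - min \<rho>1 \<rho>2..X + min \<rho>1 \<rho>2} \<subseteq> D"
      using AB(4) by blast
  qed (use \<open>\<rho>1 > 0\<close> \<open>\<rho>2 > 0\<close> in auto)
  define Bx where "Bx = {T - \<rho>..T + \<rho>} \<times> {X - \<rho>..X + \<rho>}"
  have "compact Bx" "Bx \<subseteq> D" using \<rho> by (auto simp: Bx_def intro: compact_Times)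
  then obtain B L where B: "B \<ge> 0" "L \<ge> 0"
    "\<And>t x. (t, x) \<in> Bx \<Longrightarrow> \<bar>G t x\<bar> \<le> B" "\<And>t x. (t, x) \<in> Bx \<Longrightarrow> \<bar>Gx t x\<bar> \<le> L"
    using compact_bound by metis
  \<comment> \<open>The first bound gives \<open>\<delta> + 2 * \<delta> * B \<le> \<rho>\<close>:
    starting within \<delta> of \<open>X\<close> and moving at speed at most \<open>B\<close> for a
    time of at most \<open>2 * \<delta>\<close>, a solution stays in the box. The second makes the
    Picard map contract by \<open>1/2\<close>.\<close>
  define \<delta> where "\<delta> = min (\<rho> / (1 + 2 * B)) (1 / (4 * (L + 1)))"
  have \<delta>: "\<delta> > 0" using \<rho> B by (simp add: \<delta>_def)
  have "\<delta> * (1 + 2 * B) \<le> \<rho> / (1 + 2 * B) * (1 + 2 * B)"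
    using B by (intro mult_right_mono) (auto simp: \<delta>_def)
  also have "\<dots> = \<rho>" using B by simp
  finally have \<delta>1: "\<delta> + 2 * \<delta> * B \<le> \<rho>" by (simp add: algebra_simps)
  have "\<delta> * (4 * (L + 1)) \<le> 1 / (4 * (L + 1)) * (4 * (L + 1))"
    using B by (intro mult_right_mono) (auto simp: \<delta>_def)
  also have "\<dots> = 1" using B by simp
  finally have \<delta>2: "2 * \<delta> * L \<le> 1/2" using \<delta> by (simp add: algebra_simps)
  have \<delta>\<rho>: "\<delta> \<le> \<rho>" using \<delta>1 \<delta> B by (smt (verit) mult_nonneg_nonneg)
  \<comment> \<open>Clamping time and value makes the Picard map act on all bounded continuous
    functions on the real line, a Banach space, so no closed ball of functions has to be singled
    out. The fixed point turns out to take its values in the box, where the clamp \<open>k\<close>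
    is the identity.\<close>
  define cl where "cl t = max (T - \<delta>) (min (T + \<delta>) t)" for t
  define k where "k x = max (X - \<rho>) (min (X + \<rho>) x)" for x
  have cl: "cl t \<in> {T - \<delta>..T + \<delta>}" for t using \<delta> by (auto simp: cl_def)
  have box: "(\<tau>, k x) \<in> Bx" if "\<tau> \<in> {T - \<delta>..T + \<delta>}" for \<tau> x
    using that \<delta>\<rho> \<rho> by (auto simp: Bx_def k_def)
  have k_lip: "\<bar>k x - k y\<bar> \<le> \<bar>x - y\<bar>" for x y by (auto simp: k_def)
  have ck: "continuous_on S k" for S unfolding k_def by (intro continuous_intros)
  have ccl: "continuous_on S cl" for S unfolding cl_def by (intro continuous_intros)
  define h where "h f \<tau> = G \<tau> (k (f \<tau>))" for f :: "real \<Rightarrow> real" and \<tau>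
  have ch: "continuous_on {T - \<delta>..T + \<delta>} (h f)" if "continuous_on UNIV f" for f
  proof -
    have "continuous_on {T - \<delta>..T + \<delta>} ((\<lambda>(t, x). G t x) \<circ> (\<lambda>\<tau>. (\<tau>, k (f \<tau>))))"
      using box \<open>Bx \<subseteq> D\<close>
      by (intro continuous_on_compose continuous_intros continuous_on_compose2[OF ck[of UNIV]]
          continuous_on_subset[OF that] continuous_on_subset[OF continuous_G]) auto
    then show ?thesis by (simp add: h_def o_def)
  qed
  have hB: "\<bar>h f \<tau>\<bar> \<le> B" if "\<tau> \<in> {T - \<delta>..T + \<delta>}" for f \<tau>
    unfolding h_def by (intro B box that)
  define A where "A f t = integral {T - \<delta>..t} (h f)" for f t
  have cA: "continuous_on {T - \<delta>..T + \<delta>} (A f)" if "continuous_on UNIV f" for f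
    unfolding A_def by (intro indefinite_integral_continuous_1 integrable_continuous_real ch that)
  show ?thesis
  proof (intro exI[of _ \<delta>] conjI allI impI \<delta>)
    fix t1 x1 assume t1: "\<bar>t1 - T\<bar> < \<delta>" and x1: "\<bar>x1 - X\<bar> < \<delta>"
    have t1': "t1 \<in> {T - \<delta>..T + \<delta>}" using t1 by auto
    define \<Phi> where "\<Phi> f t = x1 + (A f (cl t) - A f t1)" for f t
    have \<Phi>B: "\<bar>\<Phi> f t - x1\<bar> \<le> 2 * \<delta> * B" if "continuous_on UNIV f" for f t
    proof -
      have "\<bar>A f (cl t) - A f t1\<bar> \<le> B * \<bar>cl t - t1\<bar>"
        unfolding A_def by (intro integral_upto_lipschitz[of _ "T + \<delta>"] ch that hB cl t1')
      also have "\<dots> \<le> B * (2 * \<delta>)" using cl[of t] t1' B by (intro mult_left_mono) auto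
      finally show ?thesis by (simp add: \<Phi>_def mult_ac)
    qed
    have \<Phi>c: "continuous_on UNIV (\<Phi> f)" if "continuous_on UNIV f" for f
      unfolding \<Phi>_def using cl
      by (intro continuous_intros continuous_on_compose2[OF cA[OF that] ccl]) auto
    have \<Phi>bc: "\<Phi> f \<in> bcontfun" if "continuous_on UNIV f" for f
    proof -
      have "bounded (range (\<Phi> f))"
        unfolding bounded_iff using \<Phi>B[OF that]
        by (intro exI[of _ "\<bar>x1\<bar> + 2 * \<delta> * B"]) (auto simp: abs_le_iff intro!: add_mono; smt (verit))
      then show ?thesis using \<Phi>c[OF that] by (simp add: bcontfun_def)
    qed
    define \<Psi> where "\<Psi> f = Bcontfun (\<Phi> (apply_bcontfun f))" for f :: "real \<Rightarrow>\<^sub>C real"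
    have \<Psi>: "apply_bcontfun (\<Psi> f) = \<Phi> (apply_bcontfun f)" for f
      unfolding \<Psi>_def by (intro Bcontfun_inverse \<Phi>bc) auto
    have "\<exists>!f. \<Psi> f = f"
    proof (rule banach_fix_type[of "1/2"], safe)
      fix f g :: "real \<Rightarrow>\<^sub>C real"
      show "dist (\<Psi> f) (\<Psi> g) \<le> 1/2 * dist f g"
      proof (rule dist_bound)
        fix t
        have cf: "continuous_on UNIV (apply_bcontfun f)" "continuous_on UNIV (apply_bcontfun g)" by auto
        let ?d = "\<lambda>\<tau>. h f \<tau> - h g \<tau>"
        have int: "h f integrable_on {T - \<delta>..s}" "h g integrable_on {T - \<delta>..s}"
          if "s \<in> {T - \<delta>..T + \<delta>}" for s
          using that by (auto intro!: integrable_continuous_real continuous_on_subset[OF ch])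
        have sub: "A f s - A g s = integral {T - \<delta>..s} ?d" if "s \<in> {T - \<delta>..T + \<delta>}" for s
          unfolding A_def using int[OF that] by (simp add: Henstock_Kurzweil_Integration.integral_diff)
        have "\<bar>integral {T - \<delta>..cl t} ?d - integral {T - \<delta>..t1} ?d\<bar> \<le> (L * dist f g) * \<bar>cl t - t1\<bar>"
        proof (rule integral_upto_lipschitz[of _ "T + \<delta>"])
          fix \<tau> assume \<tau>: "\<tau> \<in> {T - \<delta>..T + \<delta>}"
          have "\<bar>h f \<tau> - h g \<tau>\<bar> \<le> L * \<bar>k (f \<tau>) - k (g \<tau>)\<bar>"
            unfolding h_def
          proof (rule G_lipschitz)
            fix z assume "z \<in> {k (f \<tau>)..k (g \<tau>)} \<or> z \<in> {k (g \<tau>)..k (f \<tau>)}"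
            then show "\<bar>Gx \<tau> z\<bar> \<le> L"
              using box[OF \<tau>, of "f \<tau>"] box[OF \<tau>, of "g \<tau>"] by (intro B) (auto simp: Bx_def)
          qed (use box[OF \<tau>] \<open>Bx \<subseteq> D\<close> in auto)
          also have "\<dots> \<le> L * dist f g"
            using dist_bounded[of f \<tau> g] k_lip[of "f \<tau>" "g \<tau>"] B
            by (intro mult_left_mono) (auto simp: dist_real_def)
          finally show "\<bar>?d \<tau>\<bar> \<le> L * dist f g" .
        qed (use cl t1' in \<open>auto intro!: continuous_intros ch\<close>)
        also have "\<dots> \<le> (L * dist f g) * (2 * \<delta>)"
          using cl[of t] t1' B by (intro mult_left_mono) auto
        also have "\<dots> = (2 * \<delta> * L) * dist f g" by simp
        also have "\<dots> \<le> 1/2 * dist f g" by (intro mult_right_mono \<delta>2) auto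
        finally show "dist (\<Psi> f t) (\<Psi> g t) \<le> 1/2 * dist f g"
          unfolding \<Psi> \<Phi>_def dist_real_def sub[OF cl, symmetric] sub[OF t1', symmetric] by (simp add: algebra_simps)
      qed
    qed auto
    then obtain f where "\<Psi> f = f" by auto
    then have f: "f t = x1 + (A f (cl t) - A f t1)" for t
      using \<Psi>[of f] by (metis \<Phi>_def)
    have cf: "continuous_on UNIV (apply_bcontfun f)" by auto
    have fX: "\<bar>f t - X\<bar> \<le> \<rho>" for t
      using \<Phi>B[OF cf, of t] x1 \<delta>1 f[of t] by (simp add: \<Phi>_def)
    have kf: "k (f t) = f t" for t
      using fX[of t] by (simp add: k_def max_def min_def abs_le_iff)
    have "solves {T - \<delta><..<T + \<delta>} f"
      unfolding solves_def
    proof (intro conjI ballI)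
      fix t assume t: "t \<in> {T - \<delta><..<T + \<delta>}"
      show "(t, f t) \<in> D" using box[of t "f t"] kf t \<open>Bx \<subseteq> D\<close> by auto
      have "(A f has_real_derivative h f t) (at t within {T - \<delta>..T + \<delta>})"
        unfolding A_def using t by (intro integral_has_real_derivative ch) auto
      then have "(A f has_real_derivative h f t) (at t)"
        using t by (simp add: at_within_Icc_at)
      then have "((\<lambda>t. x1 + (A f t - A f t1)) has_real_derivative G t (f t)) (at t)"
        by (auto intro!: derivative_eq_intros simp: h_def kf)
      moreover have "f s = x1 + (A f s - A f t1)" if "s \<in> {T - \<delta><..<T + \<delta>}" for s
        using f[of s] that by (simp add: cl_def)
      ultimately show "(f has_real_derivative G t (f t)) (at t)"
        using has_field_derivative_transform_within_open[OF _ open_greaterThanLessThan t]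
        by (metis (no_types, lifting))
    qed (auto simp: is_interval_1)
    moreover have "f t1 = x1" using f[of t1] t1 by (simp add: cl_def)
    ultimately show "\<exists>u. solves {T - \<delta><..<T + \<delta>} u \<and> u t1 = x1" by blast
  qed
qed

text \<open>The union of all solutions through \<open>(t0, x0)\<close>. The last clause covers
  solutions that meet \<open>u\<close> at any time \<open>t1\<close>, not only at \<open>t0\<close>,
  because the continuation argument compares with a solution started near the end of
  \<open>J\<close>.\<close>

lemma maximal_solution:
  assumes t0: "(t0, x0) \<in> D"
  obtains J u where "solves J u" "t0 \<in> J" "u t0 = x0"
    "\<And>J' v t1 t. solves J' v \<Longrightarrow> t1 \<in> J' \<Longrightarrow> t1 \<in> J \<Longrightarrow> v t1 = u t1 \<Longrightarrow> t \<in> J' \<Longrightarrow> t \<in> J \<and> v t = u t"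
proof -
  define S where "S = {(J, v). solves J v \<and> t0 \<in> J \<and> v t0 = x0}"
  define J where "J = (\<Union>p\<in>S. fst p)"
  define u where "u t = (SOME y. \<exists>(J, v)\<in>S. t \<in> J \<and> y = v t)" for t
  have agree: "v t = w t" if "(J1, v) \<in> S" "(J2, w) \<in> S" "t \<in> J1" "t \<in> J2" for J1 J2 v w t
  proof -
    have "solves (J1 \<inter> J2) v" "solves (J1 \<inter> J2) w"
      using that by (auto simp: S_def solves_def open_Int is_interval_Int)
    then show ?thesis using solves_unique[of "J1 \<inter> J2" v w t0 t] that by (auto simp: S_def)
  qed
  have u: "u t = v t" if "(J1, v) \<in> S" "t \<in> J1" for J1 v t
  proof -
    have "\<exists>(J, w)\<in>S. t \<in> J \<and> u t = w t"
      unfolding u_def by (rule someI_ex) (use that in blast)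
    then obtain J2 w where "(J2, w) \<in> S" "t \<in> J2" "u t = w t" by blast
    then show ?thesis using agree[of J1 v J2 w t] that by simp
  qed
  have ivl: "is_interval J"
    unfolding J_def S_def is_interval_connected_1
    by (rule connected_Union) (auto simp: is_interval_connected_1[symmetric] solves_def)
  have sol: "solves J u"
    unfolding solves_def
  proof (intro conjI ballI ivl)
    show "open J" unfolding J_def S_def by (auto simp: solves_def)
    fix t assume "t \<in> J"
    then obtain J1 v where v: "(J1, v) \<in> S" "t \<in> J1" by (force simp: J_def)
    then have "solves J1 u"
      using u by (auto intro: solves_cong simp: S_def)
    then show "(t, u t) \<in> D" "(u has_real_derivative G t (u t)) (at t)"
      using v by (auto simp: solves_def)
  qed
  have in_S: "(J1, v) \<in> S \<Longrightarrow> J1 \<subseteq> J" for J1 v by (force simp: J_def)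
  obtain \<delta> v where v: "\<delta> > 0" "solves {t0 - \<delta><..<t0 + \<delta>} v" "v t0 = x0"
    using local_solution[OF t0] by force
  then have "({t0 - \<delta><..<t0 + \<delta>}, v) \<in> S" by (auto simp: S_def)
  then have t0J: "t0 \<in> J" "u t0 = x0" using in_S u v by force+
  show thesis
  proof (rule that[OF sol t0J])
    fix J' v t1 t
    assume *: "solves J' v" "t1 \<in> J'" "t1 \<in> J" "v t1 = u t1" "t \<in> J'"
    have agree': "v s = u s" if "s \<in> J" "s \<in> J'" for s
    proof -
      have "solves (J \<inter> J') u" "solves (J \<inter> J') v"
        using sol *(1) by (auto simp: solves_def open_Int is_interval_Int)
      then show ?thesis using solves_unique[of "J \<inter> J'" v u t1 s] * that by auto
    qed
    \<comment> \<open>Gluing: \<open>w\<close> solves the equation on \<open>J\<close> and on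
      \<open>J'\<close>, hence on the union, which is connected because both contain
      \<open>t1\<close>; so the union competes in \<open>S\<close>.\<close>
    define w where "w s = (if s \<in> J then u s else v s)" for s
    have wJ: "solves J w" by (rule solves_cong[OF sol]) (simp add: w_def)
    have wJ': "solves J' w" by (rule solves_cong[OF *(1)]) (simp add: w_def agree')
    have "connected (J \<union> J')"
      using * sol by (intro connected_Un) (auto simp: solves_def is_interval_connected_1)
    then have "solves (J \<union> J') w"
      using wJ wJ' by (auto simp: solves_def is_interval_connected_1 open_Un)
    then have "(J \<union> J', w) \<in> S" using t0J by (simp add: S_def w_def)
    then have "t \<in> J" using in_S * by blast
    then show "t \<in> J \<and> v t = u t" using agree' * by auto
  qed
qed

end

section \<open>The integrals I3 and I5\<close>

locale mass =
  fixes M :: real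
  assumes M_pos: "M > 0"
begin

definition P :: "real \<Rightarrow> real \<Rightarrow> real" where
  "P \<beta> w = \<beta> + w\<^sup>2 - 2 * M * w ^ 3"

definition Pw :: "real \<Rightarrow> real" where
  "Pw w = 2 * w - 6 * M * w\<^sup>2"

definition I3 :: "real \<Rightarrow> real \<Rightarrow> real" where
  "I3 \<beta> x = integral {0..x} (\<lambda>w. 1 / sqrt (P \<beta> w) ^ 3)"

text \<open>Up to the factor \<open>- 3/2\<close> this is the derivative of \<open>I3\<close> with
  respect to \<beta>; it enters through the time dependence of the metric.\<close>

definition I5 :: "real \<Rightarrow> real \<Rightarrow> real" where
  "I5 \<beta> x = integral {0..x} (\<lambda>w. 1 / sqrt (P \<beta> w) ^ 5)"

text \<open>Positivity of \<open>P\<close> is required at the endpoint only; \<open>P_ge_min\<close>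
  spreads it over the whole range of integration.\<close>

definition adm :: "real \<Rightarrow> real \<Rightarrow> bool" where
  "adm \<beta> x \<longleftrightarrow> \<beta> > 0 \<and> x > 0 \<and> P \<beta> x > 0"

text \<open>\<open>P \<beta>\<close> is at least \<beta> up to \<open>w = 1 / (2 * M)\<close>. From
  \<open>1 / (3 * M)\<close> on, where its derivative changes sign, it decreases, so beyond
  \<open>1 / (2 * M)\<close> the value at \<open>x\<close> is the smaller one.\<close>

lemma P_ge_min:
  assumes "0 \<le> w" "w \<le> x"
  shows "P \<beta> w \<ge> min \<beta> (P \<beta> x)"
proof (cases "2 * M * w \<le> 1")
  case True
  then have "w\<^sup>2 * (2 * M * w) \<le> w\<^sup>2 * 1" by (intro mult_left_mono) auto
  then have "P \<beta> w \<ge> \<beta>" by (simp add: P_def power2_eq_square power3_eq_cube algebra_simps)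
  then show ?thesis by simp
next
  case False
  have "2 * M * w \<le> 2 * M * x" using assms M_pos by (intro mult_left_mono) auto
  then have wx: "2 * M * w \<ge> 1" "2 * M * x \<ge> 1" "0 \<le> x"
    using False assms by auto
  have "w * 1 \<le> w * (2 * M * w)" by (rule mult_left_mono[OF wx(1) assms(1)])
  moreover have "x * 1 \<le> x * (2 * M * x)" by (rule mult_left_mono[OF wx(2,3)])
  moreover have "0 \<le> x * w * (2 * M)" using wx assms M_pos by simp
  ultimately have "0 \<le> (x - w) * ((x * (2 * M * x) - x) + (w * (2 * M * w) - w) + x * w * (2 * M))"
    using assms by (intro mult_nonneg_nonneg) auto
  then have "P \<beta> x \<le> P \<beta> w"
    by (simp add: P_def power2_eq_square power3_eq_cube algebra_simps)
  then show ?thesis by simp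
qed

lemma P_pos: "adm \<beta> x \<Longrightarrow> 0 \<le> w \<Longrightarrow> w \<le> x \<Longrightarrow> P \<beta> w > 0"
  using P_ge_min[of w x \<beta>] by (auto simp: adm_def)

lemma P_shift: "P \<beta>' w = P \<beta> w + (\<beta>' - \<beta>)"
  by (simp add: P_def)

lemma P_le: "0 \<le> w \<Longrightarrow> P \<beta> w \<le> \<beta> + w\<^sup>2"
  using M_pos by (simp add: P_def)

lemma continuous_on_P [continuous_intros]:
  "continuous_on S f \<Longrightarrow> continuous_on S g \<Longrightarrow> continuous_on S (\<lambda>s. P (f s) (g s))"
  unfolding P_def by (intro continuous_intros)

lemma P_DERIV:
  assumes "(f has_real_derivative f') (at s within S)" "(g has_real_derivative g') (at s within S)"
  shows "((\<lambda>s. P (f s) (g s)) has_real_derivative f' + Pw (g s) * g') (at s within S)"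
  unfolding P_def Pw_def
  by (auto intro!: derivative_eq_intros assms simp: algebra_simps power2_eq_square)

lemma sqrt_P_DERIV:
  assumes "(f has_real_derivative f') (at s within S)" "(g has_real_derivative g') (at s within S)"
    and "P (f s) (g s) > 0"
  shows "((\<lambda>s. sqrt (P (f s) (g s))) has_real_derivative
    (f' + Pw (g s) * g') / (2 * sqrt (P (f s) (g s)))) (at s within S)"
  using DERIV_chain2[OF DERIV_real_sqrt[OF assms(3)] P_DERIV[OF assms(1,2)]]
  by (simp add: field_simps)

lemma open_adm: "open {(\<beta>, x). adm \<beta> x}"
proof -
  have "{(\<beta>, x). adm \<beta> x} = {p. 0 < fst p} \<inter> {p. 0 < snd p} \<inter> {p. 0 < P (fst p) (snd p)}"
    by (auto simp: adm_def)
  then show ?thesis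
    by (auto intro!: open_Int open_Collect_less continuous_intros)
qed

lemma adm_neighbourhood:
  assumes "adm \<beta> x"
  obtains X Y where "open X" "open Y" "convex X" "convex Y" "\<beta> \<in> X" "x \<in> Y"
    "\<And>\<beta>' x'. \<beta>' \<in> X \<Longrightarrow> x' \<in> Y \<Longrightarrow> adm \<beta>' x'"
proof -
  obtain A B where AB: "open A" "open B" "(\<beta>, x) \<in> A \<times> B" "A \<times> B \<subseteq> {(\<beta>, x). adm \<beta> x}"
    using open_prod_elim[OF open_adm, of "(\<beta>, x)"] assms by (metis case_prodI mem_Collect_eq)
  then obtain d e where "d > 0" "ball \<beta> d \<subseteq> A" "e > 0" "ball x e \<subseteq> B"
    by (metis mem_Sigma_iff open_contains_ball)
  moreover from this have "ball \<beta> d \<times> ball x e \<subseteq> {(\<beta>, x). adm \<beta> x}" using AB(4) by blast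
  ultimately show thesis by (intro that[of "ball \<beta> d" "ball x e"]) (auto simp del: mem_ball)
qed

lemma continuous_on_integrand:
  assumes "adm \<beta> x" shows "continuous_on {0..x} (\<lambda>w. 1 / sqrt (P \<beta> w) ^ n)"
proof (intro continuous_intros ballI)
  fix w assume "w \<in> {0..x}"
  then show "sqrt (P \<beta> w) ^ n \<noteq> 0" using P_pos[OF assms, of w] by simp
qed

lemma I3_has_integral:
  "adm \<beta> x \<Longrightarrow> ((\<lambda>w. 1 / sqrt (P \<beta> w) ^ 3) has_integral I3 \<beta> x) {0..x}"
  unfolding I3_def
  by (intro integrable_integral integrable_continuous_real continuous_on_integrand)

lemma I5_has_integral:
  "adm \<beta> x \<Longrightarrow> ((\<lambda>w. 1 / sqrt (P \<beta> w) ^ 5) has_integral I5 \<beta> x) {0..x}"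
  unfolding I5_def
  by (intro integrable_integral integrable_continuous_real continuous_on_integrand)

lemma I3_DERIV_x:
  assumes "adm \<beta> x" shows "(I3 \<beta> has_real_derivative 1 / sqrt (P \<beta> x) ^ 3) (at x)"
proof -
  obtain Y where Y: "open Y" "x \<in> Y" "\<And>x'. x' \<in> Y \<Longrightarrow> adm \<beta> x'"
    using adm_neighbourhood[OF assms] by metis
  then obtain e where e: "e > 0" "cball x e \<subseteq> Y" by (metis open_contains_cball)
  have "x + e \<in> Y" using e by (auto simp: cball_eq_atLeastAtMost)
  then have adm: "adm \<beta> (x + e)" using Y by simp
  have x: "x > 0" using assms by (simp add: adm_def)
  have "((\<lambda>x. I3 \<beta> x) has_real_derivative 1 / sqrt (P \<beta> x) ^ 3) (at x within {0..x + e})"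
    unfolding I3_def using x e
    by (intro integral_has_real_derivative continuous_on_integrand adm) auto
  then show ?thesis using x e by (simp add: at_within_Icc_at)
qed

text \<open>Differentiation under the integral. On \<open>U\<close> the parameter falls by less than
  \<open>m\<close>, a lower bound of \<open>P \<beta>\<close> on \<open>{0..x}\<close>, so
  \<open>P\<close> stays positive on all of \<open>U \<times> {0..x}\<close>.\<close>

lemma I3_DERIV_b:
  assumes "adm \<beta> x" shows "((\<lambda>\<beta>. I3 \<beta> x) has_real_derivative - 3/2 * I5 \<beta> x) (at \<beta>)"
proof -
  define m where "m = min \<beta> (P \<beta> x)"
  define U where "U = {\<beta> - m<..}"
  have m: "m > 0" using assms by (simp add: m_def adm_def)
  have pos: "P \<beta>' w > 0" if "\<beta>' \<in> U" "w \<in> {0..x}" for \<beta>' w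
    using P_ge_min[of w x \<beta>] that P_shift[of \<beta>' w \<beta>] by (simp add: U_def m_def)
  have "((\<lambda>\<beta>. integral (cbox 0 x) (\<lambda>w. 1 / sqrt (P \<beta> w) ^ 3)) has_field_derivative
      integral (cbox 0 x) (\<lambda>w. - 3/2 * (1 / sqrt (P \<beta> w) ^ 5))) (at \<beta> within U)"
  proof (rule leibniz_rule_field_derivative)
    fix \<beta>' w assume "\<beta>' \<in> U" "w \<in> cbox 0 x"
    then have p: "P \<beta>' w > 0" using pos by simp
    have "((\<lambda>\<beta>. sqrt (P \<beta> w)) has_field_derivative (1 + Pw w * 0) / (2 * sqrt (P \<beta>' w))) (at \<beta>' within U)"
      using p by (intro sqrt_P_DERIV[where f = "\<lambda>\<beta>. \<beta>" and g = "\<lambda>_. w"] derivative_intros)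
    from DERIV_divide[OF DERIV_const[of 1] DERIV_power[OF this, of 3]] p
    have "((\<lambda>\<beta>. 1 / sqrt (P \<beta> w) ^ 3) has_field_derivative
       - (3 * sqrt (P \<beta>' w) ^ 2 * (1 / (2 * sqrt (P \<beta>' w)))) / (sqrt (P \<beta>' w) ^ 3 * sqrt (P \<beta>' w) ^ 3)) (at \<beta>' within U)"
      by (simp add: mult_ac)
    also have "- (3 * sqrt (P \<beta>' w) ^ 2 * (1 / (2 * sqrt (P \<beta>' w)))) / (sqrt (P \<beta>' w) ^ 3 * sqrt (P \<beta>' w) ^ 3)
       = - 3/2 * (1 / sqrt (P \<beta>' w) ^ 5)"
    proof -
      have "sqrt (P \<beta>' w) \<noteq> 0" using p by simp
      then show ?thesis by (simp add: divide_simps eval_nat_numeral)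
    qed
    finally show "((\<lambda>\<beta>. 1 / sqrt (P \<beta> w) ^ 3) has_field_derivative
       - 3/2 * (1 / sqrt (P \<beta>' w) ^ 5)) (at \<beta>' within U)" .
  next
    fix \<beta>' assume "\<beta>' \<in> U"
    then show "(\<lambda>w. 1 / sqrt (P \<beta>' w) ^ 3) integrable_on cbox 0 x"
      using pos by (intro integrable_continuous continuous_intros) (auto, force)
  next
    show "continuous_on (U \<times> cbox 0 x) (\<lambda>(\<beta>, w). - 3/2 * (1 / sqrt (P \<beta> w) ^ 5))"
      using pos unfolding split_beta by (intro continuous_intros) (auto, force)
  qed (use m in \<open>auto simp: U_def\<close>)
  moreover have "at \<beta> within U = at \<beta>" using m by (intro at_within_open) (auto simp: U_def)
  ultimately show ?thesis
    unfolding I3_def I5_def by (simp only: cbox_interval integral_mult_right)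
qed

text \<open>Joint differentiability is needed because \<beta> and \<open>x\<close> vary together
  along a ray. The continuity demanded of one of the two partial derivatives is checked for the
  explicit one, in \<open>x\<close>.\<close>

lemma I3_has_derivative:
  assumes "adm \<beta> x"
  shows "((\<lambda>(\<beta>, x). I3 \<beta> x) has_derivative
    (\<lambda>(d, e). - 3/2 * I5 \<beta> x * d + 1 / sqrt (P \<beta> x) ^ 3 * e)) (at (\<beta>, x))"
proof -
  obtain X Y where XY: "open X" "open Y" "convex X" "convex Y" "\<beta> \<in> X" "x \<in> Y"
    "\<And>\<beta>' x'. \<beta>' \<in> X \<Longrightarrow> x' \<in> Y \<Longrightarrow> adm \<beta>' x'"
    using adm_neighbourhood[OF assms] by metis
  have pos: "P \<beta>' x' > 0" if "\<beta>' \<in> X" "x' \<in> Y" for \<beta>' x' using XY(7)[OF that] by (simp add: adm_def)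
  have "((\<lambda>(\<beta>, x). I3 \<beta> x) has_derivative
    (\<lambda>(d, e). - 3/2 * I5 \<beta> x * d + blinfun_apply (blinfun_mult_right (1 / sqrt (P \<beta> x) ^ 3)) e)) (at (\<beta>, x) within X \<times> Y)"
  proof (rule has_derivative_partialsI)
    show "((\<lambda>\<beta>. I3 \<beta> x) has_derivative (\<lambda>d. - 3/2 * I5 \<beta> x * d)) (at \<beta> within X)"
      using I3_DERIV_b[OF assms] unfolding has_field_derivative_def
      by (rule has_derivative_at_withinI)
    fix \<beta>' x' assume "\<beta>' \<in> X" "x' \<in> Y"
    then show "(I3 \<beta>' has_derivative blinfun_apply (blinfun_mult_right (1 / sqrt (P \<beta>' x') ^ 3))) (at x' within Y)"
      using I3_DERIV_x[OF XY(7)] unfolding has_field_derivative_def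
      by (auto intro: has_derivative_at_withinI)
  next
    have "continuous_on (X \<times> Y) (\<lambda>(\<beta>, x). blinfun_mult_right (1 / sqrt (P \<beta> x) ^ 3))"
      using pos unfolding split_beta
      by (intro continuous_intros bounded_linear.continuous_on[OF bounded_linear_blinfun_mult_right]) (auto, force)
    then show "continuous (at (\<beta>, x) within X \<times> Y) (\<lambda>(\<beta>, x). blinfun_mult_right (1 / sqrt (P \<beta> x) ^ 3))"
      using XY by (simp add: continuous_on_eq_continuous_within)
  qed (use XY in auto)
  moreover have "at (\<beta>, x) within X \<times> Y = at (\<beta>, x)"
    using XY by (intro at_within_open open_Times) auto
  ultimately show ?thesis by simp
qed

lemma I3_DERIV:
  assumes "adm (f s) (g s)"
    and f: "(f has_real_derivative f') (at s)" and g: "(g has_real_derivative g') (at s)"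
  shows "((\<lambda>s. I3 (f s) (g s)) has_real_derivative
    - 3/2 * I5 (f s) (g s) * f' + g' / sqrt (P (f s) (g s)) ^ 3) (at s)"
proof -
  have "((\<lambda>s. (f s, g s)) has_derivative (\<lambda>h. (f' * h, g' * h))) (at s)"
    using f g unfolding has_field_derivative_def by (intro has_derivative_Pair)
  from has_derivative_compose[OF this I3_has_derivative[OF assms(1)]]
  have "((\<lambda>s. I3 (f s) (g s)) has_derivative
     (\<lambda>h. - 3/2 * I5 (f s) (g s) * (f' * h) + 1 / sqrt (P (f s) (g s)) ^ 3 * (g' * h))) (at s)"
    by simp
  moreover have "(\<lambda>h. - 3/2 * I5 (f s) (g s) * (f' * h) + 1 / sqrt (P (f s) (g s)) ^ 3 * (g' * h))
     = (*) (- 3/2 * I5 (f s) (g s) * f' + g' / sqrt (P (f s) (g s)) ^ 3)"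
    by (auto simp: algebra_simps)
  ultimately show ?thesis by (simp only: has_field_derivative_def)
qed

lemma continuous_on_I3 [continuous_intros]:
  assumes "continuous_on S f" "continuous_on S g" "\<And>s. s \<in> S \<Longrightarrow> adm (f s) (g s)"
  shows "continuous_on S (\<lambda>s. I3 (f s) (g s))"
proof -
  have "continuous_on {(\<beta>, x). adm \<beta> x} (\<lambda>(\<beta>, x). I3 \<beta> x)"
    by (intro continuous_at_imp_continuous_on)
      (auto intro: has_derivative_continuous[OF I3_has_derivative])
  from continuous_on_compose2[OF this continuous_on_Pair[OF assms(1,2)]] assms(3)
  show ?thesis by auto
qed

lemma I3_lower:
  assumes "adm \<beta> x"
  shows "x \<le> I3 \<beta> x * sqrt (P \<beta> x) * (\<beta> + M * x ^ 3)"
proof -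
  have x: "x > 0" "\<beta> > 0" and p: "P \<beta> x > 0" using assms by (auto simp: adm_def)
  have "((\<lambda>w. (\<beta> + M * w ^ 3) / sqrt (P \<beta> w) ^ 3) has_integral
      x / sqrt (P \<beta> x) - 0 / sqrt (P \<beta> 0)) {0..x}"
  proof (rule fundamental_theorem_of_calculus)
    fix w assume w: "w \<in> {0..x}"
    then have p: "P \<beta> w > 0" using P_pos[OF assms] by simp
    define s where "s = sqrt (P \<beta> w)"
    have s: "s > 0" "P \<beta> w = s\<^sup>2" using p by (auto simp: s_def)
    have "((\<lambda>w. w / sqrt (P \<beta> w)) has_real_derivative
       (1 * s - w * ((0 + Pw w * 1) / (2 * s))) / (s * s)) (at w within {0..x})"
      unfolding s_def using p
      by (intro DERIV_divide sqrt_P_DERIV[where f = "\<lambda>_. \<beta>" and g = "\<lambda>w. w"] derivative_intros) auto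
    also have "(1 * s - w * ((0 + Pw w * 1) / (2 * s))) / (s * s) = (2 * s\<^sup>2 - w * Pw w) / (2 * s ^ 3)"
      using s by (simp add: field_simps power2_eq_square power3_eq_cube)
    also have "2 * s\<^sup>2 - w * Pw w = 2 * (\<beta> + M * w ^ 3)"
      unfolding s(2)[symmetric] by (simp add: P_def Pw_def power2_eq_square power3_eq_cube algebra_simps)
    also have "2 * (\<beta> + M * w ^ 3) / (2 * s ^ 3) = (\<beta> + M * w ^ 3) / s ^ 3"
      by (simp only: mult_divide_mult_cancel_left)
    finally show "((\<lambda>w. w / sqrt (P \<beta> w)) has_vector_derivative (\<beta> + M * w ^ 3) / sqrt (P \<beta> w) ^ 3) (at w within {0..x})"
      by (simp add: has_real_derivative_iff_has_vector_derivative s_def)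
  qed (use x in auto)
  \<comment> \<open>The numerator \<open>\<beta> + M * w ^ 3\<close> increases with
    \<open>w\<close>; freezing it at \<open>x\<close> leaves a multiple of
    \<open>I3\<close>.\<close>
  moreover have "((\<lambda>w. (\<beta> + M * x ^ 3) * (1 / sqrt (P \<beta> w) ^ 3)) has_integral (\<beta> + M * x ^ 3) * I3 \<beta> x) {0..x}"
    by (intro has_integral_mult_right I3_has_integral assms)
  ultimately have "x / sqrt (P \<beta> x) - 0 / sqrt (P \<beta> 0) \<le> (\<beta> + M * x ^ 3) * I3 \<beta> x"
  proof (rule has_integral_le)
    fix w assume w: "w \<in> {0..x}"
    then have "P \<beta> w > 0" using P_pos[OF assms] by simp
    moreover have "w ^ 3 \<le> x ^ 3" using w by (intro power_mono) auto
    ultimately show "(\<beta> + M * w ^ 3) / sqrt (P \<beta> w) ^ 3 \<le> (\<beta> + M * x ^ 3) * (1 / sqrt (P \<beta> w) ^ 3)"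
      using M_pos by (simp add: divide_right_mono)
  qed
  then show ?thesis using p by (simp add: field_simps)
qed

lemma I3_pos: "adm \<beta> x \<Longrightarrow> I3 \<beta> x > 0"
proof -
  assume a: "adm \<beta> x"
  then have "0 < x" "sqrt (P \<beta> x) * (\<beta> + M * x ^ 3) > 0"
    using M_pos by (auto simp: adm_def intro!: mult_pos_pos add_pos_pos)
  then show ?thesis using I3_lower[OF a] by (smt (verit) mult.assoc mult_nonpos_nonneg)
qed

text \<open>Comparison with the massless case: \<open>P \<beta> w \<le> \<beta> + w\<^sup>2\<close>,
  and \<open>\<beta> / sqrt (\<beta> + w\<^sup>2) ^ 3\<close> is the derivative of
  \<open>w / sqrt (\<beta> + w\<^sup>2)\<close>. Unlike \<open>I3_lower\<close> this keeps
  \<open>\<beta> * I3 \<beta> x\<close> away from \<open>0\<close> when \<beta> tends to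
  \<open>0\<close> at fixed \<open>x\<close>, as late times require.\<close>

lemma I3_lower':
  assumes "adm \<beta> x"
  shows "x \<le> I3 \<beta> x * \<beta> * sqrt (\<beta> + x\<^sup>2)"
proof -
  have x: "x > 0" "\<beta> > 0" using assms by (auto simp: adm_def)
  have pos: "\<beta> + w\<^sup>2 > 0" for w using x by (simp add: add_pos_nonneg)
  have "((\<lambda>w. \<beta> / sqrt (\<beta> + w\<^sup>2) ^ 3) has_integral
      x / sqrt (\<beta> + x\<^sup>2) - 0 / sqrt (\<beta> + 0\<^sup>2)) {0..x}"
  proof (rule fundamental_theorem_of_calculus)
    fix w assume w: "w \<in> {0..x}"
    define s where "s = sqrt (\<beta> + w\<^sup>2)"
    have s: "s > 0" "\<beta> + w\<^sup>2 = s\<^sup>2" using pos[of w] by (auto simp: s_def)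
    have "((\<lambda>w. sqrt (\<beta> + w\<^sup>2)) has_real_derivative inverse s / 2 * (2 * w)) (at w within {0..x})"
      unfolding s_def using pos[of w] by (intro DERIV_chain2[OF DERIV_real_sqrt]) (auto intro!: derivative_eq_intros)
    from DERIV_divide[OF DERIV_ident this] pos[of w]
    have "((\<lambda>w. w / sqrt (\<beta> + w\<^sup>2)) has_real_derivative
       (1 * s - w * (inverse s / 2 * (2 * w))) / (s * s)) (at w within {0..x})"
      unfolding s_def by simp
    also have "(1 * s - w * (inverse s / 2 * (2 * w))) / (s * s) = (s\<^sup>2 - w\<^sup>2) / s ^ 3"
      using s by (simp add: field_simps power2_eq_square power3_eq_cube)
    also have "s\<^sup>2 - w\<^sup>2 = \<beta>" using s by simp
    finally show "((\<lambda>w. w / sqrt (\<beta> + w\<^sup>2)) has_vector_derivative \<beta> / sqrt (\<beta> + w\<^sup>2) ^ 3) (at w within {0..x})"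
      by (simp add: has_real_derivative_iff_has_vector_derivative s_def)
  qed (use x in auto)
  moreover have "((\<lambda>w. \<beta> * (1 / sqrt (P \<beta> w) ^ 3)) has_integral \<beta> * I3 \<beta> x) {0..x}"
    by (intro has_integral_mult_right I3_has_integral assms)
  ultimately have "x / sqrt (\<beta> + x\<^sup>2) - 0 / sqrt (\<beta> + 0\<^sup>2) \<le> \<beta> * I3 \<beta> x"
  proof (rule has_integral_le)
    fix w assume w: "w \<in> {0..x}"
    then have "P \<beta> w > 0" using P_pos[OF assms] by simp
    moreover have "P \<beta> w \<le> \<beta> + w\<^sup>2" using P_le w by simp
    ultimately have "1 / sqrt (\<beta> + w\<^sup>2) ^ 3 \<le> 1 / sqrt (P \<beta> w) ^ 3"
      by (intro divide_left_mono power_mono mult_pos_pos zero_less_power) auto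
    then show "\<beta> / sqrt (\<beta> + w\<^sup>2) ^ 3 \<le> \<beta> * (1 / sqrt (P \<beta> w) ^ 3)"
      using x mult_left_mono[of _ _ \<beta>] by fastforce
  qed
  then show ?thesis using pos[of x] by (simp add: field_simps)
qed

lemma I3_upper:
  assumes "adm \<beta> x" "0 < m" "m \<le> \<beta>" "m \<le> P \<beta> x"
  shows "I3 \<beta> x \<le> x / sqrt m ^ 3"
proof -
  have "I3 \<beta> x \<le> x *\<^sub>R (1 / sqrt m ^ 3)"
  proof (rule has_integral_le[OF I3_has_integral[OF assms(1)]])
    show "((\<lambda>w. 1 / sqrt m ^ 3) has_integral x *\<^sub>R (1 / sqrt m ^ 3)) {0..x}"
      using has_integral_const_real[of "1 / sqrt m ^ 3" 0 x] assms(1) by (simp add: adm_def)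
    fix w assume "w \<in> {0..x}"
    then have "m \<le> P \<beta> w" using P_ge_min[of w x \<beta>] assms by simp
    then show "1 / sqrt (P \<beta> w) ^ 3 \<le> 1 / sqrt m ^ 3"
      using assms(2) by (intro divide_left_mono power_mono mult_pos_pos zero_less_power) auto
  qed
  then show ?thesis by simp
qed

text \<open>Integrates the derivative of \<open>w / sqrt (P \<beta> w) ^ 3\<close>, a function that
  vanishes at \<open>0\<close> and is positive at \<open>x\<close>. The inequality says that, at
  fixed \<open>x\<close>, the quantity \<open>b t * I3 (b t) x\<close> decays in time at a relative
  rate of at most \<open>6 * M * H t * x\<close>, which is small far out.\<close>

lemma I5_lower:
  assumes "adm \<beta> x" "4 * M * x \<le> 1"
  shows "(2 - 6 * M * x) * I3 \<beta> x \<le> 3 * \<beta> * I5 \<beta> x"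
proof -
  have x: "x > 0" "\<beta> > 0" and px: "P \<beta> x > 0" using assms by (auto simp: adm_def)
  have "((\<lambda>w. (3 * \<beta> - 2 * P \<beta> w + 3 * M * w ^ 3) / sqrt (P \<beta> w) ^ 5) has_integral
      x / sqrt (P \<beta> x) ^ 3 - 0 / sqrt (P \<beta> 0) ^ 3) {0..x}"
  proof (rule fundamental_theorem_of_calculus)
    fix w assume w: "w \<in> {0..x}"
    then have p: "P \<beta> w > 0" using P_pos[OF assms(1)] by simp
    define s where "s = sqrt (P \<beta> w)"
    have s: "s > 0" "P \<beta> w = s\<^sup>2" using p by (auto simp: s_def)
    have "((\<lambda>w. sqrt (P \<beta> w)) has_real_derivative ((0 + Pw w * 1) / (2 * s))) (at w within {0..x})"
      unfolding s_def using p
      by (intro sqrt_P_DERIV[where f = "\<lambda>_. \<beta>" and g = "\<lambda>w. w"] derivative_intros) auto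
    from DERIV_divide[OF DERIV_ident DERIV_power[OF this, of 3]] p
    have "((\<lambda>w. w / sqrt (P \<beta> w) ^ 3) has_real_derivative
       (1 * s ^ 3 - w * (3 * s\<^sup>2 * (Pw w / (2 * s)))) / (s ^ 3 * s ^ 3)) (at w within {0..x})"
      unfolding s_def by (simp add: mult_ac)
    also have "(1 * s ^ 3 - w * (3 * s\<^sup>2 * (Pw w / (2 * s)))) / (s ^ 3 * s ^ 3) = (2 * s\<^sup>2 - 3 * w * Pw w) / (2 * s ^ 5)"
      using s by (simp add: field_simps eval_nat_numeral)
    also have "2 * s\<^sup>2 - 3 * w * Pw w = 2 * (3 * \<beta> - 2 * s\<^sup>2 + 3 * M * w ^ 3)"
      unfolding s(2)[symmetric] by (simp add: P_def Pw_def power2_eq_square power3_eq_cube algebra_simps)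
    also have "2 * (3 * \<beta> - 2 * s\<^sup>2 + 3 * M * w ^ 3) / (2 * s ^ 5) = (3 * \<beta> - 2 * s\<^sup>2 + 3 * M * w ^ 3) / s ^ 5"
      by (simp only: mult_divide_mult_cancel_left)
    finally show "((\<lambda>w. w / sqrt (P \<beta> w) ^ 3) has_vector_derivative
       (3 * \<beta> - 2 * P \<beta> w + 3 * M * w ^ 3) / sqrt (P \<beta> w) ^ 5) (at w within {0..x})"
      unfolding has_real_derivative_iff_has_vector_derivative[symmetric] s_def[symmetric] unfolding s(2) .
  qed (use x in auto)
  moreover have "((\<lambda>w. (3 * \<beta>) * (1 / sqrt (P \<beta> w) ^ 5) - (2 - 6 * M * x) * (1 / sqrt (P \<beta> w) ^ 3))
      has_integral (3 * \<beta>) * I5 \<beta> x - (2 - 6 * M * x) * I3 \<beta> x) {0..x}"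
    by (intro has_integral_diff has_integral_mult_right I3_has_integral I5_has_integral assms)
  ultimately have "x / sqrt (P \<beta> x) ^ 3 - 0 / sqrt (P \<beta> 0) ^ 3 \<le> 3 * \<beta> * I5 \<beta> x - (2 - 6 * M * x) * I3 \<beta> x"
  proof (rule has_integral_le)
    fix w assume w: "w \<in> {0..x}"
    then have p: "P \<beta> w > 0" using P_pos[OF assms(1)] by simp
    define s where "s = sqrt (P \<beta> w)"
    have s: "s > 0" "P \<beta> w = s\<^sup>2" using p by (auto simp: s_def)
    \<comment> \<open>Since \<open>4 * M * w \<le> 1\<close>, the cubic term takes at most half of
      \<open>w\<^sup>2\<close>, so \<open>w\<^sup>2 \<le> 2 * P \<beta> w\<close>; this turns the
      leftover \<open>3 * M * w ^ 3\<close> into a multiple of \<open>P\<close>.\<close>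
    have "4 * M * w \<le> 4 * M * x" using w M_pos by (intro mult_left_mono) auto
    then have "4 * M * w \<le> 1" using assms(2) by simp
    then have "(4 * M * w) * w\<^sup>2 \<le> 1 * w\<^sup>2" by (intro mult_right_mono) auto
    then have "w\<^sup>2 \<le> 2 * s\<^sup>2"
      unfolding s(2)[symmetric] using x by (simp add: P_def power2_eq_square power3_eq_cube)
    then have "w\<^sup>2 * (3 * M * w) \<le> (2 * s\<^sup>2) * (3 * M * x)"
      using w M_pos by (intro mult_mono) auto
    then have "3 * \<beta> - 2 * s\<^sup>2 + 3 * M * w ^ 3 \<le> 3 * \<beta> - (2 - 6 * M * x) * s\<^sup>2"
      by (simp add: power2_eq_square power3_eq_cube algebra_simps)
    then have "(3 * \<beta> - 2 * s\<^sup>2 + 3 * M * w ^ 3) / s ^ 5 \<le> (3 * \<beta> - (2 - 6 * M * x) * s\<^sup>2) / s ^ 5"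
      using s by (intro divide_right_mono) auto
    also have "\<dots> = (3 * \<beta>) * (1 / s ^ 5) - (2 - 6 * M * x) * (1 / s ^ 3)"
      using s by (simp add: field_simps eval_nat_numeral)
    finally show "(3 * \<beta> - 2 * P \<beta> w + 3 * M * w ^ 3) / sqrt (P \<beta> w) ^ 5
       \<le> (3 * \<beta>) * (1 / sqrt (P \<beta> w) ^ 5) - (2 - 6 * M * x) * (1 / sqrt (P \<beta> w) ^ 3)"
      unfolding s_def[symmetric] unfolding s(2) .
  qed
  moreover have "0 \<le> x / sqrt (P \<beta> x) ^ 3" using x px by simp
  ultimately show ?thesis by simp
qed

lemma kappa_eq_P: "u > 0 \<Longrightarrow> 1 - 2 * M / u + u\<^sup>2 * \<beta> = u\<^sup>2 * P \<beta> (1 / u)"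
  by (simp add: P_def field_simps power2_eq_square power3_eq_cube)

text \<open>Under \<open>u = 1 / w\<close> the function \<open>- I3 \<beta> (1 / u)\<close> is an
  antiderivative. It tends to \<open>0\<close> at infinity by \<open>I3_upper\<close>, with the same
  \<open>m\<close> for all \<open>u \<ge> r\<close>, and since the integrand is nonnegative the
  integrals over \<open>{r..y}\<close> determine the one over \<open>{r..}\<close>.\<close>

lemma I3_improper:
  assumes "r > 0" "adm \<beta> (1 / r)"
  shows "((\<lambda>u. u * (1 - 2 * M / u + u\<^sup>2 * \<beta>) powr (-3/2)) has_integral I3 \<beta> (1 / r)) {r..}"
proof -
  let ?h = "\<lambda>u. u * (1 - 2 * M / u + u\<^sup>2 * \<beta>) powr (-3/2)"
  have adm: "adm \<beta> (1 / u)" if "u \<ge> r" for u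
    using P_pos[OF assms(2), of "1 / u"] assms that
    by (auto simp: adm_def divide_simps)
  have h: "?h u = 1 / sqrt (P \<beta> (1 / u)) ^ 3 * (1 / u\<^sup>2)" if u: "u \<ge> r" for u
  proof -
    have u0: "u > 0" using u assms by simp
    have p: "P \<beta> (1 / u) > 0" using adm[OF u] by (simp add: adm_def)
    have "(u\<^sup>2 * P \<beta> (1 / u)) powr (-3/2) = (sqrt (u\<^sup>2 * P \<beta> (1 / u))) powr (-3)"
      using u0 p by (simp add: powr_half_sqrt[symmetric] powr_powr)
    also have "\<dots> = inverse ((u * sqrt (P \<beta> (1 / u))) ^ 3)"
      using u0 p by (simp add: powr_minus real_sqrt_mult powr_numeral)
    finally show ?thesis
      using u0 p unfolding kappa_eq_P[OF u0] by (simp add: field_simps eval_nat_numeral)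
  qed
  have int: "(?h has_integral I3 \<beta> (1 / r) - I3 \<beta> (1 / y)) {r..y}" if "y \<ge> r" for y
  proof -
    have "(?h has_integral (- I3 \<beta> (1 / y)) - (- I3 \<beta> (1 / r))) {r..y}"
    proof (rule fundamental_theorem_of_calculus[OF that])
      fix u assume u: "u \<in> {r..y}"
      then have "((\<lambda>u. 1 / u) has_real_derivative - (1 / u\<^sup>2)) (at u)"
        using assms by (auto intro!: derivative_eq_intros simp: power2_eq_square)
      from DERIV_minus[OF DERIV_chain2[OF I3_DERIV_x[OF adm] this]]
      have "((\<lambda>u. - I3 \<beta> (1 / u)) has_real_derivative ?h u) (at u)"
        using u h[of u] by simp
      then show "((\<lambda>u. - I3 \<beta> (1 / u)) has_vector_derivative ?h u) (at u within {r..y})"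
        by (simp add: has_real_derivative_iff_has_vector_derivative has_vector_derivative_at_within)
    qed
    then show ?thesis by simp
  qed
  show ?thesis
  proof (rule has_integral_to_inf)
    show "?h integrable_on {r..y}" for y
      using int[of y] by (cases "y \<ge> r") (auto simp: integrable_on_def)
    define m where "m = min \<beta> (P \<beta> (1 / r))"
    have m: "m > 0" using assms(2) by (simp add: adm_def m_def)
    have lim: "((\<lambda>y. I3 \<beta> (1 / y)) \<longlongrightarrow> 0) at_top"
    proof (rule tendsto_sandwich)
      show "\<forall>\<^sub>F y in at_top. 0 \<le> I3 \<beta> (1 / y)"
        using eventually_ge_at_top[of r] by eventually_elim (use I3_pos[OF adm] in \<open>auto intro: less_imp_le\<close>)
      show "\<forall>\<^sub>F y in at_top. I3 \<beta> (1 / y) \<le> (1 / y) / sqrt m ^ 3"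
        using eventually_ge_at_top[of r]
      proof eventually_elim
        case (elim y)
        have "m \<le> P \<beta> (1 / y)"
          using P_ge_min[of "1 / y" "1 / r" \<beta>] assms elim by (simp add: m_def divide_simps)
        then show ?case using m by (intro I3_upper adm elim) (auto simp: m_def)
      qed
      have "((\<lambda>y::real. inverse y / sqrt m ^ 3) \<longlongrightarrow> 0 / sqrt m ^ 3) at_top"
        using m by (intro tendsto_divide tendsto_inverse_0_at_top filterlim_ident tendsto_const) auto
      then show "((\<lambda>y::real. (1 / y) / sqrt m ^ 3) \<longlongrightarrow> 0) at_top" by (simp add: inverse_eq_divide)
    qed simp
    have "((\<lambda>y. I3 \<beta> (1 / r) - I3 \<beta> (1 / y)) \<longlongrightarrow> I3 \<beta> (1 / r) - 0) at_top"
      by (intro tendsto_intros lim)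
    moreover have "\<forall>\<^sub>F y in at_top. I3 \<beta> (1 / r) - I3 \<beta> (1 / y) = integral {r..y} ?h"
      using eventually_ge_at_top[of r] by eventually_elim (rule integral_unique[OF int, symmetric])
    ultimately show "((\<lambda>y. integral {r..y} ?h) \<longlongrightarrow> I3 \<beta> (1 / r)) at_top"
      using Lim_transform_eventually by fastforce
    show "?h y \<ge> 0" if "y \<ge> r" for y using that assms by simp
  qed
qed

end

section \<open>Null geodesics of a block metric\<close>

lemma vector_4 [simp]:
  "(vector [x, y, z, w] :: 'a::zero ^ 4) $ 1 = x"
  "(vector [x, y, z, w] :: 'a ^ 4) $ 2 = y"
  "(vector [x, y, z, w] :: 'a ^ 4) $ 3 = z"
  "(vector [x, y, z, w] :: 'a ^ 4) $ 4 = w"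
  unfolding vector_def by simp_all

lemma partial_deriv_eqI:
  "((\<lambda>h. f (x + h *\<^sub>R axis i 1)) has_real_derivative d) (at 0) \<Longrightarrow> partial_deriv i f x = d"
  unfolding partial_deriv_def by (rule DERIV_imp_deriv)

lemma matrix_inv_eqI:
  fixes A :: "'a::field ^ 'n ^ 'n"
  assumes "A ** B = mat 1" shows "matrix_inv A = B"
proof -
  have BA: "B ** A = mat 1" using assms by (simp add: matrix_left_right_inverse)
  have "A ** matrix_inv A = mat 1 \<and> matrix_inv A ** A = mat 1"
    unfolding matrix_inv_def by (rule someI[of _ B]) (simp add: assms BA)
  then have "matrix_inv A ** A ** B = B" by simp
  then show ?thesis by (simp add: matrix_mul_assoc[symmetric] assms)
qed

text \<open>
  The metric is \<open>D (dr - F dt)\<^sup>2 + 2 K dt (dr - F dt)\<close> on the \<open>(t, r)\<close>-plane, so that \<open>dr = F dt\<close> is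
  one of its two null directions, and diagonal on the remaining coordinates.
\<close>

definition null_block :: "real \<Rightarrow> real \<Rightarrow> real \<Rightarrow> real \<Rightarrow> real \<Rightarrow> real ^ 4 ^ 4" where
  "null_block D F K c d = vector
     [vector [D * F\<^sup>2 - 2 * K * F, K - D * F, 0, 0],
      vector [K - D * F,           D,         0, 0],
      vector [0, 0, c, 0],
      vector [0, 0, 0, d]]"

lemma matrix_inv_null_block:
  assumes "K \<noteq> 0" "c \<noteq> 0" "d \<noteq> 0"
  shows "matrix_inv (null_block D F K c d) = vector
     [vector [- D / K\<^sup>2,        (K - D * F) / K\<^sup>2,           0, 0],
      vector [(K - D * F) / K\<^sup>2, (2 * K * F - D * F\<^sup>2) / K\<^sup>2, 0, 0],
      vector [0, 0, 1 / c, 0],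
      vector [0, 0, 0, 1 / d]]"
  by (rule matrix_inv_eqI)
    (use assms in \<open>simp add: vec_eq_iff forall_4 matrix_matrix_mult_def sum_4 null_block_def mat_def
      field_simps power2_eq_square\<close>)

text \<open>Summing against the velocity before raising the index leaves four covariant components
  to compute instead of all Christoffel symbols.\<close>

lemma christoffel_contraction:
  fixes g :: "real ^ 'n \<Rightarrow> real ^ 'n ^ 'n"
  shows "(\<Sum>i\<in>UNIV. \<Sum>j\<in>UNIV. christoffel g x k i j * v $ i * v $ j) =
    (\<Sum>l\<in>UNIV. matrix_inv (g x) $ k $ l * (\<Sum>i\<in>UNIV. \<Sum>j\<in>UNIV.
      (1/2) * (partial_deriv i (\<lambda>y. g y $ j $ l) x + partial_deriv j (\<lambda>y. g y $ i $ l) x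
         - partial_deriv l (\<lambda>y. g y $ i $ j) x) * v $ i * v $ j))"
proof -
  have swap: "(\<Sum>i\<in>UNIV. \<Sum>j\<in>UNIV. \<Sum>l\<in>UNIV. h i j l) = (\<Sum>l\<in>UNIV. \<Sum>i\<in>UNIV. \<Sum>j\<in>UNIV. h i j l)"
    for h :: "'n \<Rightarrow> 'n \<Rightarrow> 'n \<Rightarrow> real"
  proof -
    have "(\<Sum>i\<in>UNIV. \<Sum>j\<in>UNIV. \<Sum>l\<in>UNIV. h i j l) = (\<Sum>i\<in>UNIV. \<Sum>l\<in>UNIV. \<Sum>j\<in>UNIV. h i j l)"
      by (intro sum.cong refl sum.swap)
    also have "\<dots> = (\<Sum>l\<in>UNIV. \<Sum>i\<in>UNIV. \<Sum>j\<in>UNIV. h i j l)" by (rule sum.swap)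
    finally show ?thesis .
  qed
  show ?thesis
    unfolding christoffel_def sum_distrib_left sum_distrib_right
    by (subst swap) (intro sum.cong refl, simp)
qed

text \<open>In \<open>D * (dr - F dt)^2\<close> the bracket vanishes along \<open>v\<close>, so no
  derivative of \<open>D\<close> survives, and after the index is raised \<open>D\<close> itself has
  dropped out. For \<open>p = dt/ds\<close> the first component says that \<open>K * p\<close> has
  logarithmic derivative \<open>- p * Fr\<close>, which is why the equation can be integrated
  explicitly.\<close>

lemma null_geodesic_acceleration:
  fixes g :: "real ^ 4 \<Rightarrow> real ^ 4 ^ 4"
  assumes g: "g x = null_block D F K c d" and nz: "K \<noteq> 0" "c \<noteq> 0" "d \<noteq> 0"
    and block: "\<And>i j l. l \<in> {3, 4} \<Longrightarrow> j \<in> {1, 2} \<Longrightarrow> i \<in> {1, 2} \<Longrightarrow> partial_deriv i (\<lambda>y. g y $ j $ l) x = 0"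
    and fibre: "\<And>i j l. l \<in> {3, 4} \<Longrightarrow> j \<in> {1, 2} \<Longrightarrow> i \<in> {1, 2} \<Longrightarrow> partial_deriv l (\<lambda>y. g y $ i $ j) x = 0"
    and 1: "partial_deriv 1 (\<lambda>y. g y $ 1 $ 1) x = Dt * F\<^sup>2 + 2 * D * F * Ft - 2 * Kt * F - 2 * K * Ft"
      "partial_deriv 1 (\<lambda>y. g y $ 1 $ 2) x = Kt - Dt * F - D * Ft"
      "partial_deriv 1 (\<lambda>y. g y $ 2 $ 1) x = Kt - Dt * F - D * Ft"
      "partial_deriv 1 (\<lambda>y. g y $ 2 $ 2) x = Dt"
    and 2: "partial_deriv 2 (\<lambda>y. g y $ 1 $ 1) x = Dr * F\<^sup>2 + 2 * D * F * Fr - 2 * Kr * F - 2 * K * Fr"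
      "partial_deriv 2 (\<lambda>y. g y $ 1 $ 2) x = Kr - Dr * F - D * Fr"
      "partial_deriv 2 (\<lambda>y. g y $ 2 $ 1) x = Kr - Dr * F - D * Fr"
      "partial_deriv 2 (\<lambda>y. g y $ 2 $ 2) x = Dr"
    and v: "v $ 1 = p" "v $ 2 = p * F" "v $ 3 = 0" "v $ 4 = 0"
  defines "q \<equiv> - (p\<^sup>2 * (Kt + F * Kr + K * Fr)) / K"
  shows "(\<chi> k. - (\<Sum>i\<in>UNIV. \<Sum>j\<in>UNIV. christoffel g x k i j * v $ i * v $ j)) =
    vector [q, q * F + p\<^sup>2 * (Ft + F * Fr), 0, 0]"
proof -
  define w where "w l = (\<Sum>i\<in>UNIV. \<Sum>j\<in>UNIV.
      (1/2) * (partial_deriv i (\<lambda>y. g y $ j $ l) x + partial_deriv j (\<lambda>y. g y $ i $ l) x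
         - partial_deriv l (\<lambda>y. g y $ i $ j) x) * v $ i * v $ j)" for l
  have w3: "w 3 = 0" "w 4 = 0"
    by (simp_all add: w_def sum_4 v block fibre)
  have w2: "w 2 = p\<^sup>2 * (Kt + F * Kr + K * Fr - D * (Ft + F * Fr))"
    by (simp add: w_def sum_4 v 1 2) (simp add: power2_eq_square field_simps)
  have w1: "w 1 = p\<^sup>2 * (D * F * (Ft + F * Fr) - F * (Kt + F * Kr) - K * Ft - 2 * K * F * Fr)"
    by (simp add: w_def sum_4 v 1 2) (simp add: power2_eq_square field_simps)
  show ?thesis
    unfolding christoffel_contraction w_def[symmetric] g matrix_inv_null_block[OF nz]
    using nz by (simp add: vec_eq_iff forall_4 sum_4 w1 w2 w3 q_def) (simp add: field_simps power2_eq_square)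
qed

section \<open>The metric in the allowed region\<close>

locale expanding = mass +
  fixes a :: "real \<Rightarrow> real"
  assumes a_pos: "t > 0 \<Longrightarrow> a t > 0"
    and a_differentiable: "t > 0 \<Longrightarrow> a differentiable (at t)"
    and a'_differentiable: "t > 0 \<Longrightarrow> deriv a differentiable (at t)"
    and hubble_pos: "t > 0 \<Longrightarrow> hubble a t > 0"
    and a_unbounded: "filterlim a at_top at_top"
begin

abbreviation H :: "real \<Rightarrow> real" where "H \<equiv> hubble a"

definition b :: "real \<Rightarrow> real" where "b t = 1 / (a t)\<^sup>2"

lemma b_pos: "t > 0 \<Longrightarrow> b t > 0"
  using a_pos[of t] by (simp add: b_def)

lemma a_DERIV: "t > 0 \<Longrightarrow> (a has_real_derivative H t * a t) (at t)"
  using DERIV_deriv_iff_real_differentiable[of a t] a_differentiable[of t] a_pos[of t]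
  by (simp add: hubble_def)

lemma b_DERIV: "t > 0 \<Longrightarrow> (b has_real_derivative - 2 * H t * b t) (at t)"
  unfolding b_def
  by (rule derivative_eq_intros a_DERIV refl | use a_pos[of t] in
    \<open>simp add: power2_eq_square field_simps\<close>)+

lemma H_DERIV: "t > 0 \<Longrightarrow> (H has_real_derivative deriv H t) (at t)"
proof -
  assume "t > 0"
  then have "(\<lambda>t. deriv a t / a t) differentiable (at t)"
    using a'_differentiable[of t] a_differentiable[of t] a_pos[of t]
    by (intro differentiable_divide) auto
  moreover have "H = (\<lambda>t. deriv a t / a t)" by (simp add: fun_eq_iff hubble_def)
  ultimately show ?thesis by (simp add: DERIV_deriv_iff_real_differentiable)
qed

lemma continuous_on_b: "continuous_on {0<..} b"
  by (intro continuous_at_imp_continuous_on ballI) (auto intro: DERIV_isCont b_DERIV)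

lemma continuous_on_H: "continuous_on {0<..} H"
  by (intro continuous_at_imp_continuous_on ballI) (auto intro: DERIV_isCont H_DERIV)

lemma kappa_P: "r > 0 \<Longrightarrow> \<kappa> M a t r = r\<^sup>2 * P (b t) (1 / r)"
  using kappa_eq_P[of r "b t"] by (simp add: \<kappa>_def b_def)

definition region :: "real \<Rightarrow> real \<Rightarrow> bool" where
  "region t r \<longleftrightarrow> t > 0 \<and> r > 0 \<and> adm (b t) (1 / r)"

lemma region_iff: "region t r \<longleftrightarrow> t > 0 \<and> r > 0 \<and> P (b t) (1 / r) > 0"
  using b_pos by (auto simp: region_def adm_def)

text \<open>\<open>r * \<kappa>\<close> equals \<open>f r\<close>, which is strictly increasing for
  \<open>r \<ge> 0\<close>, negative at \<open>0\<close> and positive at \<open>2 * M\<close>. So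
  the zero that defines \<open>r1\<close> exists and is unique, and
  \<open>f r = r ^ 3 * P (b t) (1 / r)\<close> has the sign of \<open>P\<close>.\<close>

lemma allowed_region_iff: "(t, r) \<in> allowed_region M a \<longleftrightarrow> region t r"
proof (cases "t > 0")
  case True
  define f where "f r = b t * r ^ 3 + r - 2 * M" for r
  have b: "b t > 0" using True by (rule b_pos)
  have mono: "f r < f s" if "0 \<le> r" "r < s" for r s
    using that b power_strict_mono[of r s 3] by (simp add: f_def add_strict_mono)
  have "\<exists>r\<ge>0. r \<le> 2 * M \<and> f r = 0"
    using M_pos b by (intro IVT) (auto simp: f_def intro!: continuous_intros)
  then obtain z where z: "z \<ge> 0" "f z = 0" by blast
  then have "z > 0" using M_pos by (cases "z = 0") (auto simp: f_def)
  have kf: "\<kappa> M a t r = f r / r" if "r > 0" for r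
    using that by (simp add: \<kappa>_def f_def b_def field_simps power2_eq_square power3_eq_cube)
  have "r1 M a t = z"
    unfolding r1_def
  proof (rule the_equality)
    fix r assume r: "r > 0 \<and> \<kappa> M a t r = 0"
    then have "f r = 0" using kf[of r] by auto
    then have "f r = f z" using z by simp
    then show "r = z" using mono[of r z] mono[of z r] r z by (cases r z rule: linorder_cases) auto
  qed (use kf z \<open>z > 0\<close> in auto)
  moreover have "r > z \<longleftrightarrow> r > 0 \<and> f r > 0" for r
    using mono[of r z] mono[of z r] \<open>z > 0\<close> z by (cases r z rule: linorder_cases) auto
  moreover have "f r > 0 \<longleftrightarrow> P (b t) (1 / r) > 0" if "r > 0" for r
  proof -
    have "f r = r * \<kappa> M a t r" using that by (simp add: kf)
    then have "f r = r ^ 3 * P (b t) (1 / r)"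
      using that by (simp add: kappa_P power2_eq_square power3_eq_cube)
    then show ?thesis using that by (simp add: zero_less_mult_iff)
  qed
  ultimately show ?thesis using True by (auto simp: allowed_region_def region_iff)
qed (simp add: allowed_region_def region_iff)

lemma sqrt_kappa: "region t r \<Longrightarrow> sqrt (\<kappa> M a t r) = r * sqrt (P (b t) (1 / r))"
  by (simp add: region_iff kappa_P real_sqrt_mult)

lemma sigma_eq:
  assumes "region t r"
  shows "\<sigma> M a t r = H t * b t * r * sqrt (P (b t) (1 / r)) * I3 (b t) (1 / r)"
proof -
  have "((\<lambda>u. u * \<kappa> M a t u powr (-3/2)) has_integral I3 (b t) (1 / r)) {r..}"
    using I3_improper[of r "b t"] assms by (simp add: region_def \<kappa>_def b_def)
  then show ?thesis
    by (simp add: \<sigma>_def integral_unique sqrt_kappa[OF assms] b_def)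
qed

section \<open>Slope of the outgoing rays and the coefficients of the metric in null form\<close>

definition Q :: "real \<Rightarrow> real \<Rightarrow> real" where
  "Q t x = b t * sqrt (P (b t) x) * I3 (b t) x * (H t + sqrt (P (b t) x))"

definition Qx :: "real \<Rightarrow> real \<Rightarrow> real" where
  "Qx t x = b t * (Pw x * I3 (b t) x * (H t / sqrt (P (b t) x) + 2) / 2
     + (H t + sqrt (P (b t) x)) / P (b t) x)"

definition Qt :: "real \<Rightarrow> real \<Rightarrow> real" where
  "Qt t x = (let \<beta> = b t; \<beta>' = - 2 * H t * b t; s = sqrt (P (b t) x); I = I3 (b t) x in
     \<beta>' * s * I * (H t + s) + \<beta> * (\<beta>' / (2 * s)) * I * (H t + s)
     + \<beta> * s * (- 3/2 * I5 (b t) x * \<beta>') * (H t + s) + \<beta> * s * I * (deriv H t + \<beta>' / (2 * s)))"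

lemma Q_DERIV:
  assumes f: "(f has_real_derivative f') (at s)" and g: "(g has_real_derivative g') (at s)"
    and pos: "f s > 0" and adm: "adm (b (f s)) (g s)"
  shows "((\<lambda>s. Q (f s) (g s)) has_real_derivative Qt (f s) (g s) * f' + Qx (f s) (g s) * g') (at s)"
proof -
  define \<beta> \<beta>' y I h where "\<beta> = b (f s)" and "\<beta>' = - 2 * H (f s) * b (f s)"
    and "y = sqrt (P (b (f s)) (g s))" and "I = I3 (b (f s)) (g s)" and "h = H (f s)"
  have P: "P (b (f s)) (g s) > 0" using adm by (simp add: adm_def)
  then have y: "y > 0" "P (b (f s)) (g s) = y\<^sup>2" by (auto simp: y_def)
  have db: "((\<lambda>s. b (f s)) has_real_derivative \<beta>' * f') (at s)"
    unfolding \<beta>'_def by (rule DERIV_chain2[OF b_DERIV[OF pos] f])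
  have dH: "((\<lambda>s. H (f s)) has_real_derivative deriv H (f s) * f') (at s)"
    by (rule DERIV_chain2[OF H_DERIV[OF pos] f])
  have dy: "((\<lambda>s. sqrt (P (b (f s)) (g s))) has_real_derivative (\<beta>' * f' + Pw (g s) * g') / (2 * y)) (at s)"
    unfolding y_def by (rule sqrt_P_DERIV[OF db g P])
  have dI: "((\<lambda>s. I3 (b (f s)) (g s)) has_real_derivative
      - 3/2 * I5 (b (f s)) (g s) * (\<beta>' * f') + g' / y ^ 3) (at s)"
    unfolding y_def by (rule I3_DERIV[where f = "\<lambda>s. b (f s)", OF adm db g])
  note d = DERIV_mult[OF DERIV_mult[OF DERIV_mult[OF db dy] dI] DERIV_add[OF dH dy]]
  show ?thesis
    unfolding Q_def
    by (rule DERIV_cong[OF d], fold \<beta>_def y_def I_def)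
      (unfold Qt_def Qx_def Let_def, fold \<beta>'_def \<beta>_def y_def I_def,
       use y in \<open>simp add: y(2)[folded \<beta>_def] field_simps power2_eq_square power3_eq_cube\<close>)
qed

definition K :: "real \<Rightarrow> real \<Rightarrow> real" where "K t r = b t * I3 (b t) (1 / r)"

definition Kt :: "real \<Rightarrow> real \<Rightarrow> real" where
  "Kt t r = - 2 * H t * b t * (I3 (b t) (1 / r) - 3/2 * b t * I5 (b t) (1 / r))"

definition Kr :: "real \<Rightarrow> real \<Rightarrow> real" where
  "Kr t r = - b t / (r\<^sup>2 * sqrt (P (b t) (1 / r)) ^ 3)"

text \<open>The slope \<open>dr/dt\<close> of an outgoing ray: under \<open>r = 1 / x\<close> the
  equation \<open>x' = - Q\<close> becomes \<open>r' = r\<^sup>2 * Q\<close>. \<open>Ft\<close> and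
  \<open>Fr\<close> are its partial derivatives.\<close>

definition F :: "real \<Rightarrow> real \<Rightarrow> real" where "F t r = r\<^sup>2 * Q t (1 / r)"

definition Ft :: "real \<Rightarrow> real \<Rightarrow> real" where "Ft t r = r\<^sup>2 * Qt t (1 / r)"

definition Fr :: "real \<Rightarrow> real \<Rightarrow> real" where "Fr t r = 2 * r * Q t (1 / r) - Qx t (1 / r)"

lemma K_pos: "region t r \<Longrightarrow> K t r > 0"
  using I3_pos b_pos by (simp add: K_def region_def)

lemma inverse_DERIV:
  assumes "(g has_real_derivative g') (at s)" "g s > (0::real)"
  shows "((\<lambda>s. 1 / g s) has_real_derivative - g' / (g s)\<^sup>2) (at s)"
  using DERIV_divide[OF DERIV_const[of 1] assms(1)] assms(2) by (simp add: power2_eq_square)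

lemma K_DERIV:
  assumes f: "(f has_real_derivative f') (at s)" and g: "(g has_real_derivative g') (at s)"
    and reg: "region (f s) (g s)"
  shows "((\<lambda>s. K (f s) (g s)) has_real_derivative Kt (f s) (g s) * f' + Kr (f s) (g s) * g') (at s)"
proof -
  have pos: "f s > 0" "g s > 0" "adm (b (f s)) (1 / g s)" using reg by (auto simp: region_def)
  then have P: "P (b (f s)) (1 / g s) > 0" by (simp add: adm_def)
  have db: "((\<lambda>s. b (f s)) has_real_derivative (- 2 * H (f s) * b (f s)) * f') (at s)"
    by (rule DERIV_chain2[OF b_DERIV[OF pos(1)] f])
  note dI = I3_DERIV[where f = "\<lambda>s. b (f s)" and g = "\<lambda>s. 1 / g s", OF pos(3) db inverse_DERIV[OF g pos(2)]]
  show ?thesis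
    unfolding K_def
    by (rule DERIV_cong[OF DERIV_mult[OF db dI]])
      (use P pos in \<open>simp add: Kt_def Kr_def field_simps\<close>)
qed

lemma F_DERIV:
  assumes f: "(f has_real_derivative f') (at s)" and g: "(g has_real_derivative g') (at s)"
    and reg: "region (f s) (g s)"
  shows "((\<lambda>s. F (f s) (g s)) has_real_derivative Ft (f s) (g s) * f' + Fr (f s) (g s) * g') (at s)"
proof -
  have pos: "f s > 0" "g s > 0" "adm (b (f s)) (1 / g s)" using reg by (auto simp: region_def)
  note dQ = Q_DERIV[where g = "\<lambda>s. 1 / g s", OF f inverse_DERIV[OF g pos(2)] pos(1) pos(3)]
  show ?thesis
    unfolding F_def
    by (rule DERIV_cong[OF DERIV_mult[OF DERIV_power[OF g, of 2] dQ]])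
      (use pos in \<open>simp add: Ft_def Fr_def field_simps power2_eq_square\<close>)
qed

lemma F_eq:
  assumes "region t r"
  shows "\<sigma> M a t r * (r + sqrt (\<kappa> M a t r) / H t) = F t r"
proof -
  have "H t > 0" using assms hubble_pos by (simp add: region_def)
  then show ?thesis
    unfolding sigma_eq[OF assms] sqrt_kappa[OF assms] F_def Q_def
    by (simp add: field_simps power2_eq_square)
qed

text \<open>The mixed coefficient forces \<open>K = (F - \<sigma> * r) / \<kappa>\<close>, that is
  \<open>\<sigma> / (H * sqrt \<kappa>)\<close>; on inserting \<open>sigma_eq\<close> the Hubble
  factor cancels and \<open>b t * I3\<close> remains.\<close>

lemma metric_null_block:
  assumes "region (x $ 1) (x $ 2)"
  shows "mcvittie_metric M a x = null_block (1 / \<kappa> M a (x $ 1) (x $ 2)) (F (x $ 1) (x $ 2))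
     (K (x $ 1) (x $ 2)) ((x $ 2)\<^sup>2) ((x $ 2)\<^sup>2 * (sin (x $ 3))\<^sup>2)"
proof -
  define t r s I where "t = x $ 1" and "r = x $ 2" and "s = sqrt (P (b t) (1 / r))" and "I = I3 (b t) (1 / r)"
  have reg: "region t r" using assms by (simp add: t_def r_def)
  then have pos: "t > 0" "r > 0" "P (b t) (1 / r) > 0" by (auto simp: region_iff)
  have h: "H t > 0" using hubble_pos pos by simp
  have s: "s > 0" "P (b t) (1 / r) = s\<^sup>2" using pos by (auto simp: s_def)
  have \<sigma>: "\<sigma> M a t r = H t * b t * r * s * I" by (simp add: sigma_eq[OF reg] s_def I_def)
  have \<kappa>: "\<kappa> M a t r = r\<^sup>2 * s\<^sup>2" using pos s by (simp add: kappa_P)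
  have F: "F t r = r\<^sup>2 * (b t * s * I * (H t + s))" by (simp add: F_def Q_def s_def I_def)
  have K: "K t r = b t * I" by (simp add: K_def I_def)
  have 1: "- (H t * b t * r * s * I)\<^sup>2 * (1 / (H t)\<^sup>2 - r\<^sup>2 / (r\<^sup>2 * s\<^sup>2))
    = 1 / (r\<^sup>2 * s\<^sup>2) * (r\<^sup>2 * (b t * s * I * (H t + s)))\<^sup>2 - 2 * (b t * I) * (r\<^sup>2 * (b t * s * I * (H t + s)))"
    using pos h s by (simp add: field_simps power2_eq_square)
  have 2: "- (H t * b t * r * s * I) * r / (r\<^sup>2 * s\<^sup>2) = b t * I - 1 / (r\<^sup>2 * s\<^sup>2) * (r\<^sup>2 * (b t * s * I * (H t + s)))"
    using pos h s by (simp add: field_simps power2_eq_square)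
  show ?thesis
    unfolding mcvittie_metric_def Let_def null_block_def
    unfolding t_def[symmetric] r_def[symmetric] \<sigma> \<kappa> F K 1 2 ..
qed

lemma open_region: "open {(t, r). region t r}"
proof -
  have "open (({0<..} \<times> {0<..}) \<inter> (\<lambda>p. P (b (fst p)) (1 / snd p)) -` {0<..})"
    by (intro continuous_open_preimage continuous_intros continuous_on_compose2[OF continuous_on_b])
      (auto intro: open_Times)
  moreover have "{(t, r). region t r} = ({0<..} \<times> {0<..}) \<inter> (\<lambda>p. P (b (fst p)) (1 / snd p)) -` {0<..}"
    by (auto simp: region_iff)
  ultimately show ?thesis by simp
qed

text \<open>The closed form of the metric is available only inside the region, while the lines along
  which partial derivatives are taken may leave it. The region being open, agreement near
  \<open>h = 0\<close> is enough.\<close>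

lemma region_curve_DERIV:
  fixes f g :: "real \<Rightarrow> real"
  assumes f: "continuous_on UNIV f" and g: "continuous_on UNIV g" and reg: "region (f 0) (g 0)"
    and eq: "\<And>h. region (f h) (g h) \<Longrightarrow> A h = B h" and B: "(B has_real_derivative d) (at 0)"
  shows "(A has_real_derivative d) (at 0)"
proof -
  have "open ((\<lambda>h. (f h, g h)) -` {(t, r). region t r})"
    by (intro open_vimage open_region continuous_on_Pair f g)
  from has_field_derivative_transform_within_open[OF B this] reg eq
  show ?thesis by auto
qed

lemma mcvittie_null_acceleration:
  assumes x: "x \<in> spacetime M a"
    and v: "v $ 1 = p" "v $ 2 = p * F (x $ 1) (x $ 2)" "v $ 3 = 0" "v $ 4 = 0"
  defines "q \<equiv> - (p\<^sup>2 * (Kt (x $ 1) (x $ 2) + F (x $ 1) (x $ 2) * Kr (x $ 1) (x $ 2)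
     + K (x $ 1) (x $ 2) * Fr (x $ 1) (x $ 2))) / K (x $ 1) (x $ 2)"
  shows "(\<chi> k. - (\<Sum>i\<in>UNIV. \<Sum>j\<in>UNIV.
      christoffel (mcvittie_metric M a) x k i j * v $ i * v $ j)) =
    vector [q, q * F (x $ 1) (x $ 2) + p\<^sup>2 * (Ft (x $ 1) (x $ 2) + F (x $ 1) (x $ 2) * Fr (x $ 1) (x $ 2)), 0, 0]"
proof -
  define t r where "t = x $ 1" and "r = x $ 2"
  define D where "D t r = 1 / \<kappa> M a t r" for t r
  have reg: "region t r" using x by (simp add: spacetime_def allowed_region_iff t_def r_def)
  then have pos: "t > 0" "r > 0" "P (b t) (1 / r) > 0" by (auto simp: region_iff)
  have "sin (x $ 3) > 0" using x by (intro sin_gt_zero) (auto simp: spacetime_def)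
  have \<kappa>: "\<kappa> M a t r \<noteq> 0" using pos by (simp add: kappa_P)
  \<comment> \<open>The derivatives of \<open>D\<close> cancel in the acceleration, so their
    existence suffices and no formula for \<open>Dt\<close> and \<open>Dr\<close> is worked
    out.\<close>
  have "(\<lambda>t. D t r) differentiable (at t)"
    unfolding D_def \<kappa>_def
    using \<kappa> pos a_pos[of t] a_differentiable[OF pos(1)]
    by (intro differentiable_divide differentiable_add differentiable_diff differentiable_power
        differentiable_const differentiable_ident) (auto simp: \<kappa>_def)
  then obtain Dt where Dt: "((\<lambda>t. D t r) has_real_derivative Dt) (at t)"
    by (auto simp: real_differentiable_def)
  have "(\<lambda>r. D t r) differentiable (at r)"
    unfolding D_def \<kappa>_def
    using \<kappa> pos a_pos[of t]
    by (intro differentiable_divide differentiable_add differentiable_diff differentiable_power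
        differentiable_const differentiable_ident) (auto simp: \<kappa>_def)
  then obtain Dr where Dr: "((\<lambda>r. D t r) has_real_derivative Dr) (at r)"
    by (auto simp: real_differentiable_def)
  let ?g = "mcvittie_metric M a"
  have g_eq: "region (y $ 1) (y $ 2) \<Longrightarrow> ?g y $ 1 $ 1 = D (y $ 1) (y $ 2) * (F (y $ 1) (y $ 2))\<^sup>2 - 2 * K (y $ 1) (y $ 2) * F (y $ 1) (y $ 2)"
    "region (y $ 1) (y $ 2) \<Longrightarrow> ?g y $ 1 $ 2 = K (y $ 1) (y $ 2) - D (y $ 1) (y $ 2) * F (y $ 1) (y $ 2)"
    "region (y $ 1) (y $ 2) \<Longrightarrow> ?g y $ 2 $ 1 = K (y $ 1) (y $ 2) - D (y $ 1) (y $ 2) * F (y $ 1) (y $ 2)"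
    "region (y $ 1) (y $ 2) \<Longrightarrow> ?g y $ 2 $ 2 = D (y $ 1) (y $ 2)" for y
    by (simp_all add: metric_null_block null_block_def D_def)
  have dt: "((\<lambda>h. t + h) has_real_derivative 1) (at 0)" "((\<lambda>h. r) has_real_derivative 0) (at 0)"
    and dr: "((\<lambda>h. r + h) has_real_derivative 1) (at 0)" "((\<lambda>h. t) has_real_derivative 0) (at 0)"
    by (auto intro!: derivative_eq_intros)
  have Dh: "((\<lambda>h. D (t + h) r) has_real_derivative Dt) (at 0)"
    "((\<lambda>h. D t (r + h)) has_real_derivative Dr) (at 0)"
    using DERIV_chain2[of "\<lambda>t. D t r" Dt "\<lambda>h. t + h", OF _ dt(1)] Dt
      DERIV_chain2[of "\<lambda>r. D t r" Dr "\<lambda>h. r + h", OF _ dr(1)] Dr by auto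
  have Kh: "((\<lambda>h. K (t + h) r) has_real_derivative Kt t r) (at 0)"
    "((\<lambda>h. K t (r + h)) has_real_derivative Kr t r) (at 0)"
    using K_DERIV[OF dt] K_DERIV[OF dr(2,1)] reg by auto
  have Fh: "((\<lambda>h. F (t + h) r) has_real_derivative Ft t r) (at 0)"
    "((\<lambda>h. F t (r + h)) has_real_derivative Fr t r) (at 0)"
    using F_DERIV[OF dt] F_DERIV[OF dr(2,1)] reg by auto
  have trans_t: "partial_deriv 1 (\<lambda>y. ?g y $ i $ j) x = d"
    if "\<And>y. region (y $ 1) (y $ 2) \<Longrightarrow> ?g y $ i $ j = G (y $ 1) (y $ 2)"
      "((\<lambda>h. G (t + h) r) has_real_derivative d) (at 0)" for i j G d
  proof (intro partial_deriv_eqI region_curve_DERIV[where f = "\<lambda>h. t + h" and g = "\<lambda>_. r", OF _ _ _ _ that(2)])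
    show "?g (x + h *\<^sub>R axis 1 1) $ i $ j = G (t + h) r" if "region (t + h) r" for h
      using \<open>\<And>y. region (y $ 1) (y $ 2) \<Longrightarrow> ?g y $ i $ j = G (y $ 1) (y $ 2)\<close>[of "x + h *\<^sub>R axis 1 1"] that
      by (simp add: axis_def t_def r_def)
  qed (use reg in \<open>auto intro!: continuous_intros\<close>)
  have trans_r: "partial_deriv 2 (\<lambda>y. ?g y $ i $ j) x = d"
    if "\<And>y. region (y $ 1) (y $ 2) \<Longrightarrow> ?g y $ i $ j = G (y $ 1) (y $ 2)"
      "((\<lambda>h. G t (r + h)) has_real_derivative d) (at 0)" for i j G d
  proof (intro partial_deriv_eqI region_curve_DERIV[where f = "\<lambda>_. t" and g = "\<lambda>h. r + h", OF _ _ _ _ that(2)])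
    show "?g (x + h *\<^sub>R axis 2 1) $ i $ j = G t (r + h)" if "region t (r + h)" for h
      using \<open>\<And>y. region (y $ 1) (y $ 2) \<Longrightarrow> ?g y $ i $ j = G (y $ 1) (y $ 2)\<close>[of "x + h *\<^sub>R axis 2 1"] that
      by (simp add: axis_def t_def r_def)
  qed (use reg in \<open>auto intro!: continuous_intros\<close>)
  have block: "partial_deriv i (\<lambda>y. ?g y $ j $ l) x = 0" if "l \<in> {3, 4}" "j \<in> {1, 2}" for i j l
    by (rule partial_deriv_eqI) (use that in \<open>auto simp: mcvittie_metric_def Let_def\<close>)
  have fibre: "partial_deriv l (\<lambda>y. ?g y $ i $ j) x = 0" if "l \<in> {3, 4}" "j \<in> {1, 2}" "i \<in> {1, 2}" for i j l
    by (rule partial_deriv_eqI) (use that in \<open>auto simp: mcvittie_metric_def Let_def axis_def\<close>)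
  note dA_t = DERIV_diff[OF DERIV_mult[OF Dh(1) DERIV_power[OF Fh(1), of 2]] DERIV_mult[OF DERIV_cmult[OF Kh(1), of 2] Fh(1)]]
  note dA_r = DERIV_diff[OF DERIV_mult[OF Dh(2) DERIV_power[OF Fh(2), of 2]] DERIV_mult[OF DERIV_cmult[OF Kh(2), of 2] Fh(2)]]
  note dB_t = DERIV_diff[OF Kh(1) DERIV_mult[OF Dh(1) Fh(1)]]
  note dB_r = DERIV_diff[OF Kh(2) DERIV_mult[OF Dh(2) Fh(2)]]
  have [simp]: "x $ 1 = t" "x $ 2 = r" by (simp_all add: t_def r_def)
  show ?thesis
    unfolding q_def
    apply (simp only: \<open>x $ 1 = t\<close> \<open>x $ 2 = r\<close>)
    apply (rule null_geodesic_acceleration[where D = "D t r" and Dt = Dt and Dr = Dr and c = "r\<^sup>2" and d = "r\<^sup>2 * (sin (x $ 3))\<^sup>2"])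
    subgoal using metric_null_block[of x] reg by (simp add: D_def)
    subgoal using K_pos[OF reg] by simp
    subgoal using pos by simp
    subgoal using pos \<open>sin (x $ 3) > 0\<close> by simp
    subgoal by (rule block)
    subgoal by (rule fibre)
    subgoal by (rule trans_t[OF g_eq(1) DERIV_cong[OF dA_t]]) (simp_all add: algebra_simps)
    subgoal by (rule trans_t[OF g_eq(2) DERIV_cong[OF dB_t]]) (simp_all add: algebra_simps)
    subgoal by (rule trans_t[OF g_eq(3) DERIV_cong[OF dB_t]]) (simp_all add: algebra_simps)
    subgoal by (rule trans_t[OF g_eq(4) Dh(1)])
    subgoal by (rule trans_r[OF g_eq(1) DERIV_cong[OF dA_r]]) (simp_all add: algebra_simps)
    subgoal by (rule trans_r[OF g_eq(2) DERIV_cong[OF dB_r]]) (simp_all add: algebra_simps)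
    subgoal by (rule trans_r[OF g_eq(3) DERIV_cong[OF dB_r]]) (simp_all add: algebra_simps)
    subgoal by (rule trans_r[OF g_eq(4) Dh(2)])
    subgoal using v by simp
    subgoal using v by simp
    subgoal using v by simp
    subgoal using v by simp
    done
qed

section \<open>The ray equation as a scalar differential equation\<close>

lemma ode_continuous:
  "continuous_on {(t, x). t > 0 \<and> adm (b t) x} (\<lambda>(t, x). Q t x)"
  "continuous_on {(t, x). t > 0 \<and> adm (b t) x} (\<lambda>(t, x). Qx t x)"
proof -
  let ?D = "{p. fst p > 0 \<and> adm (b (fst p)) (snd p)}"
  have D: "{(t, x). t > 0 \<and> adm (b t) x} = ?D" by auto
  have c [continuous_intros]: "continuous_on ?D (\<lambda>p. b (fst p))" "continuous_on ?D (\<lambda>p. H (fst p))"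
    by (auto intro!: continuous_on_compose2[OF continuous_on_b] continuous_on_compose2[OF continuous_on_H]
        continuous_intros)
  have P: "p \<in> ?D \<Longrightarrow> P (b (fst p)) (snd p) > 0" for p by (auto simp: adm_def)
  show "continuous_on {(t, x). t > 0 \<and> adm (b t) x} (\<lambda>(t, x). Q t x)"
    unfolding Q_def D unfolding split_beta by (intro continuous_intros) auto
  show "continuous_on {(t, x). t > 0 \<and> adm (b t) x} (\<lambda>(t, x). Qx t x)"
    unfolding Qx_def Pw_def D unfolding split_beta using P by (intro continuous_intros) (auto, force+)
qed

sublocale ray: scalar_ode "{(t, x). t > 0 \<and> adm (b t) x}" "\<lambda>t x. - Q t x" "\<lambda>t x. - Qx t x"
proof
  have "open (({0<..} \<times> {0<..}) \<inter> (\<lambda>p. P (b (fst p)) (snd p)) -` {0<..})"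
    by (intro continuous_open_preimage continuous_intros continuous_on_compose2[OF continuous_on_b])
      (auto intro: open_Times)
  moreover have "{(t, x). t > 0 \<and> adm (b t) x} = ({0<..} \<times> {0<..}) \<inter> (\<lambda>p. P (b (fst p)) (snd p)) -` {0<..}"
  proof (rule set_eqI)
    show "p \<in> {(t, x). t > 0 \<and> adm (b t) x} \<longleftrightarrow>
        p \<in> ({0<..} \<times> {0<..}) \<inter> (\<lambda>p. P (b (fst p)) (snd p)) -` {0<..}" for p
      using b_pos[of "fst p"] by (cases p) (simp add: adm_def, blast)
  qed
  ultimately show "open {(t, x). t > 0 \<and> adm (b t) x}" by simp
  show "continuous_on {(t, x). t > 0 \<and> adm (b t) x} (\<lambda>(t, x). - Q t x)"
    "continuous_on {(t, x). t > 0 \<and> adm (b t) x} (\<lambda>(t, x). - Qx t x)"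
    using ode_continuous[THEN continuous_on_minus] by (simp_all only: case_prod_beta')
next
  fix t x assume "(t, x) \<in> {(t, x). t > 0 \<and> adm (b t) x}"
  then show "((\<lambda>x. - Q t x) has_real_derivative - Qx t x) (at x)"
    by (intro DERIV_minus DERIV_cong[OF Q_DERIV[of "\<lambda>_. t" 0 x "\<lambda>x. x" 1]]) auto
next
  fix t x y z assume "(t, x) \<in> {(t, x). t > 0 \<and> adm (b t) x}" "(t, y) \<in> {(t, x). t > 0 \<and> adm (b t) x}"
    "x \<le> z" "z \<le> y"
  moreover from this have "P (b t) z > 0" by (intro P_pos[of "b t" y z]) (auto simp: adm_def)
  ultimately show "(t, z) \<in> {(t, x). t > 0 \<and> adm (b t) x}" by (auto simp: adm_def)
qed

end

section \<open>Asymptotics of outgoing rays\<close>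

context expanding
begin

lemma Q_pos: "t > 0 \<Longrightarrow> adm (b t) x \<Longrightarrow> Q t x > 0"
  using b_pos[of t] hubble_pos[of t] I3_pos[of "b t" x]
  by (auto simp: Q_def adm_def intro!: mult_pos_pos add_pos_pos)

lemma Q_lower:
  assumes "t > 0" "adm (b t) x"
  shows "b t * x * (H t + sqrt (P (b t) x)) \<le> Q t x * (b t + M * x ^ 3)"
proof -
  have "0 \<le> b t * (H t + sqrt (P (b t) x))"
    using assms b_pos[of t] hubble_pos[of t] by (simp add: adm_def)
  from mult_left_mono[OF I3_lower[OF assms(2)] this]
  show ?thesis by (simp add: Q_def mult_ac)
qed

lemma Q_lower':
  assumes "t > 0" "adm (b t) x"
  shows "sqrt (P (b t) x) * x * (H t + sqrt (P (b t) x)) \<le> Q t x * sqrt (b t + x\<^sup>2)"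
proof -
  have "0 \<le> sqrt (P (b t) x) * (H t + sqrt (P (b t) x))"
    using assms hubble_pos[of t] by (simp add: adm_def)
  from mult_left_mono[OF I3_lower'[OF assms(2)] this]
  show ?thesis by (simp add: Q_def mult_ac)
qed

lemma Q_upper:
  assumes "t > 0" "adm (b t) x" "0 < m" "m \<le> b t" "m \<le> P (b t) x"
  shows "Q t x \<le> b t * sqrt (P (b t) x) * (H t + sqrt (P (b t) x)) / sqrt m ^ 3 * x"
proof -
  have "0 \<le> b t * sqrt (P (b t) x) * (H t + sqrt (P (b t) x))"
    using assms b_pos[of t] hubble_pos[of t] by (simp add: adm_def)
  from mult_left_mono[OF I3_upper[OF assms(2-5)] this]
  show ?thesis by (simp add: Q_def mult_ac)
qed

lemma b_antimono:
  assumes "0 < s" "s \<le> t" shows "b t \<le> b s"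
proof (rule DERIV_nonpos_imp_nonincreasing[OF assms(2)])
  fix u assume "s \<le> u" "u \<le> t"
  then have "u > 0" using assms by simp
  then show "\<exists>y. (b has_real_derivative y) (at u) \<and> y \<le> 0"
    using b_DERIV b_pos[of u] hubble_pos[of u] by (intro exI[of _ "- 2 * H u * b u"]) auto
qed

text \<open>
  Along a ray, \<open>K t (1 / x) = b t * I3 (b t) x\<close> has logarithmic derivative \<open>- 2 H + 3 H b I5 / I3 - Q / (s\<^sup>3 I3)\<close>,
  where \<open>s = sqrt P\<close>, so this bounds the logarithmic derivative of the affine speed from below.
\<close>

lemma affine_rate_lower:
  assumes "t > 0" "adm (b t) x" "4 * M * x \<le> 1"
  shows "- 6 * M * H t * x * (b t * I3 (b t) x) \<le>
    b t * (- 2 * H t * I3 (b t) x + 3 * H t * b t * I5 (b t) x - Q t x / sqrt (P (b t) x) ^ 3)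
      + b t * I3 (b t) x * (2 * Q t x / x - Qx t x)"
proof -
  define \<beta> h s I where "\<beta> = b t" and "h = H t" and "s = sqrt (P (b t) x)" and "I = I3 (b t) x"
  have h: "h > 0" and \<beta>: "\<beta> > 0" using assms hubble_pos b_pos by (auto simp: h_def \<beta>_def)
  have x: "x > 0" using assms by (simp add: adm_def)
  have s: "s > 0" "P \<beta> x = s\<^sup>2" using assms by (auto simp: adm_def s_def \<beta>_def)
  have I: "I > 0" using I3_pos assms by (simp add: I_def)
  have Il: "x \<le> I * s * (\<beta> + M * x ^ 3)" using I3_lower assms by (simp add: I_def s_def \<beta>_def)
  have "(4 * M * x) * x\<^sup>2 \<le> 1 * x\<^sup>2" using assms by (intro mult_right_mono) auto
  then have x3: "4 * (M * x ^ 3) \<le> x\<^sup>2" by (simp add: power2_eq_square power3_eq_cube)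
  have s2: "s\<^sup>2 = \<beta> + x\<^sup>2 - 2 * M * x ^ 3" using s by (simp add: P_def)
  have xPw: "x * Pw x = 2 * x\<^sup>2 - 6 * (M * x ^ 3)"
    by (simp add: Pw_def power2_eq_square power3_eq_cube algebra_simps)
  \<comment> \<open>\<open>hp\<close> and \<open>sp\<close> concern the coefficients of
    \<open>h\<close> and of \<open>s\<close> in the inequality labelled \<open>1\<close>, multiplied
    by \<open>x * s\<^sup>2 / \<beta>\<close>. The second is \<open>I3_lower\<close> itself, because
    \<open>2 * s\<^sup>2 - x * Pw x = 2 * (\<beta> + M * x ^ 3)\<close>; the first uses
    \<open>4 * M * x \<le> 1\<close>.\<close>
  have hp: "2 * x \<le> I * s * (2 * s\<^sup>2 - x * Pw x / 2)"
  proof -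
    have "0 \<le> M * x ^ 3" using M_pos x by simp
    moreover have "2 * (\<beta> + c) \<le> 2 * (\<beta> + d - 2 * c) - (2 * d - 6 * c) / 2"
      if "0 \<le> c" "4 * c \<le> d" for c d :: real
      using that by (simp add: field_simps)
    ultimately have "2 * (\<beta> + M * x ^ 3) \<le> 2 * s\<^sup>2 - x * Pw x / 2"
      using x3 unfolding s2 xPw by (simp add: mult.assoc)
    then have "I * s * (2 * (\<beta> + M * x ^ 3)) \<le> I * s * (2 * s\<^sup>2 - x * Pw x / 2)"
      using I s(1) by (intro mult_left_mono) auto
    then show ?thesis using Il by (simp add: algebra_simps)
  qed
  have sp: "2 * x \<le> I * s * (2 * s\<^sup>2 - x * Pw x)"
    using Il unfolding s2 xPw by (simp add: algebra_simps)
  have "2 * x * (h + s) \<le> I * s * (2 * s\<^sup>2 - x * Pw x / 2) * h + I * s * (2 * s\<^sup>2 - x * Pw x) * s"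
    using mult_right_mono[OF hp, of h] mult_right_mono[OF sp, of s] h s(1) by (simp add: algebra_simps)
  then have "0 \<le> (I * s * (2 * s\<^sup>2 - x * Pw x / 2) * h + I * s * (2 * s\<^sup>2 - x * Pw x) * s
      - 2 * x * (h + s)) * (\<beta> / (x * s\<^sup>2))"
    using x s(1) \<beta> by (intro mult_nonneg_nonneg) auto
  also have "\<dots> = 2 * (\<beta> * s * I * (h + s)) / x
      - \<beta> * (Pw x * I * (h / s + 2) / 2 + (h + s) / s\<^sup>2) - \<beta> * (h + s) / s\<^sup>2"
    using x s(1) by (simp add: field_simps power2_eq_square)
  finally have 1: "\<beta> * (h + s) / s\<^sup>2 \<le> 2 * Q t x / x - Qx t x"
    using s(2) by (simp add: Q_def Qx_def \<beta>_def h_def s_def I_def)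
  have Q: "Q t x = \<beta> * s * I * (h + s)" by (simp add: Q_def \<beta>_def h_def s_def I_def)
  \<comment> \<open>The loss \<open>Q t x / s ^ 3\<close>, due to the shrinking upper limit of
    \<open>I3\<close>, is compensated completely by \<open>1\<close>; only the deficit of
    \<open>I5_lower\<close> is left.\<close>
  have "I * (\<beta> * (h + s) / s\<^sup>2) \<le> I * (2 * Q t x / x - Qx t x)"
    using I by (intro mult_left_mono 1) auto
  moreover have "I * (\<beta> * (h + s) / s\<^sup>2) = Q t x / s ^ 3"
    unfolding Q using s(1) by (simp add: field_simps power2_eq_square power3_eq_cube)
  moreover have "h * ((2 - 6 * M * x) * I) \<le> h * (3 * \<beta> * I5 \<beta> x)"
    using I5_lower[of \<beta> x] assms h by (intro mult_left_mono) (auto simp: I_def \<beta>_def)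
  ultimately have "- 6 * M * h * x * I \<le> (- 2 * h * I + 3 * h * \<beta> * I5 \<beta> x - Q t x / s ^ 3)
      + I * (2 * Q t x / x - Qx t x)"
    by (simp add: algebra_simps)
  from mult_left_mono[OF this, of \<beta>] \<beta>
  have "- 6 * M * h * x * (\<beta> * I) \<le> \<beta> * (- 2 * h * I + 3 * h * \<beta> * I5 \<beta> x - Q t x / s ^ 3)
      + \<beta> * I * (2 * Q t x / x - Qx t x)"
    by (simp add: algebra_simps)
  then show ?thesis unfolding \<beta>_def h_def s_def I_def .
qed

text \<open>Converts the rate \<open>H t * x\<close> of \<open>affine_rate_lower\<close> into
  \<open>Q\<close>, the speed at which \<open>x\<close> itself decreases, so that the accumulated
  loss is controlled by the total decrease of \<open>x\<close>, which is finite. For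
  \<open>4 * M * x \<le> 1\<close> one has \<open>b t + x\<^sup>2 \<le> 4 * P (b t) x\<close>, which
  makes \<open>Q_lower'\<close> strong enough.\<close>

lemma Q_lower_small:
  assumes "t > 0" "adm (b t) x" "4 * M * x \<le> 1"
  shows "H t * x / 2 \<le> Q t x"
proof -
  define s where "s = sqrt (P (b t) x)"
  have x: "x > 0" "b t > 0" using assms by (auto simp: adm_def)
  have s: "s > 0" using assms by (simp add: s_def adm_def)
  have h: "H t > 0" using assms hubble_pos by simp
  have "(4 * M * x) * x\<^sup>2 \<le> 1 * x\<^sup>2" using assms by (intro mult_right_mono) auto
  then have "4 * (M * x ^ 3) \<le> x\<^sup>2" by (simp add: power2_eq_square power3_eq_cube)
  then have "b t + x\<^sup>2 \<le> 4 * (b t + x\<^sup>2 - 2 * (M * x ^ 3))"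
    using x zero_le_power2[of x] by (smt (verit))
  then have "b t + x\<^sup>2 \<le> 4 * P (b t) x"
    by (simp add: P_def mult.assoc)
  then have "sqrt (b t + x\<^sup>2) \<le> sqrt (4 * P (b t) x)" by simp
  then have r: "sqrt (b t + x\<^sup>2) \<le> 2 * s" by (simp add: real_sqrt_mult s_def)
  have "s * x * H t \<le> s * x * (H t + s)" using s x by (intro mult_left_mono) auto
  also have "\<dots> \<le> Q t x * sqrt (b t + x\<^sup>2)" using Q_lower'[OF assms(1,2)] by (simp add: s_def)
  also have "\<dots> \<le> Q t x * (2 * s)"
    using Q_pos[OF assms(1,2)] by (intro mult_left_mono r) auto
  finally have "s * (x * H t) \<le> s * (2 * Q t x)" by (simp add: mult_ac)
  then show ?thesis using s by (simp add: mult_ac)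
qed

end

locale ray_solution = expanding +
  fixes J :: "real set" and x :: "real \<Rightarrow> real" and t0 :: real
  assumes sol: "ray.solves J x" and t0: "t0 \<in> J"
    and maximal: "ray.solves J' v \<Longrightarrow> t1 \<in> J' \<Longrightarrow> t1 \<in> J \<Longrightarrow> v t1 = x t1 \<Longrightarrow> t \<in> J' \<Longrightarrow> t \<in> J \<and> v t = x t"
begin

lemma J_pos: "t \<in> J \<Longrightarrow> t > 0"
  and adm_x: "t \<in> J \<Longrightarrow> adm (b t) (x t)"
  and x_DERIV: "t \<in> J \<Longrightarrow> (x has_real_derivative - Q t (x t)) (at t)"
  using sol by (auto simp: ray.solves_def)

lemma x_pos: "t \<in> J \<Longrightarrow> x t > 0"
  and P_x_pos: "t \<in> J \<Longrightarrow> P (b t) (x t) > 0"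
  using adm_x by (auto simp: adm_def)

lemma J_between: "s \<in> J \<Longrightarrow> u \<in> J \<Longrightarrow> s \<le> t \<Longrightarrow> t \<le> u \<Longrightarrow> t \<in> J"
  using sol mem_is_interval_1_I unfolding ray.solves_def by blast

lemma open_J: "open J"
  using sol by (simp add: ray.solves_def)

lemma x_antimono:
  assumes "s \<in> J" "t \<in> J" "s \<le> t"
  shows "x t \<le> x s"
proof (rule DERIV_nonpos_imp_nonincreasing[OF assms(3)])
  fix u assume "s \<le> u" "u \<le> t"
  then have u: "u \<in> J" using J_between assms by blast
  then show "\<exists>y. (x has_real_derivative y) (at u) \<and> y \<le> 0"
    using x_DERIV Q_pos[OF J_pos adm_x] by (intro exI[of _ "- Q u (x u)"]) (auto intro: less_imp_le)
qed

section \<open>Distance of the ray from the boundary of the region\<close>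

definition q :: "real \<Rightarrow> real" where "q t = P (b t) (x t) / b t"

lemma q_DERIV:
  assumes "t \<in> J"
  shows "(q has_real_derivative 2 * H t * (q t - 1) - Pw (x t) * Q t (x t) / b t) (at t)"
proof -
  have b: "b t > 0" using assms J_pos b_pos by simp
  note db = b_DERIV[OF J_pos[OF assms]]
  note d = DERIV_divide[OF P_DERIV[OF db x_DERIV[OF assms]] db]
  show ?thesis
    unfolding q_def
    by (rule DERIV_cong[OF d]) (use b in \<open>simp_all add: field_simps power2_eq_square\<close>)
qed

text \<open>Here \<open>q \<le> 1\<close>, so the expansion term pushes \<open>q\<close> down, while
  the decrease of \<open>x\<close> pushes it up because \<open>Pw \<le> 0\<close>. With the bound of
  \<open>Q\<close> that comes from \<open>I3_lower\<close> the second effect wins.\<close>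

lemma q_increasing_far_in:
  assumes t: "t \<in> J" and far: "2 * M * x t \<ge> 1"
  shows "2 * H t * (q t - 1) - Pw (x t) * Q t (x t) / b t \<ge> 0"
proof -
  define y \<beta> h where "y = x t" and "\<beta> = b t" and "h = H t"
  have pos: "\<beta> > 0" "h > 0" "y > 0" "P \<beta> y > 0"
    using t J_pos b_pos hubble_pos x_pos P_x_pos by (auto simp: y_def \<beta>_def h_def)
  define d where "d = \<beta> + M * y ^ 3"
  have d: "d > 0" using pos M_pos by (auto simp: d_def intro: add_pos_pos)
  have Pw: "- Pw y \<ge> 0"
  proof -
    have "y * 1 \<le> y * (2 * M * y)" using far pos by (intro mult_left_mono) (auto simp: y_def)
    then show ?thesis using pos by (simp add: Pw_def power2_eq_square algebra_simps)
  qed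
  have "\<beta> * y * h \<le> \<beta> * y * (h + sqrt (P \<beta> y))" using pos by (intro mult_left_mono) auto
  also have "\<dots> \<le> Q t y * d"
    using Q_lower[OF J_pos[OF t] adm_x[OF t]] by (simp add: y_def \<beta>_def h_def d_def)
  finally have "- Pw y * (\<beta> * y * h) \<le> - Pw y * (Q t y * d)" using Pw by (rule mult_left_mono)
  moreover have "0 \<le> 2 * h * M * y ^ 3 * P \<beta> y" using pos M_pos by simp
  \<comment> \<open>With \<open>Q\<close> replaced by its bound and after multiplication by
    \<open>d\<close>, the surplus of the second effect is exactly
    \<open>2 * h * M * y ^ 3 * P \<beta> y\<close>.\<close>
  moreover have "2 * h * M * y ^ 3 * P \<beta> y = 2 * h * (P \<beta> y - \<beta>) * d + - Pw y * (\<beta> * y * h)"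
    by (simp add: P_def Pw_def d_def power2_eq_square power3_eq_cube algebra_simps)
  ultimately have "0 \<le> (2 * h * (P \<beta> y - \<beta>) - Pw y * Q t y) * d" by (simp add: algebra_simps)
  then have "0 \<le> 2 * h * (P \<beta> y - \<beta>) - Pw y * Q t y" using d by (simp add: zero_le_mult_iff)
  then have "0 \<le> (2 * h * (P \<beta> y - \<beta>) - Pw y * Q t y) / \<beta>" using pos by simp
  also have "\<dots> = 2 * h * (P \<beta> y / \<beta> - 1) - Pw y * Q t y / \<beta>"
    using pos by (simp add: field_simps)
  finally show ?thesis by (simp add: q_def y_def \<beta>_def h_def)
qed

definition c0 :: real where "c0 = min 1 (q t0)"

lemma c0: "0 < c0" "c0 \<le> 1"
  using P_x_pos[OF t0] b_pos[OF J_pos[OF t0]] by (auto simp: c0_def q_def)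

lemma P_lower:
  assumes t: "t \<in> J" "t0 \<le> t"
  shows "c0 * b t \<le> P (b t) (x t)"
proof -
  have b: "b t > 0" using t J_pos b_pos by simp
  have "c0 \<le> q t"
  proof (cases "2 * M * x t \<ge> 1")
    case True
    \<comment> \<open>As \<open>x\<close> decreases, \<open>2 * M * x \<ge> 1\<close> at
      \<open>t\<close> implies the same at every earlier time from \<open>t0\<close> on, so
      \<open>q\<close> has been nondecreasing throughout.\<close>
    have "q t0 \<le> q t"
    proof (rule DERIV_nonneg_imp_nondecreasing[OF t(2)])
      fix u assume u: "t0 \<le> u" "u \<le> t"
      then have uJ: "u \<in> J" using J_between t0 t by blast
      have "2 * M * x t \<le> 2 * M * x u" using x_antimono[OF uJ t(1)] u M_pos by simp
      then have "2 * M * x u \<ge> 1" using True by simp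
      then show "\<exists>y. (q has_real_derivative y) (at u) \<and> 0 \<le> y"
        using q_DERIV[OF uJ] q_increasing_far_in[OF uJ] by blast
    qed
    then show ?thesis by (simp add: c0_def)
  next
    case False
    then have "(2 * M * x t) * (x t)\<^sup>2 \<le> 1 * (x t)\<^sup>2" by (intro mult_right_mono) auto
    then have "P (b t) (x t) \<ge> b t" by (simp add: P_def power2_eq_square power3_eq_cube mult_ac)
    then have "q t \<ge> 1" using b by (simp add: q_def)
    then show ?thesis using c0 by simp
  qed
  then show ?thesis using b by (simp add: q_def field_simps)
qed

text \<open>If \<open>J\<close> ended at a finite \<open>T\<close>, the decreasing \<open>x\<close>
  would have a limit \<open>X\<close> there. \<open>P_lower\<close> gives
  \<open>P (b T) X > 0\<close>, and \<open>Q \<le> L * x\<close> keeps \<open>X\<close> positive, so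
  the ray does not escape to infinite \<open>r\<close> before \<open>T\<close>. Then
  \<open>(T, X)\<close> lies in the domain of the equation and the solution continues, against
  maximality.\<close>

lemma J_unbounded:
  assumes "t0 \<le> t" shows "t \<in> J"
proof (rule ccontr)
  assume "t \<notin> J"
  then have ub: "s \<le> t" if "s \<in> J" for s using J_between[OF t0 that assms] by (meson nle_le)
  define T where "T = Sup J"
  have bdd: "bdd_above J" unfolding bdd_above_def using ub by blast
  have le_T: "s \<le> T" if "s \<in> J" for s unfolding T_def by (rule cSup_upper[OF that bdd])
  have in_J: "s \<in> J" if "t0 \<le> s" "s < T" for s
  proof -
    obtain u where "u \<in> J" "s < u"
      using \<open>s < T\<close> less_cSup_iff[of J s] t0 bdd unfolding T_def by auto
    then show ?thesis using J_between[OF t0 _ \<open>t0 \<le> s\<close>] by simp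
  qed
  have t0_T: "t0 < T"
  proof -
    obtain e where "e > 0" "cball t0 e \<subseteq> J" using open_J t0 open_contains_cball by metis
    then have "t0 + e \<in> J" by (auto simp: cball_eq_atLeastAtMost)
    then show ?thesis using le_T[of "t0 + e"] \<open>e > 0\<close> by simp
  qed
  have t0_pos: "t0 > 0" using J_pos t0 by simp
  have T_pos: "T > 0" using t0_pos t0_T by simp
  have "compact (H ` {t0..T})"
    using t0_pos by (intro compact_continuous_image continuous_on_subset[OF continuous_on_H]) auto
  then obtain h where h: "\<And>s. s \<in> {t0..T} \<Longrightarrow> H s \<le> h"
    using bounded_real compact_imp_bounded by (metis abs_le_D1 image_eqI)
  \<comment> \<open>\<open>m\<close> bounds \<open>b\<close> and \<open>P\<close> from below on
    \<open>[t0, T)\<close>, and \<open>S\<close> bounds \<open>sqrt P\<close> from above; inserted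
    in \<open>Q_upper\<close> they give the constant \<open>L\<close>.\<close>
  define m S where "m = c0 * b T" and "S = sqrt (b t0 + (x t0)\<^sup>2)"
  have m: "m > 0" using c0 b_pos T_pos by (simp add: m_def)
  have S: "S \<ge> 0" using b_pos[OF t0_pos] by (simp add: S_def)
  have h_pos: "h > 0" using h[of t0] t0_T hubble_pos[OF t0_pos] by simp
  define L where "L = b t0 * S * (h + S) / sqrt m ^ 3"
  have L: "Q s (x s) \<le> L * x s" if s: "t0 \<le> s" "s < T" for s
  proof -
    note sJ = in_J[OF s]
    have spos: "s > 0" using J_pos sJ by simp
    have "b T \<le> b s" "b s \<le> b t0" using b_antimono s t0_pos spos by auto
    then have "m \<le> c0 * b s" using c0 by (simp add: m_def)
    moreover have "c0 * b s \<le> b s" using c0 b_pos[OF spos] by simp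
    ultimately have 1: "m \<le> b s" "m \<le> P (b s) (x s)" using P_lower[OF sJ s(1)] by auto
    have "(x s)\<^sup>2 \<le> (x t0)\<^sup>2" using x_antimono[OF t0 sJ s(1)] x_pos[OF sJ] by (intro power_mono) auto
    then have "P (b s) (x s) \<le> b t0 + (x t0)\<^sup>2"
      using P_le[of "x s" "b s"] x_pos[OF sJ] \<open>b s \<le> b t0\<close> by linarith
    then have 2: "sqrt (P (b s) (x s)) \<le> S" by (simp add: S_def)
    have "Q s (x s) \<le> b s * sqrt (P (b s) (x s)) * (H s + sqrt (P (b s) (x s))) / sqrt m ^ 3 * x s"
      by (intro Q_upper spos adm_x sJ m 1)
    also have "\<dots> \<le> L * x s"
      unfolding L_def
      using 2 \<open>b s \<le> b t0\<close> h[of s] s S m x_pos[OF sJ] b_pos[OF spos] b_pos[OF t0_pos] P_x_pos[OF sJ] hubble_pos[OF spos]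
      by (intro mult_right_mono divide_right_mono mult_mono add_mono mult_nonneg_nonneg add_nonneg_nonneg) auto
    finally show ?thesis .
  qed
  define l where "l = x t0 * exp (- L * (T - t0))"
  have L_nonneg: "L \<ge> 0" using S h_pos m b_pos[OF t0_pos] by (simp add: L_def)
  have l: "l > 0" using x_pos[OF t0] by (simp add: l_def)
  have x_lower: "l \<le> x s" if s: "t0 \<le> s" "s < T" for s
  proof -
    have "x t0 * exp (L * (t0 - t0)) \<le> x s * exp (L * (s - t0))"
    proof (rule DERIV_nonneg_imp_nondecreasing[OF s(1)])
      fix u assume u: "t0 \<le> u" "u \<le> s"
      then have uT: "u < T" using s by simp
      have "((\<lambda>u. x u * exp (L * (u - t0))) has_real_derivative
          (L * x u - Q u (x u)) * exp (L * (u - t0))) (at u)"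
        by (auto intro!: derivative_eq_intros x_DERIV in_J u uT simp: algebra_simps)
      moreover have "0 \<le> (L * x u - Q u (x u)) * exp (L * (u - t0))" using L[OF u(1) uT] by simp
      ultimately show "\<exists>y. ((\<lambda>u. x u * exp (L * (u - t0))) has_real_derivative y) (at u) \<and> 0 \<le> y" by blast
    qed
    from mult_right_mono[OF this, of "exp (- L * (s - t0))"]
    have "x t0 * exp (- L * (s - t0)) \<le> x s" by (simp add: mult.assoc exp_add[symmetric])
    moreover have "L * (s - t0) \<le> L * (T - t0)" using s L_nonneg by (intro mult_left_mono) auto
    then have "l \<le> x t0 * exp (- L * (s - t0))" unfolding l_def using x_pos[OF t0] by simp
    ultimately show ?thesis by simp
  qed
  define \<tau> where "\<tau> n = T - (T - t0) / real (Suc n)" for n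
  have \<tau>: "t0 \<le> \<tau> n" "\<tau> n < T" for n
  proof -
    have "(T - t0) / real (Suc n) \<le> (T - t0) / 1" using t0_T by (intro divide_left_mono) auto
    then show "t0 \<le> \<tau> n" "\<tau> n < T" using t0_T by (auto simp: \<tau>_def)
  qed
  have "(\<lambda>n. (T - t0) / real (Suc n)) \<longlonglongrightarrow> 0" by (rule LIMSEQ_Suc[OF lim_const_over_n])
  then have \<tau>_lim: "\<tau> \<longlonglongrightarrow> T" unfolding \<tau>_def using tendsto_diff[OF tendsto_const] by fastforce
  have "\<tau> n \<le> \<tau> (Suc n)" for n
    using t0_T by (simp add: \<tau>_def frac_le)
  then have "decseq (\<lambda>n. x (\<tau> n))"
    by (intro decseq_SucI x_antimono in_J \<tau>)
  then obtain X where X: "(\<lambda>n. x (\<tau> n)) \<longlonglongrightarrow> X" "\<And>n. X \<le> x (\<tau> n)"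
    using decseq_convergent[of "\<lambda>n. x (\<tau> n)" l] x_lower \<tau> by metis
  have "l \<le> X" using X x_lower \<tau> by (intro LIMSEQ_le_const[OF X(1)]) auto
  then have X_pos: "X > 0" using l by simp
  have bt: "(\<lambda>n. b (\<tau> n)) \<longlonglongrightarrow> b T"
    using isCont_tendsto_compose[OF DERIV_isCont[OF b_DERIV[OF T_pos]] \<tau>_lim] .
  have Pt: "(\<lambda>n. P (b (\<tau> n)) (x (\<tau> n))) \<longlonglongrightarrow> P (b T) X"
    unfolding P_def by (intro tendsto_intros bt X)
  have "c0 * b T \<le> P (b T) X"
    by (rule LIMSEQ_le[OF tendsto_mult[OF tendsto_const bt] Pt]) (use P_lower in_J \<tau> in auto)
  then have "P (b T) X > 0" using m by (simp add: m_def)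
  then have "(T, X) \<in> {(t, x). t > 0 \<and> adm (b t) x}"
    using T_pos X_pos b_pos by (simp add: adm_def)
  \<comment> \<open>The uniform \<delta> is used here: the solution restarted at
    \<open>\<tau> n\<close> exists up to \<open>T + \<delta>\<close>.\<close>
  from ray.local_solution[OF this] obtain \<delta> where \<delta>: "\<delta> > 0"
    "\<And>t1 x1. \<bar>t1 - T\<bar> < \<delta> \<Longrightarrow> \<bar>x1 - X\<bar> < \<delta> \<Longrightarrow> \<exists>u. ray.solves {T - \<delta><..<T + \<delta>} u \<and> u t1 = x1"
    by blast
  have "\<forall>\<^sub>F n in sequentially. \<bar>\<tau> n - T\<bar> < \<delta> \<and> \<bar>x (\<tau> n) - X\<bar> < \<delta>"
    using tendstoD[OF \<tau>_lim \<delta>(1)] tendstoD[OF X(1) \<delta>(1)] by eventually_elim (simp add: dist_real_def)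
  then obtain n where n: "\<bar>\<tau> n - T\<bar> < \<delta>" "\<bar>x (\<tau> n) - X\<bar> < \<delta>"
    using eventually_happens trivial_limit_sequentially by blast
  then obtain u where u: "ray.solves {T - \<delta><..<T + \<delta>} u" "u (\<tau> n) = x (\<tau> n)" using \<delta>(2) by blast
  have "T + \<delta> / 2 \<in> J"
    using maximal[OF u(1) _ in_J[OF \<tau>] u(2), of "T + \<delta> / 2"] n(1) \<delta>(1)
    by (simp add: abs_less_iff)
  then show False using le_T \<delta>(1) by force
qed

section \<open>Decay of \<open>x\<close> along the ray\<close>

lemma a_large: "\<exists>t\<ge>t1. \<forall>s\<ge>t. a s \<ge> C"
proof -
  have "\<forall>\<^sub>F s in at_top. a s \<ge> C" using a_unbounded by (simp add: filterlim_at_top)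
  then obtain t where "\<And>s. s \<ge> t \<Longrightarrow> a s \<ge> C" by (auto simp: eventually_at_top_linorder)
  then show ?thesis by (intro exI[of _ "max t t1"]) auto
qed

lemma sqrt_bound:
  assumes "t0 \<le> t" shows "sqrt (b t + (x t)\<^sup>2) \<le> sqrt (b t0 + (x t0)\<^sup>2)"
proof -
  have "(x t)\<^sup>2 \<le> (x t0)\<^sup>2"
    using x_antimono[OF t0 J_unbounded assms] assms x_pos[OF J_unbounded[OF assms]] by (intro power_mono) auto
  then show ?thesis using b_antimono[OF J_pos[OF t0] assms] by simp
qed

text \<open>Otherwise \<open>P \<le> \<beta>\<close>, that is \<open>q \<le> 1\<close>, for ever.
  But \<open>Q\<close> is at least of order \<open>H * s\<close> with \<open>s\<close> at least of
  order \<open>1 / a\<close>, and the division by \<open>b = 1 / a\<^sup>2\<close> in the derivative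
  of \<open>q\<close> leaves a growth rate of order \<open>H * a\<close>; so \<open>q\<close> would
  grow at least like \<open>ln a\<close>, which is unbounded.\<close>

lemma x_eventually_near: "\<exists>t\<ge>t0. 2 * M * x t < 1"
proof (rule ccontr)
  assume "\<not> ?thesis"
  then have far: "2 * M * x t \<ge> 1" if "t \<ge> t0" for t using that by (meson not_less)
  define m where "m = sqrt (b t0 + (x t0)\<^sup>2)"
  have m: "m > 0" using b_pos[OF J_pos[OF t0]] by (simp add: m_def add_pos_nonneg)
  \<comment> \<open>\<open>sqrt c0 / a t\<close> is the lower bound of \<open>s\<close>,
    \<open>1 / (4 * M\<^sup>2)\<close> that of \<open>y\<^sup>2\<close>, and \<open>m\<close> the
    upper bound of the square root on the right of \<open>Q_lower'\<close>.\<close>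
  define k where "k = sqrt c0 / (4 * M\<^sup>2 * m)"
  have k: "k > 0" using c0 m M_pos by (simp add: k_def)
  have growth: "H t * (k * a t - 2) \<le> 2 * H t * (q t - 1) - Pw (x t) * Q t (x t) / b t" if t: "t0 \<le> t" for t
  proof -
    note tJ = J_unbounded[OF t]
    define y s where "y = x t" and "s = sqrt (P (b t) (x t))"
    have pos: "b t > 0" "H t > 0" "y > 0" "s > 0" "a t > 0"
      using J_pos[OF tJ] b_pos hubble_pos x_pos[OF tJ] P_x_pos[OF tJ] a_pos by (auto simp: y_def s_def)
    have sb: "sqrt (b t) = 1 / a t" using pos by (simp add: b_def real_sqrt_divide)
    have "sqrt (c0 * b t) \<le> s" using P_lower[OF tJ t] by (simp add: s_def)
    then have s: "sqrt c0 / a t \<le> s" by (simp add: real_sqrt_mult sb)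
    have y: "1 / (2 * M) \<le> y" using far[OF t] M_pos by (simp add: y_def field_simps)
    have "(1 / (2 * M))\<^sup>2 \<le> y\<^sup>2" using y M_pos by (intro power_mono) auto
    then have y2: "1 / (4 * M\<^sup>2) \<le> y\<^sup>2" by (simp add: power_divide power_mult_distrib)
    have "y * 1 \<le> y * (2 * M * y)" using far[OF t] pos by (intro mult_left_mono) (auto simp: y_def)
    then have Pw: "y \<le> - Pw y" by (simp add: Pw_def power2_eq_square algebra_simps)
    have "s * y * H t \<le> s * y * (H t + s)" using pos by (intro mult_left_mono) auto
    also have "\<dots> \<le> Q t y * sqrt (b t + y\<^sup>2)"
      using Q_lower'[OF J_pos[OF tJ] adm_x[OF tJ]] by (simp add: s_def y_def)
    also have "\<dots> \<le> Q t y * m"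
      using Q_pos[OF J_pos[OF tJ] adm_x[OF tJ]] sqrt_bound[OF t] by (intro mult_left_mono) (auto simp: y_def m_def)
    finally have Q: "s * y * H t / m \<le> Q t y" using m by (simp add: field_simps)
    have "(sqrt c0 / a t) * (1 / (4 * M\<^sup>2)) \<le> s * y\<^sup>2"
      using s y2 c0 pos by (intro mult_mono) auto
    from mult_right_mono[OF this, of "a t"] have "k * m \<le> s * y\<^sup>2 * a t"
      using pos m by (simp add: k_def)
    then have "k * m * (a t * H t / m) \<le> s * y\<^sup>2 * a t * (a t * H t / m)"
      using pos m by (intro mult_right_mono) auto
    then have "k * a t * H t \<le> y * (s * y * H t / m) * (a t)\<^sup>2"
      using m by (simp add: field_simps power2_eq_square)
    also have "\<dots> \<le> - Pw y * Q t y * (a t)\<^sup>2"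
      using Pw Q pos m by (intro mult_right_mono mult_mono) auto
    also have "\<dots> = - Pw y * Q t y / b t" by (simp add: b_def)
    finally have "k * a t * H t \<le> - Pw (x t) * Q t (x t) / b t" by (simp add: y_def)
    moreover have "0 \<le> H t * q t" using pos P_x_pos[OF tJ] by (simp add: q_def)
    ultimately show ?thesis by (simp add: algebra_simps)
  qed
  \<comment> \<open>From \<open>t2\<close> on \<open>k * a s - 2 \<ge> 1\<close>, so the derivative
    of \<open>q\<close> is at least \<open>H\<close>, the derivative of \<open>ln a\<close>.\<close>
  obtain t2 where t2: "t2 \<ge> t0" "\<And>s. s \<ge> t2 \<Longrightarrow> a s \<ge> 3 / k" using a_large by blast
  have q_le: "q t \<le> 1" if "t0 \<le> t" for t
  proof -
    note tJ = J_unbounded[OF that]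
    have "1 * (x t)\<^sup>2 \<le> (2 * M * x t) * (x t)\<^sup>2" using far[OF that] by (intro mult_right_mono) auto
    then have "P (b t) (x t) \<le> b t" by (simp add: P_def power2_eq_square power3_eq_cube mult_ac)
    then show ?thesis using b_pos[OF J_pos[OF tJ]] by (simp add: q_def)
  qed
  have mono: "q t2 - ln (a t2) \<le> q t - ln (a t)" if "t2 \<le> t" for t
  proof (rule DERIV_nonneg_imp_nondecreasing[OF that])
    fix u assume u: "t2 \<le> u" "u \<le> t"
    then have u0: "t0 \<le> u" using t2 by simp
    note uJ = J_unbounded[OF u0]
    have pos: "H u > 0" "a u > 0" using J_pos[OF uJ] a_pos hubble_pos by auto
    have "((\<lambda>u. ln (a u)) has_real_derivative 1 / a u * (H u * a u)) (at u)"
      by (rule DERIV_chain2[OF DERIV_ln_divide a_DERIV]) (use pos J_pos[OF uJ] in auto)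
    then have "((\<lambda>u. q u - ln (a u)) has_real_derivative
        (2 * H u * (q u - 1) - Pw (x u) * Q u (x u) / b u) - H u) (at u)"
      using pos by (intro DERIV_diff q_DERIV uJ) simp
    moreover have "3 \<le> k * a u" using t2(2)[OF u(1)] k by (simp add: field_simps)
    then have "H u * 1 \<le> H u * (k * a u - 2)" using pos by (intro mult_left_mono) auto
    then have "0 \<le> (2 * H u * (q u - 1) - Pw (x u) * Q u (x u) / b u) - H u"
      using growth[OF u0] by simp
    ultimately show "\<exists>y. ((\<lambda>u. q u - ln (a u)) has_real_derivative y) (at u) \<and> 0 \<le> y" by blast
  qed
  \<comment> \<open>The exponent is chosen to force \<open>q t \<ge> 2\<close>.\<close>
  obtain t where t: "t \<ge> t2" "\<And>s. s \<ge> t \<Longrightarrow> a s \<ge> exp (2 - q t2 + ln (a t2))" using a_large by blast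
  have "2 - q t2 + ln (a t2) = ln (exp (2 - q t2 + ln (a t2)))" by simp
  also have "\<dots> \<le> ln (a t)" using t(2)[of t] by (subst ln_le_cancel_iff) (auto intro: less_le_trans[OF exp_gt_zero])
  finally show False using mono[OF t(1)] q_le[of t] t t2 by simp
qed

text \<open>After \<open>x_eventually_near\<close> the factor \<open>1 - 2 * M * x\<close> is
  positive. As long as \<open>x \<ge> e\<close>, the part \<open>s * s\<close> of
  \<open>Q_lower'\<close> then gives \<open>x' \<le> - \<delta>\<close> with a constant independent
  of \<open>H\<close>, which may tend to \<open>0\<close>. So \<open>x\<close> would be used up by
  the time \<open>t1 + x t1 / \<delta>\<close>.\<close>

lemma x_eventually_small:
  assumes "e > 0" shows "\<exists>t1\<ge>t0. \<forall>t\<ge>t1. x t < e"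
proof -
  have "\<exists>t1\<ge>t0. x t1 < e"
  proof (rule ccontr)
    assume "\<not> ?thesis"
    then have large: "x t \<ge> e" if "t \<ge> t0" for t using that by (meson not_less)
    obtain t1 where t1: "t1 \<ge> t0" "2 * M * x t1 < 1" using x_eventually_near by blast
    define m \<delta> where "m = sqrt (b t0 + (x t0)\<^sup>2)" and "\<delta> = e\<^sup>2 * (1 - 2 * M * x t1) * e / m"
    have m: "m > 0" using b_pos[OF J_pos[OF t0]] by (simp add: m_def add_pos_nonneg)
    have \<delta>: "\<delta> > 0" using m assms t1 by (simp add: \<delta>_def)
    have Q: "\<delta> \<le> Q t (x t)" if t: "t1 \<le> t" for t
    proof -
      have t': "t0 \<le> t" using t t1 by simp
      note tJ = J_unbounded[OF t']
      define s where "s = sqrt (P (b t) (x t))"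
      have pos: "b t > 0" "H t > 0" "s > 0" "x t > 0"
        using J_pos[OF tJ] b_pos hubble_pos x_pos[OF tJ] P_x_pos[OF tJ] by (auto simp: s_def)
      have "2 * M * x t \<le> 2 * M * x t1"
        using x_antimono[OF J_unbounded[OF t1(1)] tJ t] M_pos by simp
      then have "e\<^sup>2 * (1 - 2 * M * x t1) \<le> (x t)\<^sup>2 * (1 - 2 * M * x t)"
        using large[OF t'] assms t1 by (intro mult_mono power_mono) auto
      also have "\<dots> \<le> P (b t) (x t)"
        using pos by (simp add: P_def power2_eq_square power3_eq_cube algebra_simps)
      also have "\<dots> = s * s" using P_x_pos[OF tJ] by (simp add: s_def)
      finally have "e\<^sup>2 * (1 - 2 * M * x t1) \<le> s * s" .
      from mult_mono[OF this large[OF t']] have "e\<^sup>2 * (1 - 2 * M * x t1) * e \<le> s * s * x t"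
        using assms pos by simp
      also have "\<dots> \<le> s * x t * (H t + s)" using pos by (simp add: algebra_simps)
      also have "\<dots> \<le> Q t (x t) * sqrt (b t + (x t)\<^sup>2)"
        using Q_lower'[OF J_pos[OF tJ] adm_x[OF tJ]] by (simp add: s_def)
      also have "\<dots> \<le> Q t (x t) * m"
        using Q_pos[OF J_pos[OF tJ] adm_x[OF tJ]] sqrt_bound[OF t'] by (intro mult_left_mono) (auto simp: m_def)
      finally show ?thesis using m by (simp add: \<delta>_def field_simps)
    qed
    define t where "t = t1 + x t1 / \<delta>"
    have t1_pos: "x t1 > 0" using x_pos J_unbounded t1 by simp
    have t: "t1 \<le> t" using t1_pos \<delta> by (simp add: t_def)
    have "x t + \<delta> * t \<le> x t1 + \<delta> * t1"
    proof (rule DERIV_nonpos_imp_nonincreasing[OF t])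
      fix u assume u: "t1 \<le> u" "u \<le> t"
      have "((\<lambda>u. x u + \<delta> * u) has_real_derivative - Q u (x u) + \<delta>) (at u)"
        using u t1 by (auto intro!: derivative_eq_intros x_DERIV J_unbounded)
      then show "\<exists>y. ((\<lambda>u. x u + \<delta> * u) has_real_derivative y) (at u) \<and> y \<le> 0"
        using Q[OF u(1)] by (intro exI[of _ "- Q u (x u) + \<delta>"]) auto
    qed
    moreover have "\<delta> * t = \<delta> * t1 + x t1" using \<delta> by (simp add: t_def field_simps)
    moreover have "x t > 0" using x_pos J_unbounded t t1 by simp
    ultimately show False by simp
  qed
  then obtain t1 where "t1 \<ge> t0" "x t1 < e" by blast
  then have "x t < e" if "t \<ge> t1" for t
    using x_antimono[of t1 t] that J_unbounded by fastforce
  then show ?thesis using \<open>t1 \<ge> t0\<close> by blast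
qed

lemma inverse_x_unbounded: "filterlim (\<lambda>t. 1 / x t) at_top at_top"
  unfolding filterlim_at_top_gt[where c = 0]
proof safe
  fix Z :: real assume Z: "Z > 0"
  obtain t1 where t1: "t1 \<ge> t0" "\<And>t. t \<ge> t1 \<Longrightarrow> x t < 1 / Z"
    using x_eventually_small[of "1 / Z"] Z by auto
  have "Z \<le> 1 / x t" if "t \<ge> t1" for t
    using t1(2)[OF that] x_pos[OF J_unbounded, of t] that t1(1) Z by (simp add: field_simps)
  then show "\<forall>\<^sub>F t in at_top. Z \<le> 1 / x t" by (auto simp: eventually_at_top_linorder)
qed

lemma affine_speed_lower:
  assumes A: "\<And>t. t \<in> J \<Longrightarrow> (A has_real_derivative Fr t (1 / x t)) (at t)"
  shows "\<exists>y0>0. \<exists>t1\<ge>t0. \<forall>t\<ge>t1. y0 \<le> K t (1 / x t) * exp (A t)"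
proof -
  obtain t1 where t1: "t1 \<ge> t0" "\<And>t. t \<ge> t1 \<Longrightarrow> x t < 1 / (4 * M)"
    using x_eventually_small[of "1 / (4 * M)"] M_pos by auto
  define Y where "Y t = b t * I3 (b t) (x t) * exp (A t)" for t
  define y0 where "y0 = Y t1 * exp (- 12 * M * x t1)"
  have Y_pos: "Y t > 0" if "t \<in> J" for t
    using I3_pos[OF adm_x] b_pos[OF J_pos] that by (simp add: Y_def)
  have y0: "y0 > 0" using Y_pos J_unbounded t1 by (simp add: y0_def)
  have "y0 \<le> Y t" if t: "t \<ge> t1" for t
  proof -
    have "Y t1 * exp (- 12 * M * x t1) \<le> Y t * exp (- 12 * M * x t)"
    proof (rule DERIV_nonneg_imp_nondecreasing[OF t])
      fix u assume u: "t1 \<le> u" "u \<le> t"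
      have uJ: "u \<in> J" using J_unbounded u t1 by simp
      have small: "4 * M * x u \<le> 1" using t1(2)[OF u(1)] M_pos by (simp add: field_simps)
      define B where "B = b u * (- 2 * H u * I3 (b u) (x u) + 3 * H u * b u * I5 (b u) (x u)
        - Q u (x u) / sqrt (P (b u) (x u)) ^ 3)"
      have dK: "((\<lambda>u. b u * I3 (b u) (x u)) has_real_derivative B) (at u)"
        by (rule DERIV_cong[OF DERIV_mult[OF b_DERIV[OF J_pos[OF uJ]]
              I3_DERIV[OF adm_x[OF uJ] b_DERIV[OF J_pos[OF uJ]] x_DERIV[OF uJ]]]])
          (simp add: B_def algebra_simps)
      have Fr: "Fr u (1 / x u) = 2 * Q u (x u) / x u - Qx u (x u)" by (simp add: Fr_def)
      have dA: "((\<lambda>u. exp (A u)) has_real_derivative exp (A u) * (2 * Q u (x u) / x u - Qx u (x u))) (at u)"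
        using DERIV_chain2[OF DERIV_exp A[OF uJ]] Fr by simp
      have dE: "((\<lambda>u. exp (- 12 * M * x u)) has_real_derivative exp (- 12 * M * x u) * (12 * M * Q u (x u))) (at u)"
        using DERIV_chain2[OF DERIV_exp DERIV_cmult[OF x_DERIV[OF uJ], of "- 12 * M"]] by simp
      define E where "E = exp (A u) * exp (- 12 * M * x u)"
      have "((\<lambda>u. Y u * exp (- 12 * M * x u)) has_real_derivative
        (B + b u * I3 (b u) (x u) * (2 * Q u (x u) / x u - Qx u (x u))
          + b u * I3 (b u) (x u) * (12 * M * Q u (x u))) * E) (at u)"
        unfolding Y_def
        by (rule DERIV_cong[OF DERIV_mult[OF DERIV_mult[OF dK dA] dE]]) (simp add: E_def algebra_simps)
      moreover have "0 \<le> (B + b u * I3 (b u) (x u) * (2 * Q u (x u) / x u - Qx u (x u))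
          + b u * I3 (b u) (x u) * (12 * M * Q u (x u))) * E"
      proof (rule mult_nonneg_nonneg)
        have "- 6 * M * H u * x u * (b u * I3 (b u) (x u)) \<le> B + b u * I3 (b u) (x u) * (2 * Q u (x u) / x u - Qx u (x u))"
          using affine_rate_lower[OF J_pos[OF uJ] adm_x[OF uJ] small] by (simp add: B_def)
        moreover have "b u * I3 (b u) (x u) * (12 * M) * (H u * x u / 2) \<le> b u * I3 (b u) (x u) * (12 * M) * Q u (x u)"
          using Q_lower_small[OF J_pos[OF uJ] adm_x[OF uJ] small] I3_pos[OF adm_x[OF uJ]] b_pos[OF J_pos[OF uJ]] M_pos
          by (intro mult_left_mono) auto
        ultimately show "0 \<le> B + b u * I3 (b u) (x u) * (2 * Q u (x u) / x u - Qx u (x u))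
          + b u * I3 (b u) (x u) * (12 * M * Q u (x u))" by (simp add: algebra_simps)
      qed (simp add: E_def)
      ultimately show "\<exists>y. ((\<lambda>u. Y u * exp (- 12 * M * x u)) has_real_derivative y) (at u) \<and> 0 \<le> y" by blast
    qed
    also have "\<dots> \<le> Y t * 1"
    proof -
      have tJ: "t \<in> J" using J_unbounded t t1 by simp
      show ?thesis using Y_pos[OF tJ] x_pos[OF tJ] M_pos by (intro mult_left_mono) auto
    qed
    finally show ?thesis by (simp add: y0_def)
  qed
  then show ?thesis using y0 t1(1)
    by (intro exI[of _ y0] exI[of _ t1] conjI) (auto simp: Y_def K_def)
qed

end

section \<open>Affine parametrisation\<close>

text \<open>Serves two changes of parameter: the affine parameter \<open>S\<close> of the
  constructed ray, and the \<open>t\<close>-component of an arbitrary geodesic.\<close>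

lemma inverse_of_increasing:
  fixes S Y :: "real \<Rightarrow> real"
  assumes J: "open J" "is_interval J"
    and S: "\<And>t. t \<in> J \<Longrightarrow> (S has_real_derivative Y t) (at t)" and Y: "\<And>t. t \<in> J \<Longrightarrow> Y t > 0"
  shows "\<And>s t. s \<in> J \<Longrightarrow> t \<in> J \<Longrightarrow> s < t \<Longrightarrow> S s < S t"
    and "open (S ` J)" and "is_interval (S ` J)"
    and "\<And>t. t \<in> J \<Longrightarrow> the_inv_into J S (S t) = t"
    and "\<And>t. t \<in> J \<Longrightarrow> (the_inv_into J S has_real_derivative 1 / Y t) (at (S t))"
proof -
  show less: "S s < S t" if "s \<in> J" "t \<in> J" "s < t" for s t
  proof (rule DERIV_pos_imp_increasing[OF \<open>s < t\<close>])
    fix u assume "s \<le> u" "u \<le> t"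
    then have "u \<in> J" using mem_is_interval_1_I[OF J(2)] that by blast
    then show "\<exists>y. (S has_real_derivative y) (at u) \<and> 0 < y" using S Y by blast
  qed
  have inj: "inj_on S J"
    by (rule linorder_inj_onI') (use less in force)
  have cont: "continuous_on J S"
    by (meson S DERIV_continuous continuous_at_imp_continuous_on)
  show "open (S ` J)" by (rule invariance_of_domain[OF cont J(1) inj])
  show "is_interval (S ` J)"
    using connected_continuous_image[OF cont] J(2) by (simp add: is_interval_connected_1)
  show inv: "the_inv_into J S (S t) = t" if "t \<in> J" for t by (rule the_inv_into_f_f[OF inj that])
  show "(the_inv_into J S has_real_derivative 1 / Y t) (at (S t))" if "t \<in> J" for t
  proof -
    have "(the_inv_into J S has_derivative (*) (1 / Y t)) (at (S t))"
    proof (rule has_derivative_inverse_strong[OF J(1) that cont inv])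
      show "(S has_derivative (*) (Y t)) (at t)" using S[OF that] by (simp add: has_field_derivative_def)
      show "(*) (Y t) \<circ> (*) (1 / Y t) = id" using Y[OF that] by (auto simp: fun_eq_iff)
    qed
    then show ?thesis by (simp add: has_field_derivative_def)
  qed
qed

lemma has_vector_derivative_vector_4:
  fixes f1 f2 f3 f4 :: "real \<Rightarrow> real"
  assumes "(f1 has_real_derivative d1) (at s)" "(f2 has_real_derivative d2) (at s)"
    "(f3 has_real_derivative d3) (at s)" "(f4 has_real_derivative d4) (at s)"
  shows "((\<lambda>s. vector [f1 s, f2 s, f3 s, f4 s] :: real ^ 4) has_vector_derivative vector [d1, d2, d3, d4]) (at s)"
proof -
  have eq: "(vector [p, q, r, t] :: real ^ 4) = p *\<^sub>R axis 1 1 + q *\<^sub>R axis 2 1 + r *\<^sub>R axis 3 1 + t *\<^sub>R axis 4 1"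
    for p q r t
    by (simp add: vec_eq_iff forall_4 axis_def)
  show ?thesis
    unfolding eq
    by (rule has_vector_derivative_eq_rhs, (rule derivative_intros assms)+) simp
qed

lemma has_vector_derivative_nth:
  "(f has_vector_derivative d) (at s) \<Longrightarrow> ((\<lambda>s. f s $ i) has_real_derivative d $ i) (at s)"
  unfolding has_real_derivative_iff_has_vector_derivative
  by (rule bounded_linear.has_vector_derivative[OF bounded_linear_vec_nth])

lemma constant_on_interval:
  fixes f :: "real \<Rightarrow> real"
  assumes "is_interval J" "\<And>s. s \<in> J \<Longrightarrow> (f has_real_derivative 0) (at s)" "s \<in> J" "t \<in> J"
  shows "f s = f t"
proof -
  have "\<exists>c. \<forall>s\<in>J. f s = c"
    using assms(1,2)
    by (intro has_field_derivative_zero_constant) (auto simp: is_interval_convex intro: has_field_derivative_at_within)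
  then show ?thesis using assms(3,4) by auto
qed

context ray_solution
begin

text \<open>\<open>J\<close> is bounded below by \<open>0\<close> and unbounded above, so it is the
  open half-line beyond \<open>Inf J\<close>, where \<open>einterval_antiderivative\<close> applies.
  Times before \<open>t0\<close> are included because the maximal geodesic also extends into the
  past.\<close>

lemma antiderivative:
  assumes "continuous_on J f"
  shows "\<exists>A. \<forall>t\<in>J. (A has_real_derivative f t) (at t)"
proof -
  define c where "c = Inf J"
  have bdd: "bdd_below J" using J_pos by (auto intro!: bdd_belowI[of _ 0] less_imp_le)
  have up: "t \<in> J" if t: "c < t" for t
  proof -
    obtain s where "s \<in> J" "s < t" using cInf_lessD[of J t] t t0 unfolding c_def by blast
    then show ?thesis using J_between[of s "max t t0" t] J_unbounded[of "max t t0"] by simp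
  qed
  have lo: "c < t" if t: "t \<in> J" for t
  proof -
    obtain e where "e > 0" "cball t e \<subseteq> J" using open_J t open_contains_cball by metis
    then have "t - e \<in> J" by (auto simp: cball_eq_atLeastAtMost)
    then show ?thesis using cInf_lower[OF _ bdd, of "t - e"] \<open>e > 0\<close> by (simp add: c_def)
  qed
  have "\<exists>A. \<forall>t::real. ereal c < t \<longrightarrow> t < \<infinity> \<longrightarrow> (A has_vector_derivative f t) (at t)"
    using assms open_J up by (intro einterval_antiderivative) (auto simp: continuous_on_eq_continuous_at)
  then show ?thesis using lo by (simp add: has_real_derivative_iff_has_vector_derivative) blast
qed

lemma x_continuous: "continuous_on J x"
  by (rule ray.solves_continuous[OF sol])

lemma continuous_on_Fr: "continuous_on J (\<lambda>t. Fr t (1 / x t))"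
proof -
  have p: "continuous_on J (\<lambda>t. (t, x t))" by (intro continuous_intros x_continuous)
  have "(\<lambda>t. (t, x t)) ` J \<subseteq> {(t, x). t > 0 \<and> adm (b t) x}" using J_pos adm_x by auto
  from continuous_on_compose2[OF ode_continuous(1) p this] continuous_on_compose2[OF ode_continuous(2) p this]
  have "continuous_on J (\<lambda>t. Q t (x t))" "continuous_on J (\<lambda>t. Qx t (x t))" by simp_all
  moreover have "\<forall>t\<in>J. x t \<noteq> 0" using x_pos by force
  ultimately have "continuous_on J (\<lambda>t. 2 * Q t (x t) / x t - Qx t (x t))"
    by (intro continuous_intros x_continuous)
  then show ?thesis by (simp add: Fr_def)
qed

lemma continuous_on_K: "continuous_on J (\<lambda>t. K t (1 / x t))"
proof -
  have "continuous_on J b"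
    by (rule continuous_on_subset[OF continuous_on_b]) (use J_pos in auto)
  then have "continuous_on J (\<lambda>t. b t * I3 (b t) (x t))"
    by (intro continuous_intros x_continuous adm_x)
  then show ?thesis by (simp add: K_def)
qed

end

text \<open>
  The affine parameter is \<open>S\<close> as a function of \<open>t\<close>: the covariant \<open>r\<close>-component \<open>K dt/ds\<close> of the
  velocity is proportional to \<open>exp (- A)\<close>.
\<close>

locale affine_ray = ray_solution +
  fixes A S :: "real \<Rightarrow> real" and \<theta>0 \<phi>0 :: real
  assumes A_DERIV: "t \<in> J \<Longrightarrow> (A has_real_derivative Fr t (1 / x t)) (at t)"
    and S_DERIV: "t \<in> J \<Longrightarrow> (S has_real_derivative K t (1 / x t) * exp (A t)) (at t)"
    and S_t0: "S t0 = 0"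
    and \<theta>0: "0 < \<theta>0" "\<theta>0 < pi"
begin

definition T :: "real \<Rightarrow> real" where "T = the_inv_into J S"

definition \<gamma> :: "real \<Rightarrow> real ^ 4" where "\<gamma> s = point (T s) (1 / x (T s)) \<theta>0 \<phi>0"

lemma is_interval_J: "is_interval J"
  using sol by (simp add: ray.solves_def)

lemma region_x: "t \<in> J \<Longrightarrow> region t (1 / x t)"
  using J_pos x_pos adm_x by (simp add: region_def)

lemma Y_pos: "t \<in> J \<Longrightarrow> K t (1 / x t) * exp (A t) > 0"
  using K_pos[OF region_x] by simp

lemma S_less: "s \<in> J \<Longrightarrow> t \<in> J \<Longrightarrow> s < t \<Longrightarrow> S s < S t"
  and open_image_S: "open (S ` J)"
  and is_interval_image_S: "is_interval (S ` J)"
  and T_S: "t \<in> J \<Longrightarrow> T (S t) = t"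
  and T_DERIV_S: "t \<in> J \<Longrightarrow> (T has_real_derivative 1 / (K t (1 / x t) * exp (A t))) (at (S t))"
proof -
  note inv = inverse_of_increasing[OF open_J is_interval_J S_DERIV Y_pos, folded T_def]
  show "s \<in> J \<Longrightarrow> t \<in> J \<Longrightarrow> s < t \<Longrightarrow> S s < S t" by (rule inv(1))
  show "open (S ` J)" by (rule inv(2))
  show "is_interval (S ` J)" by (rule inv(3))
  show "t \<in> J \<Longrightarrow> T (S t) = t" by (rule inv(4))
  show "t \<in> J \<Longrightarrow> (T has_real_derivative 1 / (K t (1 / x t) * exp (A t))) (at (S t))" by (rule inv(5))
qed

lemma T_in_J: "s \<in> S ` J \<Longrightarrow> T s \<in> J"
  using T_S by auto

lemma T_DERIV:
  assumes "s \<in> S ` J"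
  shows "(T has_real_derivative 1 / (K (T s) (1 / x (T s)) * exp (A (T s)))) (at s)"
proof -
  obtain t where "t \<in> J" "s = S t" using assms by blast
  then show ?thesis using T_DERIV_S[of t] by (simp add: T_S)
qed

lemma inverse_x_DERIV:
  assumes "t \<in> J" shows "((\<lambda>t. 1 / x t) has_real_derivative F t (1 / x t)) (at t)"
  by (rule DERIV_cong[OF inverse_DERIV[OF x_DERIV[OF assms] x_pos[OF assms]]])
    (simp add: F_def power_one_over)

definition p :: "real \<Rightarrow> real" where "p s = 1 / (K (T s) (1 / x (T s)) * exp (A (T s)))"

definition V :: "real \<Rightarrow> real ^ 4" where "V s = vector [p s, p s * F (T s) (1 / x (T s)), 0, 0]"

lemma r_DERIV:
  assumes "s \<in> S ` J"
  shows "((\<lambda>s. 1 / x (T s)) has_real_derivative F (T s) (1 / x (T s)) * p s) (at s)"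
  using DERIV_chain2[OF inverse_x_DERIV[OF T_in_J[OF assms]] T_DERIV[OF assms]] by (simp add: p_def)

lemma \<gamma>_DERIV:
  assumes "s \<in> S ` J" shows "(\<gamma> has_vector_derivative V s) (at s)"
  unfolding \<gamma>_def point_def V_def
  by (rule has_vector_derivative_eq_rhs,
      rule has_vector_derivative_vector_4[OF T_DERIV[OF assms] r_DERIV[OF assms] DERIV_const DERIV_const])
    (simp add: p_def mult.commute)

text \<open>Since \<open>p = 1 / (K * exp A)\<close> and \<open>A\<close> has derivative
  \<open>Fr\<close> along the ray, differentiation reproduces the acceleration of
  \<open>mcvittie_null_acceleration\<close>; the second component follows from
  \<open>dr/ds = p * F\<close>.\<close>

lemma V_DERIV:
  assumes s: "s \<in> S ` J"
  defines "t \<equiv> T s" and "r \<equiv> 1 / x (T s)"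
  defines "p1 \<equiv> - ((p s)\<^sup>2 * (Kt t r + F t r * Kr t r + K t r * Fr t r)) / K t r"
  shows "(V has_vector_derivative vector [p1, p1 * F t r + (p s)\<^sup>2 * (Ft t r + F t r * Fr t r), 0, 0]) (at s)"
proof -
  have tJ: "t \<in> J" using T_in_J[OF s] by (simp add: t_def)
  have r: "r = 1 / x t" by (simp add: t_def r_def)
  have reg: "region t r" using region_x[OF tJ] by (simp add: r)
  have K: "K t r > 0" by (rule K_pos[OF reg])
  have dT: "(T has_real_derivative p s) (at s)" using T_DERIV[OF s] by (simp add: p_def)
  have dr: "((\<lambda>s. 1 / x (T s)) has_real_derivative F t r * p s) (at s)"
    using r_DERIV[OF s] by (simp add: t_def r_def)
  have dF: "((\<lambda>s. F (T s) (1 / x (T s))) has_real_derivative Ft t r * p s + Fr t r * (F t r * p s)) (at s)"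
    using F_DERIV[OF dT dr] reg by (simp add: t_def r_def)
  have dK: "((\<lambda>s. K (T s) (1 / x (T s))) has_real_derivative Kt t r * p s + Kr t r * (F t r * p s)) (at s)"
    using K_DERIV[OF dT dr] reg by (simp add: t_def r_def)
  have dE: "((\<lambda>s. exp (A (T s))) has_real_derivative exp (A t) * (Fr t r * p s)) (at s)"
    using DERIV_chain2[OF DERIV_exp DERIV_chain2[OF A_DERIV[OF tJ, unfolded t_def] dT]]
    by (simp add: t_def r_def)
  have ps: "p s = 1 / (K t r * exp (A t))" by (simp add: p_def t_def r_def)
  have dp: "(p has_real_derivative p1) (at s)"
    unfolding p_def
    by (rule DERIV_cong[OF inverse_DERIV[OF DERIV_mult[OF dK dE]]], fold t_def r_def)
      (use K in \<open>simp_all add: p1_def ps field_simps power2_eq_square\<close>)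
  show ?thesis
    unfolding V_def
    by (rule has_vector_derivative_eq_rhs, rule has_vector_derivative_vector_4[OF dp DERIV_mult[OF dp dF] DERIV_const DERIV_const],
        fold t_def r_def)
      (simp add: power2_eq_square algebra_simps)
qed

lemma \<gamma>_ORNG: "outgoing_radial_null_geodesic M a (S ` J) \<gamma>"
proof -
  have vel: "velocity \<gamma> s = V s" if "s \<in> S ` J" for s
    using \<gamma>_DERIV[OF that] by (rule vector_derivative_at)
  have comp: "\<gamma> s $ 1 = T s" "\<gamma> s $ 2 = 1 / x (T s)" "\<gamma> s $ 3 = \<theta>0" "\<gamma> s $ 4 = \<phi>0" for s
    by (simp_all add: \<gamma>_def point_def)
  have reg: "region (T s) (1 / x (T s))" if "s \<in> S ` J" for s
    using region_x T_in_J that by blast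
  have space: "\<gamma> s \<in> spacetime M a" if "s \<in> S ` J" for s
    using reg[OF that] \<theta>0 by (simp add: spacetime_def allowed_region_iff comp)
  have p: "p s > 0" if "s \<in> S ` J" for s
    using Y_pos[OF T_in_J[OF that]] by (simp add: p_def)
  show ?thesis
    unfolding outgoing_radial_null_geodesic_def affine_geodesic_on_def null_on_def
  proof (intro conjI ballI)
    show "open (S ` J)" by (rule open_image_S)
    show "is_interval (S ` J)" by (rule is_interval_image_S)
    show "\<exists>\<theta> \<phi>. \<forall>s\<in>S ` J. \<gamma> s $ 3 = \<theta> \<and> \<gamma> s $ 4 = \<phi>" by (simp add: comp)
  next
    fix s assume s: "s \<in> S ` J"
    show "\<gamma> s \<in> spacetime M a" by (rule space[OF s])
    show "\<gamma> differentiable at s"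
      using \<gamma>_DERIV[OF s] by (auto simp: has_vector_derivative_def differentiable_def)
    have "(velocity \<gamma> has_vector_derivative d) (at s)" if "(V has_vector_derivative d) (at s)" for d
      using has_vector_derivative_transform_within_open[OF that open_image_S s] vel by metis
    then show "(velocity \<gamma> has_vector_derivative
       (\<chi> k. - (\<Sum>i\<in>UNIV. \<Sum>j\<in>UNIV. christoffel (mcvittie_metric M a) (\<gamma> s) k i j *
          velocity \<gamma> s $ i * velocity \<gamma> s $ j))) (at s)"
      unfolding vel[OF s]
      by (subst mcvittie_null_acceleration[OF space[OF s], where p = "p s"])
        (use V_DERIV[OF s] in \<open>simp_all add: V_def comp\<close>)
    show "velocity \<gamma> s \<bullet> (mcvittie_metric M a (\<gamma> s) *v velocity \<gamma> s) = 0"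
      using reg[OF s]
      by (simp add: vel[OF s] metric_null_block comp V_def null_block_def inner_vec_def sum_4 matrix_vector_mult_def)
        (simp add: algebra_simps power2_eq_square)
    show "velocity \<gamma> s $ 1 > 0" using p[OF s] by (simp add: vel[OF s] V_def)
    show "velocity \<gamma> s $ 2 / velocity \<gamma> s $ 1 = \<sigma> M a (\<gamma> s $ 1) (\<gamma> s $ 2) *
            (\<gamma> s $ 2 + sqrt (\<kappa> M a (\<gamma> s $ 1) (\<gamma> s $ 2)) / H (\<gamma> s $ 1))"
      unfolding comp F_eq[OF reg[OF s]] using p[OF s] by (simp add: vel[OF s] V_def)
  qed
qed

text \<open>Both integrations are repeated for \<open>\<eta>\<close>. As a curve over
  \<open>t\<close> it solves the ray equation, so maximality puts it on \<open>x\<close>. Then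
  \<open>dt/ds * K * exp A\<close> is a constant of motion \<open>c\<close>, which makes
  \<open>S\<close> along \<open>\<eta>\<close> the linear function \<open>c * s\<close>; this
  constant is the freedom of rescaling.\<close>

lemma ORNG_restriction:
  assumes orng: "outgoing_radial_null_geodesic M a J' \<eta>" and 0: "0 \<in> J'" and init: "\<eta> 0 = point t0 (1 / x t0) \<theta>0 \<phi>0"
  shows "\<exists>c>0. \<forall>s\<in>J'. c * s \<in> S ` J \<and> \<eta> s = \<gamma> (c * s)"
proof -
  define \<tau> \<rho> v where "\<tau> s = \<eta> s $ 1" and "\<rho> s = \<eta> s $ 2" and "v = velocity \<eta>" for s
  have J': "open J'" "is_interval J'"
    using orng by (auto simp: outgoing_radial_null_geodesic_def)
  obtain \<theta> \<phi> where ang: "\<And>s. s \<in> J' \<Longrightarrow> \<eta> s $ 3 = \<theta> \<and> \<eta> s $ 4 = \<phi>"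
    using orng by (auto simp: outgoing_radial_null_geodesic_def)
  have ang0: "\<theta> = \<theta>0" "\<phi> = \<phi>0" using ang[OF 0] init by (simp_all add: point_def)
  have space: "\<eta> s \<in> spacetime M a" if "s \<in> J'" for s
    using orng that by (auto simp: outgoing_radial_null_geodesic_def affine_geodesic_on_def)
  have reg: "region (\<tau> s) (\<rho> s)" if "s \<in> J'" for s
    using space[OF that] by (simp add: spacetime_def allowed_region_iff \<tau>_def \<rho>_def)
  have d\<eta>: "(\<eta> has_vector_derivative v s) (at s)" if "s \<in> J'" for s
    using orng that by (auto simp: outgoing_radial_null_geodesic_def affine_geodesic_on_def v_def
        vector_derivative_works)
  have v1: "v s $ 1 > 0" if "s \<in> J'" for s
    using orng that by (auto simp: outgoing_radial_null_geodesic_def v_def)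
  have v2: "v s $ 2 = v s $ 1 * F (\<tau> s) (\<rho> s)" if "s \<in> J'" for s
  proof -
    have "v s $ 2 / v s $ 1 = F (\<tau> s) (\<rho> s)"
      using orng that F_eq[OF reg[OF that]]
      by (simp add: outgoing_radial_null_geodesic_def v_def \<tau>_def \<rho>_def)
    then show ?thesis using v1[OF that] by (simp add: field_simps)
  qed
  have const: "v s $ i = 0" if "s \<in> J'" "\<And>s. s \<in> J' \<Longrightarrow> \<eta> s $ i = c" for s i c
  proof -
    have "((\<lambda>_. c) has_real_derivative v s $ i) (at s)"
      using has_field_derivative_transform_within_open[OF has_vector_derivative_nth[OF d\<eta>[OF that(1)]] J'(1) that(1)] that(2)
      by metis
    then show ?thesis using DERIV_unique DERIV_const by blast
  qed
  have v34: "v s $ 3 = 0" "v s $ 4 = 0" if "s \<in> J'" for s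
    using const[OF that] ang by blast+
  have d\<tau>: "(\<tau> has_real_derivative v s $ 1) (at s)" "(\<rho> has_real_derivative v s $ 1 * F (\<tau> s) (\<rho> s)) (at s)"
    if "s \<in> J'" for s
    using has_vector_derivative_nth[OF d\<eta>[OF that]] v2[OF that] unfolding \<tau>_def \<rho>_def by metis+
  note inv = inverse_of_increasing[OF J' d\<tau>(1) v1]
  define U where "U = the_inv_into J' \<tau>"
  have U: "U (\<tau> s) = s" "(U has_real_derivative 1 / v s $ 1) (at (\<tau> s))" if "s \<in> J'" for s
    using inv(4,5)[OF _ _ that] unfolding U_def by blast+
  have "ray.solves (\<tau> ` J') (\<lambda>t. 1 / \<rho> (U t))"
    unfolding ray.solves_def
  proof (intro conjI ballI)
    show "open (\<tau> ` J')" "is_interval (\<tau> ` J')" using inv(2,3) by blast+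
    fix t assume "t \<in> \<tau> ` J'"
    then obtain s where s: "s \<in> J'" "t = \<tau> s" by blast
    have \<rho>: "\<rho> s > 0" using reg[OF s(1)] by (simp add: region_def)
    show "(t, 1 / \<rho> (U t)) \<in> {(t, x). t > 0 \<and> adm (b t) x}"
      using reg[OF s(1)] by (simp add: s(2) U(1)[OF s(1)] region_def)
    have "((\<lambda>t. \<rho> (U t)) has_real_derivative v s $ 1 * F (\<tau> s) (\<rho> s) * (1 / v s $ 1)) (at t)"
      unfolding s(2)
      by (rule DERIV_chain2[OF _ U(2)[OF s(1)]]) (use d\<tau>(2)[OF s(1)] U(1)[OF s(1)] in simp)
    from inverse_DERIV[OF this]
    show "((\<lambda>t. 1 / \<rho> (U t)) has_real_derivative - Q t (1 / \<rho> (U t))) (at t)"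
      using \<rho> v1[OF s(1)] by (simp add: s(2) U(1)[OF s(1)] F_def)
  qed
  note max = maximal[OF this _ t0]
  have \<tau>0: "\<tau> 0 = t0" "\<rho> 0 = 1 / x t0" using init by (simp_all add: \<tau>_def \<rho>_def point_def)
  have on_ray: "\<tau> s \<in> J" "\<rho> s = 1 / x (\<tau> s)" if s: "s \<in> J'" for s
  proof -
    have "\<tau> s \<in> J \<and> 1 / \<rho> (U (\<tau> s)) = x (\<tau> s)"
    proof (rule max)
      show "t0 \<in> \<tau> ` J'" using \<tau>0 0 by force
      show "1 / \<rho> (U t0) = x t0" using U(1)[OF 0] \<tau>0 by simp
      show "\<tau> s \<in> \<tau> ` J'" using s by blast
    qed
    moreover have "\<rho> s = 1 / (1 / \<rho> s)" by simp
    ultimately show "\<tau> s \<in> J" "\<rho> s = 1 / x (\<tau> s)" using U(1)[OF s] by auto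
  qed
  have dv: "((\<lambda>s. v s $ 1) has_real_derivative - ((v s $ 1)\<^sup>2 * (Kt (\<tau> s) (\<rho> s) + F (\<tau> s) (\<rho> s) * Kr (\<tau> s) (\<rho> s)
      + K (\<tau> s) (\<rho> s) * Fr (\<tau> s) (\<rho> s))) / K (\<tau> s) (\<rho> s)) (at s)" if s: "s \<in> J'" for s
  proof -
    have "(v has_vector_derivative
       (\<chi> k. - (\<Sum>i\<in>UNIV. \<Sum>j\<in>UNIV. christoffel (mcvittie_metric M a) (\<eta> s) k i j * v s $ i * v s $ j))) (at s)"
      using orng s by (simp add: outgoing_radial_null_geodesic_def affine_geodesic_on_def v_def)
    from has_vector_derivative_nth[OF this, of 1] show ?thesis
      by (subst (asm) mcvittie_null_acceleration[OF space[OF s], where p = "v s $ 1"])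
        (use v2[OF s] v34[OF s] in \<open>simp_all add: \<tau>_def \<rho>_def\<close>)
  qed
  define Y where "Y s = K (\<tau> s) (\<rho> s) * exp (A (\<tau> s))" for s
  have dY: "(Y has_real_derivative (Kt (\<tau> s) (\<rho> s) + F (\<tau> s) (\<rho> s) * Kr (\<tau> s) (\<rho> s)
      + K (\<tau> s) (\<rho> s) * Fr (\<tau> s) (\<rho> s)) * exp (A (\<tau> s)) * v s $ 1) (at s)" if s: "s \<in> J'" for s
  proof -
    have dE: "((\<lambda>s. exp (A (\<tau> s))) has_real_derivative exp (A (\<tau> s)) * (Fr (\<tau> s) (\<rho> s) * v s $ 1)) (at s)"
      using DERIV_chain2[OF DERIV_exp DERIV_chain2[OF A_DERIV[OF on_ray(1)[OF s]] d\<tau>(1)[OF s]]] on_ray(2)[OF s]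
      by simp
    show ?thesis
      unfolding Y_def
      by (rule DERIV_cong[OF DERIV_mult[OF K_DERIV[OF d\<tau>(1,2)[OF s] reg[OF s]] dE]])
        (simp add: algebra_simps)
  qed
  have Y_pos': "Y s > 0" if "s \<in> J'" for s using K_pos[OF reg[OF that]] by (simp add: Y_def)
  define c where "c = v 0 $ 1 * Y 0"
  have c: "c > 0" using v1[OF 0] Y_pos'[OF 0] by (simp add: c_def)
  have vY: "v s $ 1 * Y s = c" if s: "s \<in> J'" for s
    unfolding c_def
  proof (rule constant_on_interval[OF J'(2) _ s 0])
    fix u assume u: "u \<in> J'"
    \<comment> \<open>\<open>dv\<close> and \<open>dY\<close> contain the same bracket with opposite
      signs, so the product rule gives \<open>0\<close>.\<close>
    show "((\<lambda>s. v s $ 1 * Y s) has_real_derivative 0) (at u)"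
      by (rule DERIV_cong[OF DERIV_mult[OF dv[OF u] dY[OF u]]])
        (use K_pos[OF reg[OF u]] in \<open>simp add: Y_def field_simps power2_eq_square\<close>)
  qed
  have Sc: "S (\<tau> s) = c * s" if s: "s \<in> J'" for s
  proof -
    have "S (\<tau> s) - c * s = S (\<tau> 0) - c * 0"
    proof (rule constant_on_interval[OF J'(2) _ s 0])
      fix u assume u: "u \<in> J'"
      have "((\<lambda>s. S (\<tau> s)) has_real_derivative Y u * v u $ 1) (at u)"
        using DERIV_chain2[OF S_DERIV[OF on_ray(1)[OF u]] d\<tau>(1)[OF u]] on_ray(2)[OF u] by (simp add: Y_def)
      then have "((\<lambda>s. S (\<tau> s) - c * s) has_real_derivative Y u * v u $ 1 - c * 1) (at u)"
        by (intro DERIV_diff DERIV_cmult DERIV_ident)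
      then show "((\<lambda>s. S (\<tau> s) - c * s) has_real_derivative 0) (at u)"
        using vY[OF u] by (simp add: mult.commute)
    qed
    then show ?thesis by (simp add: \<tau>0 S_t0)
  qed
  show ?thesis
  proof (intro exI[of _ c] conjI ballI c)
    fix s assume s: "s \<in> J'"
    show "c * s \<in> S ` J" using Sc[OF s] on_ray(1)[OF s] by force
    have "T (c * s) = \<tau> s" using T_S[OF on_ray(1)[OF s]] Sc[OF s] by simp
    then show "\<eta> s = \<gamma> (c * s)"
      using on_ray(2)[OF s] ang[OF s] ang0
      by (simp add: vec_eq_iff forall_4 \<gamma>_def point_def \<tau>_def \<rho>_def)
  qed
qed

section \<open>Future completeness and the limits of the coordinates\<close>

lemma S_unbounded: "\<exists>t\<ge>t0. Z \<le> S t"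
proof -
  obtain y0 t1 where y: "y0 > 0" "t1 \<ge> t0" "\<And>t. t \<ge> t1 \<Longrightarrow> y0 \<le> K t (1 / x t) * exp (A t)"
    using affine_speed_lower[of A] A_DERIV by blast
  define t where "t = t1 + max 0 ((Z - S t1) / y0)"
  have t: "t1 \<le> t" by (simp add: t_def)
  have "S t1 - y0 * t1 \<le> S t - y0 * t"
  proof (rule DERIV_nonneg_imp_nondecreasing[OF t])
    fix u assume u: "t1 \<le> u" "u \<le> t"
    have "((\<lambda>u. S u - y0 * u) has_real_derivative K u (1 / x u) * exp (A u) - y0 * 1) (at u)"
      using u y by (intro DERIV_diff DERIV_cmult DERIV_ident S_DERIV J_unbounded) simp
    then show "\<exists>d. ((\<lambda>u. S u - y0 * u) has_real_derivative d) (at u) \<and> 0 \<le> d"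
      using y(3)[OF u(1)] by (intro exI[of _ "K u (1 / x u) * exp (A u) - y0 * 1"]) auto
  qed
  moreover have "(Z - S t1) / y0 * y0 \<le> (t - t1) * y0"
    using y(1) by (intro mult_right_mono) (auto simp: t_def)
  moreover have "(Z - S t1) / y0 * y0 = Z - S t1" using y(1) by simp
  ultimately have "Z \<le> S t" by (simp add: algebra_simps)
  then show ?thesis using t y(2) by (intro exI[of _ t]) auto
qed

lemma future_complete: "{0..} \<subseteq> S ` J"
proof
  fix s :: real assume s: "s \<in> {0..}"
  obtain t where t: "t \<ge> t0" "s \<le> S t" using S_unbounded by blast
  have "S t0 \<in> S ` J" "S t \<in> S ` J" using t0 J_unbounded[OF t(1)] by simp_all
  moreover have "S t0 \<le> s" using s S_t0 by simp
  ultimately show "s \<in> S ` J" using mem_is_interval_1_I[OF is_interval_image_S] t(2) by blast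
qed

lemma T_at_top: "filterlim T at_top at_top"
  unfolding filterlim_at_top
proof
  fix Z
  define t where "t = max Z t0"
  have tJ: "t \<in> J" using J_unbounded by (simp add: t_def)
  have "Z \<le> T s" if s: "s \<ge> max 0 (S t)" for s
  proof -
    have "s \<in> S ` J" using s future_complete by auto
    then obtain u where u: "u \<in> J" "s = S u" by blast
    have "t \<le> u" using S_less[OF u(1) tJ] s u by force
    then show ?thesis using T_S[OF u(1)] u by (simp add: t_def)
  qed
  then show "\<forall>\<^sub>F s in at_top. Z \<le> T s" unfolding eventually_at_top_linorder by blast
qed

lemma ray_complete:
  "unique_ORNG_through M a (point t0 (1 / x t0) \<theta>0 \<phi>0) (S ` J) \<gamma>"
  "filterlim (\<lambda>s. \<gamma> s $ 1) at_top at_top" "filterlim (\<lambda>s. \<gamma> s $ 2) at_top at_top"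
proof -
  have "T 0 = t0" using T_S[OF t0] S_t0 by simp
  then show "unique_ORNG_through M a (point t0 (1 / x t0) \<theta>0 \<phi>0) (S ` J) \<gamma>"
    unfolding unique_ORNG_through_def
    using \<gamma>_ORNG future_complete ORNG_restriction by (auto simp: \<gamma>_def)
  show "filterlim (\<lambda>s. \<gamma> s $ 1) at_top at_top" using T_at_top by (simp add: \<gamma>_def point_def)
  show "filterlim (\<lambda>s. \<gamma> s $ 2) at_top at_top"
    using filterlim_compose[OF inverse_x_unbounded T_at_top] by (simp add: \<gamma>_def point_def)
qed

end

theorem proposition7p1:
  fixes M \<Lambda> t0 r0 \<theta>0 \<phi>0 :: real and a :: "real \<Rightarrow> real"
  assumes "M > 0"
    and "\<forall>\<epsilon>\<in>{0<..1}. K_bar \<epsilon> > 0"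
    and "eternally_expanding \<Lambda> a"
    and "(t0, r0) \<in> allowed_region M a"
    and "0 < \<theta>0" and "\<theta>0 < pi"
  shows "\<exists>I \<gamma>. unique_ORNG_through M a (point t0 r0 \<theta>0 \<phi>0) I \<gamma> \<and>
    {0..} \<subseteq> I \<and>
    filterlim (\<lambda>s. \<gamma> s $ 1) at_top at_top \<and>
    filterlim (\<lambda>s. \<gamma> s $ 2) at_top at_top"
proof -
  interpret expanding M a
    using assms(1,3) by unfold_locales (auto simp: eternally_expanding_def C2_on_def)
  have reg: "region t0 r0" using assms(4) by (simp add: allowed_region_iff)
  then have "(t0, 1 / r0) \<in> {(t, x). t > 0 \<and> adm (b t) x}" by (simp add: region_def)
  then have "\<exists>J x. x t0 = 1 / r0 \<and> ray_solution M a J x t0"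
  proof (rule ray.maximal_solution)
    fix J x
    assume "ray.solves J x" "t0 \<in> J" "x t0 = 1 / r0"
      "\<And>J' v t1 t. ray.solves J' v \<Longrightarrow> t1 \<in> J' \<Longrightarrow> t1 \<in> J \<Longrightarrow> v t1 = x t1 \<Longrightarrow> t \<in> J' \<Longrightarrow> t \<in> J \<and> v t = x t"
    then have "ray_solution M a J x t0" by unfold_locales
    then show ?thesis using \<open>x t0 = 1 / r0\<close> by blast
  qed
  then obtain J x where x0: "x t0 = 1 / r0" and "ray_solution M a J x t0" by blast
  then interpret ray_solution M a J x t0 by simp
  \<comment> \<open>The additive constant in \<open>A\<close> is arbitrary: it multiplies the
    derivative of \<open>S\<close> by a positive factor, which is the rescaling freedom of an affine
    parameter. Subtracting \<open>S t0\<close> afterwards fixes the origin.\<close>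
  obtain A where A: "\<And>t. t \<in> J \<Longrightarrow> (A has_real_derivative Fr t (1 / x t)) (at t)"
    using antiderivative[OF continuous_on_Fr] by blast
  have "continuous_on J A" using A by (meson DERIV_continuous continuous_at_imp_continuous_on)
  then have "continuous_on J (\<lambda>t. K t (1 / x t) * exp (A t))"
    by (intro continuous_intros continuous_on_K)
  then obtain S where S: "\<And>t. t \<in> J \<Longrightarrow> (S has_real_derivative K t (1 / x t) * exp (A t)) (at t)"
    using antiderivative by blast
  have S0: "((\<lambda>t. S t - S t0) has_real_derivative K t (1 / x t) * exp (A t)) (at t)" if "t \<in> J" for t
    using DERIV_diff[OF S[OF that] DERIV_const] by simp
  interpret affine_ray M a J x t0 A "\<lambda>t. S t - S t0" \<theta>0 \<phi>0
    by unfold_locales (rule A S0 assms(5,6) diff_self | assumption)+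
  show ?thesis
    using ray_complete future_complete x0 by auto
qed

end
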